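(* Let $k$ be a perfect field of characteristic $p>0$, let $G$ be a finite group with a local action $\rho\colon G\to\operatorname{Aut}_k k[[t]]$, and let $N$ be a normal subgroup of $G$. Consider the morphism $\Phi=(\mathrm{res},\mathrm{ind})\colon D_G\to D_N^{G/N}\times D_{G/N}$ and the map it induces on tangent spaces $$\Phi_{k[\varepsilon]}\colon \mathrm{H}^1(G,\Theta)\to\mathrm{H}^1(N,\Theta)^{G/N}\times\mathrm{H}^1(G/N,\Theta^\sharp).$$ Then: (i) $\ker\Phi_{k[\varepsilon]}=\operatorname{coker}\bigl(\Theta_1^G\to(\Theta_1^N/\Theta^N)^{G/N}\bigr)$ (the identification being given by the connecting homomorphism of $0\to\Theta^N\to\Theta_1^N\to\Theta_1^N/\Theta^N\to0$ followed by inflation $\mathrm{H}^1(G/N,\Theta^N)\hookrightarrow \mathrm{H}^1(G,\Theta)$); (ii) $\operatorname{im}\Phi_{k[\varepsilon]}=\mathrm{H}^1(N,\Theta)^{G/N}\times_{\mathrm{H}^1(G/N,\Theta^\sharp/\Theta^N)}\mathrm{H}^1(G/N,\Theta^\sharp)$, where the fibered product is taken with respect to the maps $\gamma\colon\mathrm{H}^1(N,\Theta)^{G/N}\to\mathrm{H}^1(G/N,\Theta^\sharp/\Theta^N)$ and $\sigma\colon\mathrm{H}^1(G/N,\Theta^\sharp)\to\mathrm{H}^1(G/N,\Theta^\sharp/\Theta^N)$ defined in the context.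
   Context: **Deformation functors.** $\mathcal C$ is the category of local artinian $W(k)$-algebras with residue field $k$, with local $W(k)$-algebra homomorphisms. Write $\Gamma_A=\operatorname{Aut}_A A[[t]]$. A local $G$-action is an injective homomorphism $\rho\colon G\to\Gamma_k$. A lift of $\rho$ to $A\in\mathcal C$ is a homomorphism $\rho_A\colon G\to\Gamma_A$ reducing to $\rho$ modulo $\mathfrak m_A$; two lifts are equivalent if conjugate by an element of $\ker(\Gamma_A\to\Gamma_k)$. $D_G(A)$ is the set of equivalence classes of lifts of $\rho$ to $A$; $D_N$ is the analogous functor for $\rho|_N$. **Restriction.** $G/N$ acts on $D_N$: $g_*[\rho_A]$ is the class of $n\mapsto r_g\rho_A(g^{-1}ng)r_g^{-1}$, with $r_g\in\Gamma_A$ any lift of $\rho(g)$. $D_N^{G/N}$ is the subfunctor of invariants; restricting lifts to $N$ gives $\mathrm{res}\colon D_G\to D_N^{G/N}$. **Induction.** $k[[t]]^N=k[[y_N]]$ with $y_N=\prod_{s\in N}\rho(s)(t)$, and $\rho$ induces a local $G/N$-action $\rho^\sharp$ on $k[[y_N]]$; $D_{G/N}$ is its deformation functor. For a lift $\rho_A$ of $\rho$, $A[[t]]^N=A[[y_A]]$ with $y_A=\prod_{s\in N}\rho_A(s)(t)$; restricting the $\rho_A(g)$ to $A[[t]]^N\cong A[[y]]$ ($y\mapsto y_A$) gives a lift $\rho_A^\sharp$ of $\rho^\sharp$, and $\mathrm{ind}\colon D_G\to D_{G/N}$ sends $[\rho_A]$ to $[\rho_A^\sharp]$. **Modules.** $\Theta=\operatorname{Der}_k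 k[[t]]$ with $d^g=\rho(g)\,d\,\rho(g)^{-1}$; $\Theta^\sharp=\operatorname{Der}_k(k[[t]]^N)$ with $d^{\bar g}=\rho^\sharp(\bar g)\,d\,\rho^\sharp(\bar g)^{-1}$. Restricting derivations gives $\Theta^N\hookrightarrow\Theta^\sharp$. Let $y_G=\prod_{g\in G}\rho(g)(t)$, so $k[[t]]^G=k[[y_G]]$. Write $\mathcal D_{S/R}$ for the different. The maps $d\mapsto d(y_G)$ identify $\Theta$ with the ideal $\mathcal D_{k[[t]]/k[[t]]^G}$ of $k[[t]]$ and $\Theta^\sharp$ with the ideal $\mathcal D_{k[[t]]^N/k[[t]]^G}$ of $k[[t]]^N$, compatibly with group actions and with $\Theta^N\hookrightarrow\Theta^\sharp$. Let $\Theta_1=\mathcal D_{k[[t]]^N/k[[t]]^G}\cdot k[[t]]$, a $G$-module via $\rho$; then $\Theta\subseteq\Theta_1$ and $\Theta_1^N=\Theta^\sharp$. **Tangent spaces.** $k[\varepsilon]=k[w]/w^2$. $D_G(k[\varepsilon])$ is identified with $\mathrm{H}^1(G,\Theta)$: the class of a 1-cocycle $(d_g)$ corresponds to the class of the lift $\rho_A(g)(x)=\rho(g)(x)+\varepsilon d_g(\rho(g)(x))$, $x\in k[[t]]$. Likewise $D_N^{G/N}(k[\varepsilon])=\mathrm{H}^1(N,\Theta)^{G/N}$ and $D_{G/N}(k[\varepsilon])=\mathrm{H}^1(G/N,\Theta^\sharp)$. **The maps $\sigma$ and $\gamma$.** $\sigma$ is induced by $\Theta^\sharp\to\Theta^\sharp/\Theta^N$.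 The map $\mathrm{H}^1(N,\Theta)\to\mathrm{H}^1(N,\Theta_1)$ is zero, so $0\to\Theta\to\Theta_1\to\Theta_1/\Theta\to0$ yields a short exact sequence of $G/N$-modules $0\to\Theta_1^N/\Theta^N\to(\Theta_1/\Theta)^N\to\mathrm{H}^1(N,\Theta)\to0$. $\gamma$ is minus the connecting homomorphism $\mathrm{H}^1(N,\Theta)^{G/N}\to\mathrm{H}^1(G/N,\Theta_1^N/\Theta^N)=\mathrm{H}^1(G/N,\Theta^\sharp/\Theta^N)$ of this sequence. *)

theory Defs
  imports
    "HOL-Algebra.Coset"
    "HOL-Computational_Algebra.Formal_Laurent_Series"
begin

section \<open>Automorphisms of power series rings and deformation functors\<close>

text \<open>
  \<open>\<Gamma>\<close> is the group of \<open>A\<close>-algebra automorphisms of \<open>A[[t]]\<close>, where \<open>A\<close> is the type \<open>'a\<close>.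
  An object \<open>A\<close> of the category of local artinian \<open>W(k)\<close>-algebras with residue field \<open>k\<close> enters
  the definitions below only through its underlying ring and its residue map \<open>\<pi> : A \<rightarrow> k\<close>.
\<close>

definition Aut_fps :: "('a::comm_ring_1 fps \<Rightarrow> 'a fps) monoid" (\<open>\<Gamma>\<close>) where
  "\<Gamma> = \<lparr>carrier = {\<phi>. bij \<phi> \<and> (\<forall>f g. \<phi> (f + g) = \<phi> f + \<phi> g) \<and> (\<forall>f g. \<phi> (f * g) = \<phi> f * \<phi> g)
                      \<and> (\<forall>a. \<phi> (fps_const a) = fps_const a)},
        monoid.mult = (\<circ>), one = id\<rparr>"

definition local_action ::
    "('g, 'b) monoid_scheme \<Rightarrow> ('g \<Rightarrow> 'k::field fps \<Rightarrow> 'k fps) \<Rightarrow> bool" where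
  "local_action G \<rho> \<longleftrightarrow> \<rho> \<in> hom G \<Gamma> \<and> inj_on \<rho> (carrier G)"

definition fps_map :: "('a \<Rightarrow> 'b) \<Rightarrow> 'a fps \<Rightarrow> 'b fps" where
  "fps_map \<pi> f = Abs_fps (\<lambda>n. \<pi> (f $ n))"

definition reduces_to ::
    "('a \<Rightarrow> 'k) \<Rightarrow> ('a fps \<Rightarrow> 'a fps) \<Rightarrow> ('k fps \<Rightarrow> 'k fps) \<Rightarrow> bool" where
  "reduces_to \<pi> \<phi> \<psi> \<longleftrightarrow> (\<forall>f. fps_map \<pi> (\<phi> f) = \<psi> (fps_map \<pi> f))"

definition lifts ::
    "('g, 'b) monoid_scheme \<Rightarrow> ('g \<Rightarrow> 'k::field fps \<Rightarrow> 'k fps) \<Rightarrow> ('a::comm_ring_1 \<Rightarrow> 'k)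
      \<Rightarrow> ('g \<Rightarrow> 'a fps \<Rightarrow> 'a fps) set" where
  "lifts G \<rho> \<pi> = {\<rho>\<^sub>A \<in> hom G \<Gamma>. \<rho>\<^sub>A \<in> extensional (carrier G) \<and>
                     (\<forall>g\<in>carrier G. reduces_to \<pi> (\<rho>\<^sub>A g) (\<rho> g))}"

definition lift_equiv ::
    "('g, 'b) monoid_scheme \<Rightarrow> ('g \<Rightarrow> 'k::field fps \<Rightarrow> 'k fps) \<Rightarrow> ('a::comm_ring_1 \<Rightarrow> 'k)
      \<Rightarrow> (('g \<Rightarrow> 'a fps \<Rightarrow> 'a fps) \<times> ('g \<Rightarrow> 'a fps \<Rightarrow> 'a fps)) set" where
  "lift_equiv G \<rho> \<pi> = {(\<sigma>, \<tau>). \<sigma> \<in> lifts G \<rho> \<pi> \<and> \<tau> \<in> lifts G \<rho> \<pi> \<and>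
     (\<exists>u\<in>carrier \<Gamma>. reduces_to \<pi> u id \<and>
        (\<forall>g\<in>carrier G. \<tau> g = u \<otimes>\<^bsub>\<Gamma>\<^esub> \<sigma> g \<otimes>\<^bsub>\<Gamma>\<^esub> inv\<^bsub>\<Gamma>\<^esub> u))}"

text \<open>\<open>D\<^sub>G(A)\<close>:\<close>

definition def_functor ::
    "('g, 'b) monoid_scheme \<Rightarrow> ('g \<Rightarrow> 'k::field fps \<Rightarrow> 'k fps) \<Rightarrow> ('a::comm_ring_1 \<Rightarrow> 'k)
      \<Rightarrow> ('g \<Rightarrow> 'a fps \<Rightarrow> 'a fps) set set" where
  "def_functor G \<rho> \<pi> = lifts G \<rho> \<pi> // lift_equiv G \<rho> \<pi>"

abbreviation subgrp :: "('g, 'b) monoid_scheme \<Rightarrow> 'g set \<Rightarrow> ('g, 'b) monoid_scheme" where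
  "subgrp G N \<equiv> G\<lparr>carrier := N\<rparr>"


subsection \<open>Restriction\<close>

definition res_map ::
    "('g, 'b) monoid_scheme \<Rightarrow> 'g set \<Rightarrow> ('g \<Rightarrow> 'k::field fps \<Rightarrow> 'k fps) \<Rightarrow> ('a::comm_ring_1 \<Rightarrow> 'k)
      \<Rightarrow> ('g \<Rightarrow> 'a fps \<Rightarrow> 'a fps) set \<Rightarrow> ('g \<Rightarrow> 'a fps \<Rightarrow> 'a fps) set" where
  "res_map G N \<rho> \<pi> c = lift_equiv (subgrp G N) \<rho> \<pi> `` ((\<lambda>\<rho>\<^sub>A. restrict \<rho>\<^sub>A N) ` c)"

text \<open>The action \<open>g\<^sub>*\<close> of \<open>G/N\<close> on \<open>D\<^sub>N(A)\<close>; \<open>r\<close> ranges over all lifts of \<open>\<rho>(g)\<close>.\<close>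

definition def_act ::
    "('g, 'b) monoid_scheme \<Rightarrow> 'g set \<Rightarrow> ('g \<Rightarrow> 'k::field fps \<Rightarrow> 'k fps) \<Rightarrow> ('a::comm_ring_1 \<Rightarrow> 'k)
      \<Rightarrow> 'g \<Rightarrow> ('g \<Rightarrow> 'a fps \<Rightarrow> 'a fps) set \<Rightarrow> ('g \<Rightarrow> 'a fps \<Rightarrow> 'a fps) set" where
  "def_act G N \<rho> \<pi> g c = lift_equiv (subgrp G N) \<rho> \<pi> ``
     {(\<lambda>n\<in>N. r \<otimes>\<^bsub>\<Gamma>\<^esub> \<rho>\<^sub>A (inv\<^bsub>G\<^esub> g \<otimes>\<^bsub>G\<^esub> n \<otimes>\<^bsub>G\<^esub> g) \<otimes>\<^bsub>\<Gamma>\<^esub> inv\<^bsub>\<Gamma>\<^esub> r) | \<rho>\<^sub>A r.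
        \<rho>\<^sub>A \<in> c \<and> r \<in> carrier \<Gamma> \<and> reduces_to \<pi> r (\<rho> g)}"

text \<open>\<open>D\<^sub>N\<^sup>G\<^sup>/\<^sup>N(A)\<close>, the codomain of \<open>res\<close>:\<close>

definition def_functor_inv ::
    "('g, 'b) monoid_scheme \<Rightarrow> 'g set \<Rightarrow> ('g \<Rightarrow> 'k::field fps \<Rightarrow> 'k fps) \<Rightarrow> ('a::comm_ring_1 \<Rightarrow> 'k)
      \<Rightarrow> ('g \<Rightarrow> 'a fps \<Rightarrow> 'a fps) set set" where
  "def_functor_inv G N \<rho> \<pi> =
     {c \<in> def_functor (subgrp G N) \<rho> \<pi>. \<forall>g\<in>carrier G. def_act G N \<rho> \<pi> g c = c}"

subsection \<open>Restriction takes values in \<open>D\<^sub>N\<^sup>G\<^sup>/\<^sup>N\<close>\<close>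

lemma group_Aut_fps: "group (\<Gamma> :: ('a::comm_ring_1 fps \<Rightarrow> 'a fps) monoid)"
proof (rule groupI)
  fix \<phi> :: "'a fps \<Rightarrow> 'a fps" assume "\<phi> \<in> carrier \<Gamma>"
  then have b: "bij \<phi>" and a: "\<And>f g. \<phi> (f + g) = \<phi> f + \<phi> g"
    and m: "\<And>f g. \<phi> (f * g) = \<phi> f * \<phi> g" and c: "\<And>a. \<phi> (fps_const a) = fps_const a"
    by (auto simp: Aut_fps_def)
  have s: "\<phi> (inv_into UNIV \<phi> f) = f" for f
    using b by (meson bij_is_surj surj_f_inv_f)
  have i: "inv_into UNIV \<phi> (\<phi> f) = f" for f
    using b by (meson bij_is_inj inv_f_f)
  have "inv_into UNIV \<phi> \<in> carrier \<Gamma>"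
    unfolding Aut_fps_def using b bij_imp_bij_inv[OF b]
    by (simp, metis a m c s i)
  moreover have "inv_into UNIV \<phi> \<circ> \<phi> = id" using i by auto
  ultimately show "\<exists>\<psi>\<in>carrier \<Gamma>. \<psi> \<otimes>\<^bsub>\<Gamma>\<^esub> \<phi> = \<one>\<^bsub>\<Gamma>\<^esub>"
    by (auto simp: Aut_fps_def)
qed (auto simp: Aut_fps_def bij_comp)

lemma Aut_fps_mult: "(\<phi> \<otimes>\<^bsub>\<Gamma>\<^esub> \<psi>) f = \<phi> (\<psi> f)"
  by (simp add: Aut_fps_def)

lemma Aut_fps_inv: "\<phi> \<in> carrier \<Gamma> \<Longrightarrow> \<phi> ((inv\<^bsub>\<Gamma>\<^esub> \<phi>) f) = f"
  using group.r_inv[OF group_Aut_fps, of \<phi>] Aut_fps_mult[of \<phi> "inv\<^bsub>\<Gamma>\<^esub> \<phi>" f]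
  by (simp add: Aut_fps_def)

lemma reduces_to_id_inv:
  assumes "u \<in> carrier \<Gamma>" "reduces_to \<pi> u id"
  shows "reduces_to \<pi> (inv\<^bsub>\<Gamma>\<^esub> u) id"
  using assms Aut_fps_inv[OF assms(1)] unfolding reduces_to_def by (metis id_apply)

lemma lift_conj:
  fixes G :: "('g, 'b) monoid_scheme" and \<pi> :: "'a::comm_ring_1 \<Rightarrow> 'k::field"
  assumes "group G" and \<sigma>: "\<sigma> \<in> lifts G \<rho> \<pi>" and w: "w \<in> carrier \<Gamma>" "reduces_to \<pi> w id"
  shows "(\<sigma>, \<lambda>g\<in>carrier G. w \<otimes>\<^bsub>\<Gamma>\<^esub> \<sigma> g \<otimes>\<^bsub>\<Gamma>\<^esub> inv\<^bsub>\<Gamma>\<^esub> w) \<in> lift_equiv G \<rho> \<pi>"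
proof -
  interpret A: group "\<Gamma> :: ('a fps \<Rightarrow> 'a fps) monoid" by (rule group_Aut_fps)
  interpret G: group G by fact
  let ?\<tau> = "\<lambda>g\<in>carrier G. w \<otimes>\<^bsub>\<Gamma>\<^esub> \<sigma> g \<otimes>\<^bsub>\<Gamma>\<^esub> inv\<^bsub>\<Gamma>\<^esub> w"
  have h: "\<sigma> \<in> hom G \<Gamma>" using \<sigma> by (simp add: lifts_def)
  have c: "\<sigma> g \<in> carrier \<Gamma>" if "g \<in> carrier G" for g
    using h that by (auto simp: hom_def)
  have "?\<tau> \<in> hom G \<Gamma>"
  proof (rule homI)
    fix x y assume xy: "x \<in> carrier G" "y \<in> carrier G"
    have "w \<otimes>\<^bsub>\<Gamma>\<^esub> (\<sigma> x \<otimes>\<^bsub>\<Gamma>\<^esub> \<sigma> y) \<otimes>\<^bsub>\<Gamma>\<^esub> inv\<^bsub>\<Gamma>\<^esub> w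
        = (w \<otimes>\<^bsub>\<Gamma>\<^esub> \<sigma> x \<otimes>\<^bsub>\<Gamma>\<^esub> inv\<^bsub>\<Gamma>\<^esub> w) \<otimes>\<^bsub>\<Gamma>\<^esub> (w \<otimes>\<^bsub>\<Gamma>\<^esub> \<sigma> y \<otimes>\<^bsub>\<Gamma>\<^esub> inv\<^bsub>\<Gamma>\<^esub> w)"
      using c[OF xy(1)] c[OF xy(2)] w(1) by (simp add: A.m_assoc A.inv_solve_left' flip: A.m_assoc[of "inv\<^bsub>\<Gamma>\<^esub> w" w])
    then show "?\<tau> (x \<otimes>\<^bsub>G\<^esub> y) = ?\<tau> x \<otimes>\<^bsub>\<Gamma>\<^esub> ?\<tau> y"
      using xy hom_mult[OF h xy] by simp
  qed (use c w in auto)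
  moreover have "reduces_to \<pi> (?\<tau> g) (\<rho> g)" if g: "g \<in> carrier G" for g
    using \<sigma> g w(2) reduces_to_id_inv[OF w]
    by (simp add: lifts_def reduces_to_def Aut_fps_mult)
  ultimately have "?\<tau> \<in> lifts G \<rho> \<pi>" by (simp add: lifts_def)
  then show ?thesis using \<sigma> w unfolding lift_equiv_def by auto
qed

lemma equiv_lift_equiv:
  fixes G :: "('g, 'b) monoid_scheme" and \<pi> :: "'a::comm_ring_1 \<Rightarrow> 'k::field"
  assumes "group G"
  shows "equiv (lifts G \<rho> \<pi>) (lift_equiv G \<rho> \<pi>)"
proof (rule equivI)
  interpret A: group "\<Gamma> :: ('a fps \<Rightarrow> 'a fps) monoid" by (rule group_Aut_fps)
  have c: "\<sigma> g \<in> carrier \<Gamma>" if "\<sigma> \<in> lifts G \<rho> \<pi>" "g \<in> carrier G" for \<sigma> g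
    using that by (auto simp: lifts_def hom_def)
  show "lift_equiv G \<rho> \<pi> \<subseteq> lifts G \<rho> \<pi> \<times> lifts G \<rho> \<pi>"
    by (auto simp: lift_equiv_def)
  have one: "reduces_to \<pi> \<one>\<^bsub>\<Gamma>\<^esub> id" by (simp add: reduces_to_def Aut_fps_def)
  show "refl_on (lifts G \<rho> \<pi>) (lift_equiv G \<rho> \<pi>)"
    unfolding refl_on_def lift_equiv_def
    by (auto intro!: bexI[of _ "\<one>\<^bsub>\<Gamma>\<^esub>"] simp: one c)
  show "sym (lift_equiv G \<rho> \<pi>)"
  proof (rule symI)
    fix \<sigma> \<tau> assume "(\<sigma>, \<tau>) \<in> lift_equiv G \<rho> \<pi>"
    then obtain u where u: "\<sigma> \<in> lifts G \<rho> \<pi>" "\<tau> \<in> lifts G \<rho> \<pi>" "u \<in> carrier \<Gamma>" "reduces_to \<pi> u id"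
      and e: "\<And>g. g \<in> carrier G \<Longrightarrow> \<tau> g = u \<otimes>\<^bsub>\<Gamma>\<^esub> \<sigma> g \<otimes>\<^bsub>\<Gamma>\<^esub> inv\<^bsub>\<Gamma>\<^esub> u"
      by (auto simp: lift_equiv_def)
    have "\<sigma> g = inv\<^bsub>\<Gamma>\<^esub> u \<otimes>\<^bsub>\<Gamma>\<^esub> \<tau> g \<otimes>\<^bsub>\<Gamma>\<^esub> inv\<^bsub>\<Gamma>\<^esub> (inv\<^bsub>\<Gamma>\<^esub> u)" if g: "g \<in> carrier G" for g
    proof -
      have "inv\<^bsub>\<Gamma>\<^esub> u \<otimes>\<^bsub>\<Gamma>\<^esub> (u \<otimes>\<^bsub>\<Gamma>\<^esub> \<sigma> g \<otimes>\<^bsub>\<Gamma>\<^esub> inv\<^bsub>\<Gamma>\<^esub> u) \<otimes>\<^bsub>\<Gamma>\<^esub> u = \<sigma> g"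
        using c[OF u(1) g] u(3) by (metis A.inv_closed A.inv_solve_left A.inv_solve_right A.m_assoc A.m_closed)
      then show ?thesis using e[OF g] u(3) by simp
    qed
    then show "(\<tau>, \<sigma>) \<in> lift_equiv G \<rho> \<pi>"
      using u reduces_to_id_inv[OF u(3,4)] unfolding lift_equiv_def
      by (auto intro!: bexI[of _ "inv\<^bsub>\<Gamma>\<^esub> u"])
  qed
  show "trans (lift_equiv G \<rho> \<pi>)"
  proof (rule transI)
    fix \<sigma> \<tau> \<upsilon> assume "(\<sigma>, \<tau>) \<in> lift_equiv G \<rho> \<pi>" "(\<tau>, \<upsilon>) \<in> lift_equiv G \<rho> \<pi>"
    then obtain u v where u: "\<sigma> \<in> lifts G \<rho> \<pi>" "\<tau> \<in> lifts G \<rho> \<pi>" "u \<in> carrier \<Gamma>" "reduces_to \<pi> u id"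
      and e: "\<And>g. g \<in> carrier G \<Longrightarrow> \<tau> g = u \<otimes>\<^bsub>\<Gamma>\<^esub> \<sigma> g \<otimes>\<^bsub>\<Gamma>\<^esub> inv\<^bsub>\<Gamma>\<^esub> u"
      and v: "\<upsilon> \<in> lifts G \<rho> \<pi>" "v \<in> carrier \<Gamma>" "reduces_to \<pi> v id"
      and e': "\<And>g. g \<in> carrier G \<Longrightarrow> \<upsilon> g = v \<otimes>\<^bsub>\<Gamma>\<^esub> \<tau> g \<otimes>\<^bsub>\<Gamma>\<^esub> inv\<^bsub>\<Gamma>\<^esub> v"
      by (auto simp: lift_equiv_def)
    have "\<upsilon> g = (v \<otimes>\<^bsub>\<Gamma>\<^esub> u) \<otimes>\<^bsub>\<Gamma>\<^esub> \<sigma> g \<otimes>\<^bsub>\<Gamma>\<^esub> inv\<^bsub>\<Gamma>\<^esub> (v \<otimes>\<^bsub>\<Gamma>\<^esub> u)" if g: "g \<in> carrier G" for g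
      using c[OF u(1) g] u(3) v(2) e[OF g] e'[OF g] by (simp add: A.inv_mult_group A.m_assoc)
    moreover have "reduces_to \<pi> (v \<otimes>\<^bsub>\<Gamma>\<^esub> u) id"
      using u(4) v(3) by (simp add: reduces_to_def Aut_fps_mult)
    ultimately show "(\<sigma>, \<upsilon>) \<in> lift_equiv G \<rho> \<pi>"
      using u v unfolding lift_equiv_def by (auto intro!: bexI[of _ "v \<otimes>\<^bsub>\<Gamma>\<^esub> u"])
  qed
qed

lemma res_map_in_def_functor_inv:
  fixes G :: "('g, 'b) monoid_scheme" and \<pi> :: "'a::comm_ring_1 \<Rightarrow> 'k::field"
  assumes "N \<lhd> G" and c: "c \<in> def_functor G \<rho> \<pi>"
  shows "res_map G N \<rho> \<pi> c \<in> def_functor_inv G N \<rho> \<pi>"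
proof -
  interpret A: group "\<Gamma> :: ('a fps \<Rightarrow> 'a fps) monoid" by (rule group_Aut_fps)
  interpret N: normal N G by fact
  let ?R = "lift_equiv (subgrp G N) \<rho> \<pi>"
  have gN: "group (subgrp G N)" using N.subgroup_is_group N.is_group by blast
  note eqG = equiv_lift_equiv[OF N.is_group, of \<rho> \<pi>] and eqN = equiv_lift_equiv[OF gN, of \<rho> \<pi>]
  obtain \<sigma> where \<sigma>: "\<sigma> \<in> lifts G \<rho> \<pi>" and c_eq: "c = lift_equiv G \<rho> \<pi> `` {\<sigma>}"
    using c unfolding def_functor_def by (auto elim: quotientE)
  have sc: "\<sigma> g \<in> carrier \<Gamma>" "reduces_to \<pi> (\<sigma> g) (\<rho> g)" if "g \<in> carrier G" for g
    using \<sigma> that by (auto simp: lifts_def hom_def)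
  have res_lift: "restrict \<tau> N \<in> lifts (subgrp G N) \<rho> \<pi>" if "\<tau> \<in> lifts G \<rho> \<pi>" for \<tau>
    using that N.subset by (auto simp: lifts_def hom_def Pi_def subset_iff)
  define \<sigma>N where "\<sigma>N = restrict \<sigma> N"
  have \<sigma>N: "\<sigma>N \<in> lifts (subgrp G N) \<rho> \<pi>" using res_lift[OF \<sigma>] by (simp add: \<sigma>N_def)
  have img: "?R `` S = ?R `` {\<sigma>N}" if "S \<subseteq> ?R `` {\<sigma>N}" "S \<noteq> {}" for S
    using that eqN unfolding equiv_def sym_def trans_def by blast
  have "(\<sigma>N, restrict \<tau> N) \<in> ?R" if "(\<sigma>, \<tau>) \<in> lift_equiv G \<rho> \<pi>" for \<tau>
    using that res_lift[of \<tau>] \<sigma>N N.subset by (fastforce simp: lift_equiv_def \<sigma>N_def)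
  moreover have "\<sigma> \<in> c" using c_eq equiv_class_self[OF eqG \<sigma>] by simp
  ultimately have res: "res_map G N \<rho> \<pi> c = ?R `` {\<sigma>N}"
    unfolding res_map_def by (intro img) (auto simp: c_eq)
  have "def_act G N \<rho> \<pi> g (?R `` {\<sigma>N}) = ?R `` {\<sigma>N}" if g: "g \<in> carrier G" for g
  proof -
    have conj: "(\<sigma>N, \<lambda>n\<in>N. r \<otimes>\<^bsub>\<Gamma>\<^esub> \<tau> (inv\<^bsub>G\<^esub> g \<otimes>\<^bsub>G\<^esub> n \<otimes>\<^bsub>G\<^esub> g) \<otimes>\<^bsub>\<Gamma>\<^esub> inv\<^bsub>\<Gamma>\<^esub> r) \<in> ?R"
      if \<tau>: "(\<sigma>N, \<tau>) \<in> ?R" and r: "r \<in> carrier \<Gamma>" "reduces_to \<pi> r (\<rho> g)" for \<tau> r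
    proof -
      obtain u where u: "u \<in> carrier \<Gamma>" "reduces_to \<pi> u id"
        and e: "\<And>n. n \<in> N \<Longrightarrow> \<tau> n = u \<otimes>\<^bsub>\<Gamma>\<^esub> \<sigma>N n \<otimes>\<^bsub>\<Gamma>\<^esub> inv\<^bsub>\<Gamma>\<^esub> u"
        using \<tau> by (auto simp: lift_equiv_def)
      define w where "w = r \<otimes>\<^bsub>\<Gamma>\<^esub> u \<otimes>\<^bsub>\<Gamma>\<^esub> inv\<^bsub>\<Gamma>\<^esub> (\<sigma> g)"
      have w: "w \<in> carrier \<Gamma>" using r u sc[OF g] by (simp add: w_def)
      have wr: "reduces_to \<pi> w id"
        unfolding reduces_to_def
      proof
        fix f
        let ?f = "(inv\<^bsub>\<Gamma>\<^esub> (\<sigma> g)) f"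
        have "fps_map \<pi> (w f) = \<rho> g (fps_map \<pi> ?f)"
          using r(2) u(2) by (simp add: w_def Aut_fps_mult reduces_to_def)
        also have "\<dots> = fps_map \<pi> (\<sigma> g ?f)" using sc(2)[OF g] by (simp add: reduces_to_def)
        finally show "fps_map \<pi> (w f) = id (fps_map \<pi> f)" using Aut_fps_inv[OF sc(1)[OF g]] by simp
      qed
      have "r \<otimes>\<^bsub>\<Gamma>\<^esub> \<tau> (inv\<^bsub>G\<^esub> g \<otimes>\<^bsub>G\<^esub> n \<otimes>\<^bsub>G\<^esub> g) \<otimes>\<^bsub>\<Gamma>\<^esub> inv\<^bsub>\<Gamma>\<^esub> r
              = w \<otimes>\<^bsub>\<Gamma>\<^esub> \<sigma>N n \<otimes>\<^bsub>\<Gamma>\<^esub> inv\<^bsub>\<Gamma>\<^esub> w" if n: "n \<in> N" for n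
      proof -
        have nG: "n \<in> carrier G" using n N.subset by auto
        have m: "inv\<^bsub>G\<^esub> g \<otimes>\<^bsub>G\<^esub> n \<otimes>\<^bsub>G\<^esub> g \<in> N" using N.inv_op_closed1[OF g n] .
        have h: "group_hom G \<Gamma> \<sigma>" using \<sigma>
          by (simp add: group_hom_def group_hom_axioms_def lifts_def N.is_group A.is_group)
        have "\<sigma> (inv\<^bsub>G\<^esub> g \<otimes>\<^bsub>G\<^esub> n \<otimes>\<^bsub>G\<^esub> g) = inv\<^bsub>\<Gamma>\<^esub> (\<sigma> g) \<otimes>\<^bsub>\<Gamma>\<^esub> \<sigma> n \<otimes>\<^bsub>\<Gamma>\<^esub> \<sigma> g"
          using g nG by (simp add: group_hom.hom_mult[OF h] group_hom.hom_inv[OF h])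
        then show ?thesis
          using e[OF m] m n r(1) u(1) sc(1)[OF g] sc(1)[OF nG]
          by (simp add: \<sigma>N_def w_def A.inv_mult_group A.m_assoc)
      qed
      then have "(\<lambda>n\<in>N. r \<otimes>\<^bsub>\<Gamma>\<^esub> \<tau> (inv\<^bsub>G\<^esub> g \<otimes>\<^bsub>G\<^esub> n \<otimes>\<^bsub>G\<^esub> g) \<otimes>\<^bsub>\<Gamma>\<^esub> inv\<^bsub>\<Gamma>\<^esub> r)
          = (\<lambda>n\<in>carrier (subgrp G N). w \<otimes>\<^bsub>\<Gamma>\<^esub> \<sigma>N n \<otimes>\<^bsub>\<Gamma>\<^esub> inv\<^bsub>\<Gamma>\<^esub> w)"
        by (auto simp: restrict_def)
      then show ?thesis using lift_conj[OF gN \<sigma>N w wr] by simp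
    qed
    have "\<sigma>N \<in> ?R `` {\<sigma>N}" using equiv_class_self[OF eqN \<sigma>N] .
    then show ?thesis
      unfolding def_act_def using conj sc[OF g] by (intro img) blast+
  qed
  moreover have "?R `` {\<sigma>N} \<in> def_functor (subgrp G N) \<rho> \<pi>"
    unfolding def_functor_def using \<sigma>N by (rule quotientI)
  ultimately show ?thesis by (simp add: def_functor_inv_def res)
qed


subsection \<open>Induction\<close>

text \<open>
  The \<open>A\<close>-algebra homomorphism \<open>A[[y]] \<rightarrow> A[[t]]\<close> with \<open>y \<mapsto> h\<close>; the series converges \<open>t\<close>-adically
  as soon as the constant term of \<open>h\<close> is nilpotent (this rules out \<open>fps_compose\<close>,
  which needs constant term \<open>0\<close>).
\<close>

definition fps_subst :: "'a::comm_ring_1 fps \<Rightarrow> 'a fps \<Rightarrow> 'a fps" where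
  "fps_subst h f = (\<Sum>n. fps_const (f $ n) * h ^ n)"

definition orbit_prod :: "'g set \<Rightarrow> ('g \<Rightarrow> 'a::comm_ring_1 fps \<Rightarrow> 'a fps) \<Rightarrow> 'a fps" where
  "orbit_prod H \<rho> = (\<Prod>s\<in>H. \<rho> s fps_X)"

text \<open>
  The isomorphism \<open>A[[y]] \<rightarrow> A[[t]]\<^sup>N\<close>, \<open>y \<mapsto> y\<^sub>A\<close>, and its inverse. Throughout, \<open>k[[t]]\<^sup>N\<close> is
  identified with the power series ring \<open>k[[y]]\<close> (again the type \<open>'k fps\<close>) along this map for
  \<open>A = k\<close>.
\<close>

definition from_inv :: "'g set \<Rightarrow> ('g \<Rightarrow> 'a::comm_ring_1 fps \<Rightarrow> 'a fps) \<Rightarrow> 'a fps \<Rightarrow> 'a fps" where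
  "from_inv N \<rho> = fps_subst (orbit_prod N \<rho>)"

definition to_inv :: "'g set \<Rightarrow> ('g \<Rightarrow> 'a::comm_ring_1 fps \<Rightarrow> 'a fps) \<Rightarrow> 'a fps \<Rightarrow> 'a fps" where
  "to_inv N \<rho> x = (THE f. from_inv N \<rho> f = x)"

text \<open>\<open>\<rho>\<^sup>\<sharp>\<close>, and \<open>\<rho>\<^sub>A\<^sup>\<sharp>\<close> for a lift; the value does not depend on the element \<open>g\<close> of the coset \<open>C\<close>.\<close>

definition sharp ::
    "('g, 'b) monoid_scheme \<Rightarrow> 'g set \<Rightarrow> ('g \<Rightarrow> 'a::comm_ring_1 fps \<Rightarrow> 'a fps)
      \<Rightarrow> 'g set \<Rightarrow> 'a fps \<Rightarrow> 'a fps" where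
  "sharp G N \<rho> = (\<lambda>C\<in>carrier (G Mod N). \<lambda>f. THE f'. \<forall>g\<in>C. f' = to_inv N \<rho> (\<rho> g (from_inv N \<rho> f)))"

definition ind_map ::
    "('g, 'b) monoid_scheme \<Rightarrow> 'g set \<Rightarrow> ('g \<Rightarrow> 'k::field fps \<Rightarrow> 'k fps) \<Rightarrow> ('a::comm_ring_1 \<Rightarrow> 'k)
      \<Rightarrow> ('g \<Rightarrow> 'a fps \<Rightarrow> 'a fps) set \<Rightarrow> ('g set \<Rightarrow> 'a fps \<Rightarrow> 'a fps) set" where
  "ind_map G N \<rho> \<pi> c = lift_equiv (G Mod N) (sharp G N \<rho>) \<pi> `` (sharp G N ` c)"

text \<open>\<open>\<Phi>\<^sub>A : D\<^sub>G(A) \<rightarrow> D\<^sub>N\<^sup>G\<^sup>/\<^sup>N(A) \<times> D\<^sub>G\<^sub>/\<^sub>N(A)\<close>:\<close>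

definition Phi ::
    "('g, 'b) monoid_scheme \<Rightarrow> 'g set \<Rightarrow> ('g \<Rightarrow> 'k::field fps \<Rightarrow> 'k fps) \<Rightarrow> ('a::comm_ring_1 \<Rightarrow> 'k)
      \<Rightarrow> ('g \<Rightarrow> 'a fps \<Rightarrow> 'a fps) set
      \<Rightarrow> ('g \<Rightarrow> 'a fps \<Rightarrow> 'a fps) set \<times> ('g set \<Rightarrow> 'a fps \<Rightarrow> 'a fps) set" where
  "Phi G N \<rho> \<pi> c = (res_map G N \<rho> \<pi> c, ind_map G N \<rho> \<pi> c)"


section \<open>Group cohomology\<close>

text \<open>
  A \<open>G\<close>-module is an abelian group \<open>M\<close>, written multiplicatively, together with
  a map \<open>a\<close> such that \<open>a g : M \<rightarrow> M\<close> is the action of \<open>g \<in> G\<close>.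
\<close>

definition cochains1 :: "('g, 'b) monoid_scheme \<Rightarrow> ('m, 'c) monoid_scheme \<Rightarrow> ('g \<Rightarrow> 'm) monoid" where
  "cochains1 G M = \<lparr>carrier = carrier G \<rightarrow>\<^sub>E carrier M,
                    monoid.mult = (\<lambda>c d. \<lambda>g\<in>carrier G. c g \<otimes>\<^bsub>M\<^esub> d g), one = (\<lambda>g\<in>carrier G. \<one>\<^bsub>M\<^esub>)\<rparr>"

definition cocycles1 ::
    "('g, 'b) monoid_scheme \<Rightarrow> ('m, 'c) monoid_scheme \<Rightarrow> ('g \<Rightarrow> 'm \<Rightarrow> 'm) \<Rightarrow> ('g \<Rightarrow> 'm) set" where
  "cocycles1 G M a = {c \<in> carrier (cochains1 G M).
     \<forall>g\<in>carrier G. \<forall>h\<in>carrier G. c (g \<otimes>\<^bsub>G\<^esub> h) = c g \<otimes>\<^bsub>M\<^esub> a g (c h)}"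

definition coboundaries1 ::
    "('g, 'b) monoid_scheme \<Rightarrow> ('m, 'c) monoid_scheme \<Rightarrow> ('g \<Rightarrow> 'm \<Rightarrow> 'm) \<Rightarrow> ('g \<Rightarrow> 'm) set" where
  "coboundaries1 G M a = {(\<lambda>g\<in>carrier G. a g m \<otimes>\<^bsub>M\<^esub> inv\<^bsub>M\<^esub> m) | m. m \<in> carrier M}"

definition H1 ::
    "('g, 'b) monoid_scheme \<Rightarrow> ('m, 'c) monoid_scheme \<Rightarrow> ('g \<Rightarrow> 'm \<Rightarrow> 'm) \<Rightarrow> ('g \<Rightarrow> 'm) set monoid" where
  "H1 G M a = (cochains1 G M)\<lparr>carrier := cocycles1 G M a\<rparr> Mod coboundaries1 G M a"

definition H1_class ::
    "('g, 'b) monoid_scheme \<Rightarrow> ('m, 'c) monoid_scheme \<Rightarrow> ('g \<Rightarrow> 'm \<Rightarrow> 'm) \<Rightarrow> ('g \<Rightarrow> 'm) \<Rightarrow> ('g \<Rightarrow> 'm) set" where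
  "H1_class G M a z = coboundaries1 G M a #>\<^bsub>cochains1 G M\<^esub> z"

text \<open>
  The map to \<open>H\<^sup>1(G, M)\<close> induced by a group homomorphism \<open>\<phi>\<close> out of \<open>G\<close> and a compatible
  homomorphism \<open>f\<close> into \<open>M\<close>. All representatives \<open>z\<close> of the class \<open>c\<close> have the same image, so the
  union is a single class; the same device is used in \<open>connecting\<close>.
\<close>

definition H1_map ::
    "('g, 'b) monoid_scheme \<Rightarrow> ('m, 'c) monoid_scheme \<Rightarrow> ('g \<Rightarrow> 'm \<Rightarrow> 'm) \<Rightarrow> ('g \<Rightarrow> 'h) \<Rightarrow> ('l \<Rightarrow> 'm)
      \<Rightarrow> ('h \<Rightarrow> 'l) set \<Rightarrow> ('g \<Rightarrow> 'm) set" where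
  "H1_map G M a \<phi> f c = (\<Union>z\<in>c. H1_class G M a (\<lambda>g\<in>carrier G. f (z (\<phi> g))))"

definition invariants ::
    "('g, 'b) monoid_scheme \<Rightarrow> ('m, 'c) monoid_scheme \<Rightarrow> ('g \<Rightarrow> 'm \<Rightarrow> 'm) \<Rightarrow> ('m, 'c) monoid_scheme" where
  "invariants G M a = M\<lparr>carrier := {m \<in> carrier M. \<forall>g\<in>carrier G. a g m = m}\<rparr>"

text \<open>The connecting map \<open>C\<^sup>G \<rightarrow> H\<^sup>1(G, A)\<close> of \<open>0 \<rightarrow> A \<rightarrow> B \<rightarrow> C \<rightarrow> 0\<close> (with maps \<open>i\<close> and \<open>p\<close>):
  \<open>p b = c\<close> is sent to the class of \<open>g \<mapsto> i\<^sup>-\<^sup>1(g b - b)\<close>.\<close>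

definition connecting ::
    "('g, 'b) monoid_scheme \<Rightarrow> ('l, 'c) monoid_scheme \<Rightarrow> ('g \<Rightarrow> 'l \<Rightarrow> 'l)
      \<Rightarrow> ('m, 'd) monoid_scheme \<Rightarrow> ('g \<Rightarrow> 'm \<Rightarrow> 'm) \<Rightarrow> ('l \<Rightarrow> 'm) \<Rightarrow> ('m \<Rightarrow> 'n) \<Rightarrow> 'n \<Rightarrow> ('g \<Rightarrow> 'l) set" where
  "connecting G A a B b i p c =
     (\<Union>m\<in>{m \<in> carrier B. p m = c}.
        H1_class G A a (\<lambda>g\<in>carrier G. inv_into (carrier A) i (b g m \<otimes>\<^bsub>B\<^esub> inv\<^bsub>B\<^esub> m)))"

text \<open>The action on a quotient module \<open>M Mod S\<close>, and the \<open>G/N\<close>-action derived from a \<open>G\<close>-action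
  under which \<open>N\<close> acts trivially on the elements considered.\<close>

definition act_quot :: "('g \<Rightarrow> 'm \<Rightarrow> 'm) \<Rightarrow> 'g \<Rightarrow> 'm set \<Rightarrow> 'm set" where
  "act_quot a g X = a g ` X"

definition act_Mod :: "('g \<Rightarrow> 'm \<Rightarrow> 'm) \<Rightarrow> 'g set \<Rightarrow> 'm \<Rightarrow> 'm" where
  "act_Mod a C m = (THE m'. \<forall>g\<in>C. m' = a g m)"

text \<open>The action of \<open>g \<in> G\<close> on \<open>H\<^sup>1(N, M)\<close>: \<open>(g c)\<^sub>n = g c\<^bsub>g\<inverse>ng\<^esub>\<close> on cocycles.\<close>

definition act_H1 ::
    "('g, 'b) monoid_scheme \<Rightarrow> 'g set \<Rightarrow> ('g \<Rightarrow> 'm \<Rightarrow> 'm) \<Rightarrow> 'g \<Rightarrow> ('g \<Rightarrow> 'm) set \<Rightarrow> ('g \<Rightarrow> 'm) set" where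
  "act_H1 G N a g X = (\<lambda>z. \<lambda>n\<in>N. a g (z (inv\<^bsub>G\<^esub> g \<otimes>\<^bsub>G\<^esub> n \<otimes>\<^bsub>G\<^esub> g))) ` X"


section \<open>The modules\<close>

text \<open>\<open>\<Theta> = Der\<^sub>k k[[t]]\<close> with \<open>d\<^sup>g = \<rho>(g) d \<rho>(g)\<^sup>-\<^sup>1\<close>; the same definitions applied to \<open>G/N\<close> and
  \<open>\<rho>\<^sup>\<sharp>\<close> give \<open>\<Theta>\<^sup>\<sharp>\<close>.\<close>

definition Der_fps :: "('k::field fps \<Rightarrow> 'k fps) monoid" (\<open>\<Theta>\<close>) where
  "\<Theta> = \<lparr>carrier = {d. (\<forall>f g. d (f + g) = d f + d g) \<and> (\<forall>f g. d (f * g) = f * d g + g * d f)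
                     \<and> (\<forall>a. d (fps_const a) = 0)},
        monoid.mult = (\<lambda>d e f. d f + e f), one = (\<lambda>f. 0)\<rparr>"

definition der_act ::
    "('g \<Rightarrow> 'k::field fps \<Rightarrow> 'k fps) \<Rightarrow> 'g \<Rightarrow> ('k fps \<Rightarrow> 'k fps) \<Rightarrow> ('k fps \<Rightarrow> 'k fps)" where
  "der_act \<rho> g d = \<rho> g \<circ> d \<circ> inv\<^bsub>\<Gamma>\<^esub> (\<rho> g)"

definition Der_inv :: "('g, 'b) monoid_scheme \<Rightarrow> 'g set \<Rightarrow> ('g \<Rightarrow> 'k::field fps \<Rightarrow> 'k fps)
      \<Rightarrow> ('k fps \<Rightarrow> 'k fps) monoid" where
  "Der_inv G N \<rho> = invariants (subgrp G N) \<Theta> (der_act \<rho>)"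

text \<open>The restriction of derivations \<open>\<Theta>\<^sup>N \<rightarrow> \<Theta>\<^sup>\<sharp>\<close>, in the coordinate \<open>y\<close> of \<open>k[[t]]\<^sup>N\<close>.\<close>

definition der_restrict ::
    "'g set \<Rightarrow> ('g \<Rightarrow> 'k::field fps \<Rightarrow> 'k fps) \<Rightarrow> ('k fps \<Rightarrow> 'k fps) \<Rightarrow> ('k fps \<Rightarrow> 'k fps)" where
  "der_restrict N \<rho> d = (\<lambda>f. to_inv N \<rho> (d (from_inv N \<rho> f)))"

text \<open>The maps \<open>d \<mapsto> d(y\<^sub>G)\<close> from \<open>\<Theta>\<close> and from \<open>\<Theta>\<^sup>\<sharp>\<close> to \<open>k[[t]]\<close>.\<close>

definition ev ::
    "('g, 'b) monoid_scheme \<Rightarrow> ('g \<Rightarrow> 'k::field fps \<Rightarrow> 'k fps) \<Rightarrow> ('k fps \<Rightarrow> 'k fps) \<Rightarrow> 'k fps" where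
  "ev G \<rho> d = d (orbit_prod (carrier G) \<rho>)"

definition ev_sharp ::
    "('g, 'b) monoid_scheme \<Rightarrow> 'g set \<Rightarrow> ('g \<Rightarrow> 'k::field fps \<Rightarrow> 'k fps) \<Rightarrow> ('k fps \<Rightarrow> 'k fps) \<Rightarrow> 'k fps" where
  "ev_sharp G N \<rho> d = from_inv N \<rho> (d (to_inv N \<rho> (orbit_prod (carrier G) \<rho>)))"


subsection \<open>The different\<close>

text \<open>
  For subrings \<open>R \<subseteq> S\<close> of \<open>k[[t]]\<close> such that \<open>Frac S / Frac R\<close> is finite Galois, the trace
  is the sum of the Galois conjugates. The inverse of the codifferent \<open>C\<close> consists of the
  \<open>x \<in> Frac S\<close> with \<open>x C \<subseteq> S\<close>; such \<open>x\<close> lie in \<open>S\<close> because \<open>1 \<in> C\<close>.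
\<close>

definition fps_frac :: "'k::field fps set \<Rightarrow> 'k fls set" where
  "fps_frac S = {fps_to_fls a / fps_to_fls b | a b. a \<in> S \<and> b \<in> S \<and> b \<noteq> 0}"

definition Gal :: "'l::field set \<Rightarrow> 'l set \<Rightarrow> ('l \<Rightarrow> 'l) set" where
  "Gal L K = {\<sigma> \<in> extensional L. bij_betw \<sigma> L L \<and>
     (\<forall>x\<in>L. \<forall>y\<in>L. \<sigma> (x + y) = \<sigma> x + \<sigma> y \<and> \<sigma> (x * y) = \<sigma> x * \<sigma> y) \<and> (\<forall>x\<in>K. \<sigma> x = x)}"

definition Gal_trace :: "'l::field set \<Rightarrow> 'l set \<Rightarrow> 'l \<Rightarrow> 'l" where
  "Gal_trace L K x = (\<Sum>\<sigma>\<in>Gal L K. \<sigma> x)"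

definition codifferent :: "'k::field fps set \<Rightarrow> 'k fps set \<Rightarrow> 'k fls set" where
  "codifferent S R = {x \<in> fps_frac S.
     \<forall>s\<in>S. Gal_trace (fps_frac S) (fps_frac R) (x * fps_to_fls s) \<in> fps_to_fls ` R}"

definition different :: "'k::field fps set \<Rightarrow> 'k fps set \<Rightarrow> 'k fps set" where
  "different S R = {s \<in> S. \<forall>x\<in>codifferent S R. fps_to_fls s * x \<in> fps_to_fls ` S}"

definition fps_inv :: "'g set \<Rightarrow> ('g \<Rightarrow> 'k::field fps \<Rightarrow> 'k fps) \<Rightarrow> 'k fps set" where
  "fps_inv H \<rho> = {f. \<forall>h\<in>H. \<rho> h f = f}"


subsection \<open>The module \<open>\<Theta>\<^sub>1\<close> and its subquotients\<close>

definition Theta1 ::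
    "('g, 'b) monoid_scheme \<Rightarrow> 'g set \<Rightarrow> ('g \<Rightarrow> 'k::field fps \<Rightarrow> 'k fps) \<Rightarrow> 'k fps monoid" where
  "Theta1 G N \<rho> = \<lparr>carrier = module.span (*) (different (fps_inv N \<rho>) (fps_inv (carrier G) \<rho>)),
                monoid.mult = (+), one = 0\<rparr>"

definition Theta1_inv ::
    "('g, 'b) monoid_scheme \<Rightarrow> 'g set \<Rightarrow> ('g \<Rightarrow> 'k::field fps \<Rightarrow> 'k fps) \<Rightarrow> 'k fps monoid" where
  "Theta1_inv G N \<rho> = invariants (subgrp G N) (Theta1 G N \<rho>) \<rho>"

text \<open>\<open>\<Theta>\<^sub>1\<^sup>N/\<Theta>\<^sup>N\<close>, with its projection and \<open>G/N\<close>-action:\<close>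

definition Q1 ::
    "('g, 'b) monoid_scheme \<Rightarrow> 'g set \<Rightarrow> ('g \<Rightarrow> 'k::field fps \<Rightarrow> 'k fps) \<Rightarrow> 'k fps set monoid" where
  "Q1 G N \<rho> = Theta1_inv G N \<rho> Mod (ev G \<rho> ` carrier (Der_inv G N \<rho>))"

definition Q1_proj ::
    "('g, 'b) monoid_scheme \<Rightarrow> 'g set \<Rightarrow> ('g \<Rightarrow> 'k::field fps \<Rightarrow> 'k fps) \<Rightarrow> 'k fps \<Rightarrow> 'k fps set" where
  "Q1_proj G N \<rho> x = (ev G \<rho> ` carrier (Der_inv G N \<rho>)) #>\<^bsub>Theta1_inv G N \<rho>\<^esub> x"

abbreviation Q1_act :: "('g \<Rightarrow> 'k::field fps \<Rightarrow> 'k fps) \<Rightarrow> 'g set \<Rightarrow> 'k fps set \<Rightarrow> 'k fps set" where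
  "Q1_act \<rho> \<equiv> act_quot (act_Mod \<rho>)"

text \<open>\<open>(\<Theta>\<^sub>1/\<Theta>)\<^sup>N\<close>, with the projection \<open>\<Theta>\<^sub>1 \<rightarrow> \<Theta>\<^sub>1/\<Theta>\<close> and its \<open>G/N\<close>-action:\<close>

definition Q2 ::
    "('g, 'b) monoid_scheme \<Rightarrow> 'g set \<Rightarrow> ('g \<Rightarrow> 'k::field fps \<Rightarrow> 'k fps) \<Rightarrow> 'k fps set monoid" where
  "Q2 G N \<rho> = invariants (subgrp G N) (Theta1 G N \<rho> Mod (ev G \<rho> ` carrier \<Theta>)) (act_quot \<rho>)"

definition Q2_proj ::
    "('g, 'b) monoid_scheme \<Rightarrow> 'g set \<Rightarrow> ('g \<Rightarrow> 'k::field fps \<Rightarrow> 'k fps) \<Rightarrow> 'k fps \<Rightarrow> 'k fps set" where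
  "Q2_proj G N \<rho> x = (ev G \<rho> ` carrier \<Theta>) #>\<^bsub>Theta1 G N \<rho>\<^esub> x"

abbreviation Q2_act :: "('g \<Rightarrow> 'k::field fps \<Rightarrow> 'k fps) \<Rightarrow> 'g set \<Rightarrow> 'k fps set \<Rightarrow> 'k fps set" where
  "Q2_act \<rho> \<equiv> act_Mod (act_quot \<rho>)"

text \<open>The natural map \<open>\<Theta>\<^sub>1\<^sup>N/\<Theta>\<^sup>N \<rightarrow> (\<Theta>\<^sub>1/\<Theta>)\<^sup>N\<close>:\<close>

definition Q1_to_Q2 ::
    "('g, 'b) monoid_scheme \<Rightarrow> 'g set \<Rightarrow> ('g \<Rightarrow> 'k::field fps \<Rightarrow> 'k fps) \<Rightarrow> 'k fps set \<Rightarrow> 'k fps set" where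
  "Q1_to_Q2 G N \<rho> X = (\<Union>x\<in>X. Q2_proj G N \<rho> x)"

text \<open>\<open>\<Theta>\<^sup>\<sharp>/\<Theta>\<^sup>N\<close>, with its projection and \<open>G/N\<close>-action:\<close>

definition Qs ::
    "('g, 'b) monoid_scheme \<Rightarrow> 'g set \<Rightarrow> ('g \<Rightarrow> 'k::field fps \<Rightarrow> 'k fps) \<Rightarrow> ('k fps \<Rightarrow> 'k fps) set monoid" where
  "Qs G N \<rho> = \<Theta> Mod (der_restrict N \<rho> ` carrier (Der_inv G N \<rho>))"

definition Qs_proj :: "('g, 'b) monoid_scheme \<Rightarrow> 'g set \<Rightarrow> ('g \<Rightarrow> 'k::field fps \<Rightarrow> 'k fps)
      \<Rightarrow> ('k fps \<Rightarrow> 'k fps) \<Rightarrow> ('k fps \<Rightarrow> 'k fps) set" where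
  "Qs_proj G N \<rho> d = (der_restrict N \<rho> ` carrier (Der_inv G N \<rho>)) #>\<^bsub>\<Theta>\<^esub> d"

abbreviation Qs_act :: "('g, 'b) monoid_scheme \<Rightarrow> 'g set \<Rightarrow> ('g \<Rightarrow> 'k::field fps \<Rightarrow> 'k fps)
      \<Rightarrow> 'g set \<Rightarrow> ('k fps \<Rightarrow> 'k fps) set \<Rightarrow> ('k fps \<Rightarrow> 'k fps) set" where
  "Qs_act G N \<rho> \<equiv> act_quot (der_act (sharp G N \<rho>))"

text \<open>The isomorphism \<open>\<Theta>\<^sub>1\<^sup>N/\<Theta>\<^sup>N \<rightarrow> \<Theta>\<^sup>\<sharp>/\<Theta>\<^sup>N\<close> coming from \<open>\<Theta>\<^sup>\<sharp> = \<Theta>\<^sub>1\<^sup>N\<close>, \<open>d \<mapsto> d(y\<^sub>G)\<close>:\<close>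

definition Q1_to_Qs :: "('g, 'b) monoid_scheme \<Rightarrow> 'g set \<Rightarrow> ('g \<Rightarrow> 'k::field fps \<Rightarrow> 'k fps)
      \<Rightarrow> 'k fps set \<Rightarrow> ('k fps \<Rightarrow> 'k fps) set" where
  "Q1_to_Qs G N \<rho> X = {d \<in> carrier \<Theta>. ev_sharp G N \<rho> d \<in> X}"


section \<open>Tangent spaces\<close>

text \<open>\<open>k[\<epsilon>]\<close>; \<open>DualNum a b\<close> is \<open>a + \<epsilon> b\<close>.\<close>

datatype 'a dualnum = DualNum (dn_re: 'a) (dn_im: 'a)

instantiation dualnum :: (comm_ring_1) comm_ring_1
begin

definition "0 = DualNum 0 0"
definition "1 = DualNum 1 0"
definition "x + y = DualNum (dn_re x + dn_re y) (dn_im x + dn_im y)"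
definition "x - y = DualNum (dn_re x - dn_re y) (dn_im x - dn_im y)"
definition "- x = DualNum (- dn_re x) (- dn_im x)"
definition "x * y = DualNum (dn_re x * dn_re y) (dn_re x * dn_im y + dn_im x * dn_re y)"

instance
  by standard
    (simp_all add: zero_dualnum_def one_dualnum_def plus_dualnum_def minus_dualnum_def
      uminus_dualnum_def times_dualnum_def algebra_simps)

end

text \<open>The lift \<open>x \<mapsto> \<rho>(g)(x) + \<epsilon> d\<^sub>g(\<rho>(g)(x))\<close> (for \<open>x \<in> k[[t]]\<close>) attached to a cocycle,
  extended \<open>k[\<epsilon>]\<close>-linearly to \<open>x + \<epsilon> x'\<close>.\<close>

definition cocycle_lift ::
    "('g, 'b) monoid_scheme \<Rightarrow> ('g \<Rightarrow> 'k::field fps \<Rightarrow> 'k fps) \<Rightarrow> ('g \<Rightarrow> 'k fps \<Rightarrow> 'k fps)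
      \<Rightarrow> 'g \<Rightarrow> 'k dualnum fps \<Rightarrow> 'k dualnum fps" where
  "cocycle_lift G \<rho> d = (\<lambda>g\<in>carrier G. \<lambda>f.
     let x = fps_map dn_re f; x' = fps_map dn_im f;
         u = \<rho> g x; v = d g (\<rho> g x) + \<rho> g x'
     in Abs_fps (\<lambda>n. DualNum (u $ n) (v $ n)))"

text \<open>The identification \<open>H\<^sup>1(G, \<Theta>) \<rightarrow> D\<^sub>G(k[\<epsilon>])\<close>:\<close>

definition tangent_id ::
    "('g, 'b) monoid_scheme \<Rightarrow> ('g \<Rightarrow> 'k::field fps \<Rightarrow> 'k fps) \<Rightarrow> ('g \<Rightarrow> 'k fps \<Rightarrow> 'k fps) set
      \<Rightarrow> ('g \<Rightarrow> 'k dualnum fps \<Rightarrow> 'k dualnum fps) set" where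
  "tangent_id G \<rho> c = lift_equiv G \<rho> dn_re `` (cocycle_lift G \<rho> ` c)"

text \<open>\<open>H\<^sup>1(G, \<Theta>)\<close>, \<open>H\<^sup>1(N, \<Theta>)\<^sup>G\<^sup>/\<^sup>N\<close> and \<open>H\<^sup>1(G/N, \<Theta>\<^sup>\<sharp>)\<close>:\<close>

definition H1G :: "('g, 'b) monoid_scheme \<Rightarrow> ('g \<Rightarrow> 'k::field fps \<Rightarrow> 'k fps)
      \<Rightarrow> ('g \<Rightarrow> 'k fps \<Rightarrow> 'k fps) set monoid" where
  "H1G G \<rho> = H1 G \<Theta> (der_act \<rho>)"

definition H1N :: "('g, 'b) monoid_scheme \<Rightarrow> 'g set \<Rightarrow> ('g \<Rightarrow> 'k::field fps \<Rightarrow> 'k fps)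
      \<Rightarrow> ('g \<Rightarrow> 'k fps \<Rightarrow> 'k fps) set monoid" where
  "H1N G N \<rho> = invariants (G Mod N) (H1 (subgrp G N) \<Theta> (der_act \<rho>))
                 (act_Mod (act_H1 G N (der_act \<rho>)))"

definition H1sharp :: "('g, 'b) monoid_scheme \<Rightarrow> 'g set \<Rightarrow> ('g \<Rightarrow> 'k::field fps \<Rightarrow> 'k fps)
      \<Rightarrow> ('g set \<Rightarrow> 'k fps \<Rightarrow> 'k fps) set monoid" where
  "H1sharp G N \<rho> = H1 (G Mod N) \<Theta> (der_act (sharp G N \<rho>))"

text \<open>\<open>\<Phi>\<^bsub>k[\<epsilon>]\<^esub>\<close>, read on cohomology through the identifications above:\<close>

definition Phi_tangent :: "('g, 'b) monoid_scheme \<Rightarrow> 'g set \<Rightarrow> ('g \<Rightarrow> 'k::field fps \<Rightarrow> 'k fps)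
      \<Rightarrow> ('g \<Rightarrow> 'k fps \<Rightarrow> 'k fps) set
      \<Rightarrow> ('g \<Rightarrow> 'k fps \<Rightarrow> 'k fps) set \<times> ('g set \<Rightarrow> 'k fps \<Rightarrow> 'k fps) set" where
  "Phi_tangent G N \<rho> c =
     inv_into (carrier (H1N G N \<rho>) \<times> carrier (H1sharp G N \<rho>))
       (map_prod (tangent_id (subgrp G N) \<rho>) (tangent_id (G Mod N) (sharp G N \<rho>)))
       (Phi G N \<rho> dn_re (tangent_id G \<rho> c))"


section \<open>The maps in the statement\<close>

text \<open>\<open>(\<Theta>\<^sub>1\<^sup>N/\<Theta>\<^sup>N)\<^sup>G\<^sup>/\<^sup>N \<rightarrow> H\<^sup>1(G/N, \<Theta>\<^sup>N) \<rightarrow> H\<^sup>1(G, \<Theta>)\<close>, connecting map followed by inflation:\<close>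

definition infl_connecting :: "('g, 'b) monoid_scheme \<Rightarrow> 'g set \<Rightarrow> ('g \<Rightarrow> 'k::field fps \<Rightarrow> 'k fps)
      \<Rightarrow> 'k fps set \<Rightarrow> ('g \<Rightarrow> 'k fps \<Rightarrow> 'k fps) set" where
  "infl_connecting G N \<rho> X =
     H1_map G \<Theta> (der_act \<rho>) (\<lambda>g. N #>\<^bsub>G\<^esub> g) (\<lambda>d. d)
       (connecting (G Mod N) (Der_inv G N \<rho>) (act_Mod (der_act \<rho>))
          (Theta1_inv G N \<rho>) (act_Mod \<rho>) (ev G \<rho>) (Q1_proj G N \<rho>) X)"

definition sigma_map :: "('g, 'b) monoid_scheme \<Rightarrow> 'g set \<Rightarrow> ('g \<Rightarrow> 'k::field fps \<Rightarrow> 'k fps)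
      \<Rightarrow> ('g set \<Rightarrow> 'k fps \<Rightarrow> 'k fps) set \<Rightarrow> ('g set \<Rightarrow> ('k fps \<Rightarrow> 'k fps) set) set" where
  "sigma_map G N \<rho> = H1_map (G Mod N) (Qs G N \<rho>) (Qs_act G N \<rho>) (\<lambda>C. C) (Qs_proj G N \<rho>)"

text \<open>The connecting map \<open>(\<Theta>\<^sub>1/\<Theta>)\<^sup>N \<rightarrow> H\<^sup>1(N, \<Theta>)\<close> of \<open>0 \<rightarrow> \<Theta> \<rightarrow> \<Theta>\<^sub>1 \<rightarrow> \<Theta>\<^sub>1/\<Theta> \<rightarrow> 0\<close>:\<close>

definition Q2_to_H1 :: "('g, 'b) monoid_scheme \<Rightarrow> 'g set \<Rightarrow> ('g \<Rightarrow> 'k::field fps \<Rightarrow> 'k fps)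
      \<Rightarrow> 'k fps set \<Rightarrow> ('g \<Rightarrow> 'k fps \<Rightarrow> 'k fps) set" where
  "Q2_to_H1 G N \<rho> =
     connecting (subgrp G N) \<Theta> (der_act \<rho>) (Theta1 G N \<rho>) \<rho> (ev G \<rho>) (Q2_proj G N \<rho>)"

text \<open>\<open>\<gamma>\<close> is minus the connecting map of
  \<open>0 \<rightarrow> \<Theta>\<^sub>1\<^sup>N/\<Theta>\<^sup>N \<rightarrow> (\<Theta>\<^sub>1/\<Theta>)\<^sup>N \<rightarrow> H\<^sup>1(N, \<Theta>) \<rightarrow> 0\<close>.\<close>

definition gamma_map :: "('g, 'b) monoid_scheme \<Rightarrow> 'g set \<Rightarrow> ('g \<Rightarrow> 'k::field fps \<Rightarrow> 'k fps)
      \<Rightarrow> ('g \<Rightarrow> 'k fps \<Rightarrow> 'k fps) set \<Rightarrow> ('g set \<Rightarrow> ('k fps \<Rightarrow> 'k fps) set) set" where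
  "gamma_map G N \<rho> c =
     inv\<^bsub>H1 (G Mod N) (Qs G N \<rho>) (Qs_act G N \<rho>)\<^esub>
       (H1_map (G Mod N) (Qs G N \<rho>) (Qs_act G N \<rho>) (\<lambda>C. C) (Q1_to_Qs G N \<rho>)
          (connecting (G Mod N) (Q1 G N \<rho>) (Q1_act \<rho>) (Q2 G N \<rho>) (Q2_act \<rho>)
             (Q1_to_Q2 G N \<rho>) (Q2_to_H1 G N \<rho>) c))"

end

theory Submission
  imports Defs "HOL-Computational_Algebra.Polynomial"
begin

text \<open>
  Evaluation at \<open>y\<^sub>G\<close> moves everything into \<open>k[[t]]\<close>: with \<open>w = dy\<^sub>G/dy\<^sub>N\<close>, the modules
  \<open>\<Theta> \<subseteq> \<Theta>\<^sub>1\<close> become the ideals generated by \<open>dy\<^sub>G/dt\<close> and by \<open>w\<close>, and \<open>\<Theta>\<^sup>\<sharp>\<close> becomes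
  \<open>\<Theta>\<^sub>1\<^sup>N\<close>. (That \<open>w\<close> generates the different is Euler's formula for the trace dual of the basis
  \<open>1, y\<^sub>N, y\<^sub>N\<^sup>2, \<dots>\<close>, combined with a unit relating \<open>w\<close> to the derivative of the minimal polynomial
  of \<open>y\<^sub>N\<close> at \<open>y\<^sub>N\<close>.)

  For the lift attached to a cocycle \<open>d\<close> of \<open>G\<close>, write \<open>y\<^sub>A = y\<^sub>N + \<epsilon> \<zeta>\<close> and \<open>\<delta> = w \<zeta>\<close>. Invariance of
  \<open>y\<^sub>A\<close> gives \<open>d\<^sub>n = - (n \<delta> - \<delta>)\<close> for \<open>n \<in> N\<close>, and the induced lift of \<open>\<rho>\<^sup>\<sharp>\<close> is the one attached to
  \<open>d\<^sub>g + (g \<delta> - \<delta>)\<close>, which vanishes on \<open>N\<close> and therefore is a cocycle of \<open>G/N\<close> in \<open>\<Theta>\<^sub>1\<^sup>N\<close>.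
  If both \<open>d\<close> on \<open>N\<close> and this induced cocycle are coboundaries, then \<open>d\<close> is cohomologous to
  \<open>g \<mapsto> g x - x\<close> for some \<open>x \<in> \<Theta>\<^sub>1\<^sup>N\<close>, which is (i). Moreover \<open>- \<delta>\<close> represents the preimage of the
  class of \<open>d\<close> on \<open>N\<close> in \<open>(\<Theta>\<^sub>1/\<Theta>)\<^sup>N\<close>, so that \<open>\<gamma>\<close> of it is the class of \<open>g \<delta> - \<delta>\<close> modulo
  \<open>\<Theta>\<close>, and this is also the class of the induced cocycle modulo \<open>\<Theta>\<close>.
\<close>

text \<open>Derivations are compared through their values at \<open>y_G\<close>, not at t or
  \<open>y_N\<close>, because \<open>y_G\<close> is fixed by all of G: conjugation of derivations
  then becomes the action of \<rho> on series. The factor w is not G-invariant; it is multiplied by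
  the Jacobian of the action on \<open>y_N\<close>. The element \<delta> enters because the induced
  lift is read in the coordinate y_A instead of \<open>y_N\<close>. This change of coordinate is the
  derivation \<zeta> d/dy_N from k[[y_N]] to k[[t]], whose value at \<open>y_G\<close> is w \<zeta>.
  It lies in \<Theta>_1 but need not lie in \<Theta>, so g \<delta> - \<delta> cannot be dropped as
  a coboundary on G. Nothing is computed about \<zeta> beyond the invariance of y_A, which fixes the
  coboundary of \<delta> on N. Two elements of \<Theta>_1 with the same coboundary on N differ by an
  N-invariant one, that is, by an element of \<open>\<Theta>\<^sup>\<sharp>\<close>, and such a
  change is a coboundary for G/N. This freedom replaces every explicit comparison of different
  \<zeta>. The sign in \<gamma> is forced: the connecting map takes - \<delta> to - (g \<delta> -
  \<delta>).\<close>

section \<open>Power series: X-adic approximation and Weierstrass division\<close>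

lemma fps_X_decompose: "(f :: 'a::comm_ring_1 fps) = fps_const (f $ 0) + fps_X * fps_shift 1 f"
  by (rule fps_ext) (auto simp: fps_X_mult_nth)

text \<open>A substitute for continuity: equalities of power series are obtained below by showing,
  by induction on n, that the difference is divisible by X^n.\<close>

lemma fps_X_adic_separated:
  assumes "\<And>n. fps_X ^ n dvd (f :: 'a::comm_ring_1 fps)"
  shows "f = 0"
proof (rule fps_ext)
  fix n
  obtain h where "f = fps_X ^ Suc n * h" using assms[of "Suc n"] by (auto simp: dvd_def)
  then show "f $ n = 0 $ n" by (simp add: fps_X_power_mult_nth del: power_Suc)
qed

lemma fps_cutoff_eq_sum:
  "fps_cutoff n (f :: 'a::comm_ring_1 fps) = (\<Sum>i<n. fps_const (f $ i) * fps_X ^ i)"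
proof (rule fps_ext)
  fix m
  have "(\<Sum>i<n. fps_const (f $ i) * fps_X ^ i) $ m = (\<Sum>i<n. if i = m then f $ i else 0)"
    unfolding fps_sum_nth by (intro sum.cong) (auto simp: fps_X_power_nth)
  then show "fps_cutoff n f $ m = (\<Sum>i<n. fps_const (f $ i) * fps_X ^ i) $ m"
    by (cases "m < n") (simp_all add: sum.delta)
qed

lemma fps_compose_cancel:
  fixes y :: "'k::field fps"
  assumes "y $ 0 = 0" "y \<noteq> 0"
  shows "F oo y = G oo y \<longleftrightarrow> F = G"
  using fps_compose_eq_0_iff[OF assms(1), of "F - G"] assms(2)
  by (auto simp: fps_compose_sub_distrib)

text \<open>Division with remainder by y, iterated: one step writes g as a polynomial of degree
  below n = subdegree y plus y times a quotient, and the quotient is divided again. The i-th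
  coefficients of the successive remainders form the series \<open>c i\<close>. Thus k[[t]] is
  spanned over k[[y]] by 1, t, ..., t^(n-1).\<close>

lemma weierstrass_division:
  fixes y f :: "'k::field fps"
  assumes "subdegree y > 0"
  obtains c where "f = (\<Sum>i<subdegree y. (c i oo y) * fps_X ^ i)"
proof -
  define n where "n = subdegree y"
  define u where "u = fps_shift n y"
  have y0: "y $ 0 = 0" and ynz: "y \<noteq> 0"
    using assms by (metis nth_less_subdegree_zero, auto)
  have u0: "u $ 0 \<noteq> 0" using ynz by (simp add: u_def n_def)
  have yu: "y = u * fps_X ^ n" using subdegree_decompose[of y] by (simp add: u_def n_def)
  define step where "step = (\<lambda>g. inverse u * fps_shift n g)"
  have step: "g = (\<Sum>i<n. fps_const (g $ i) * fps_X ^ i) + y * step g" for g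
  proof -
    have "y * step g = (u * inverse u) * fps_shift n g * fps_X ^ n"
      by (simp add: yu step_def mult_ac)
    also have "u * inverse u = 1" using u0 by (simp add: inverse_mult_eq_1' mult.commute)
    finally show ?thesis
      by (metis fps_shift_cutoff add.commute fps_cutoff_eq_sum mult.left_neutral)
  qed
  define c where "c = (\<lambda>g i. Abs_fps (\<lambda>j. (step ^^ j) g $ i))"
  define T where "T = (\<lambda>g. \<Sum>i<n. (c g i oo y) * fps_X ^ i)"
  have c_step: "c g i = fps_const (g $ i) + fps_X * c (step g) i" for g i
    by (rule fps_ext) (auto simp: c_def funpow_swap1 simp flip: funpow_Suc_right split: nat.splits,
      metis (no_types, lifting) Suc_pred funpow_Suc_right o_apply)
  have T_step: "T g = (\<Sum>i<n. fps_const (g $ i) * fps_X ^ i) + y * T (step g)" for g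
    unfolding T_def
    by (subst c_step)
      (simp add: fps_compose_add_distrib fps_compose_mult_distrib y0 algebra_simps sum.distrib sum_distrib_left)
  \<comment> \<open>\<open>g\<close> and \<open>T g\<close> obey the same recursion, so their
    difference is y times the difference for the quotient; each round gains a factor X because y has
    no constant term.\<close>
  have "fps_X ^ m dvd g - T g" for m g
  proof (induction m arbitrary: g)
    case (Suc m)
    have "g - T g = y * (step g - T (step g))"
      using step[of g] T_step[of g] by (simp add: algebra_simps)
    moreover have "fps_X dvd y"
      using fps_X_decompose[of y] y0 by (metis add.left_neutral dvd_triv_left fps_const_0_eq_0)
    ultimately show ?case using Suc[of "step g"] by (auto intro: mult_dvd_mono)
  qed simp
  then have "f - T f = 0" by (rule fps_X_adic_separated)
  then show ?thesis using that[of "c f"] by (simp add: T_def n_def)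
qed

subsection \<open>Automorphisms and derivations\<close>

lemma Aut_add: "\<phi> \<in> carrier \<Gamma> \<Longrightarrow> \<phi> (f + g) = \<phi> f + \<phi> g"
  and Aut_mult: "\<phi> \<in> carrier \<Gamma> \<Longrightarrow> \<phi> (f * g) = \<phi> f * \<phi> g"
  and Aut_const: "\<phi> \<in> carrier \<Gamma> \<Longrightarrow> \<phi> (fps_const a) = fps_const a"
  and Aut_bij: "\<phi> \<in> carrier \<Gamma> \<Longrightarrow> bij \<phi>"
  by (simp_all add: Aut_fps_def)

lemma Aut_zero: "\<phi> \<in> carrier \<Gamma> \<Longrightarrow> \<phi> 0 = 0"
  and Aut_one: "\<phi> \<in> carrier \<Gamma> \<Longrightarrow> \<phi> 1 = 1"
  using Aut_const[of \<phi> 0] Aut_const[of \<phi> 1] by simp_all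

lemma Aut_uminus: "\<phi> \<in> carrier \<Gamma> \<Longrightarrow> \<phi> (- f) = - \<phi> f"
  by (metis Aut_add Aut_zero add_eq_0_iff)

lemma Aut_diff: "\<phi> \<in> carrier \<Gamma> \<Longrightarrow> \<phi> (f - g) = \<phi> f - \<phi> g"
  by (metis Aut_add Aut_uminus diff_conv_add_uminus)

lemma Aut_sum: "\<phi> \<in> carrier \<Gamma> \<Longrightarrow> \<phi> (\<Sum>x\<in>A. f x) = (\<Sum>x\<in>A. \<phi> (f x))"
  by (induction A rule: infinite_finite_induct) (auto simp: Aut_add Aut_zero)

lemma Aut_prod: "\<phi> \<in> carrier \<Gamma> \<Longrightarrow> \<phi> (\<Prod>x\<in>A. f x) = (\<Prod>x\<in>A. \<phi> (f x))"
  by (induction A rule: infinite_finite_induct) (auto simp: Aut_mult Aut_one)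

lemma Aut_power: "\<phi> \<in> carrier \<Gamma> \<Longrightarrow> \<phi> (f ^ n) = \<phi> f ^ n"
  by (induction n) (auto simp: Aut_mult Aut_one)

lemma Aut_eq_iff: "\<phi> \<in> carrier \<Gamma> \<Longrightarrow> \<phi> f = \<phi> g \<longleftrightarrow> f = g"
  using Aut_bij bij_is_inj inj_eq by metis

lemma Aut_eq_0_iff: "\<phi> \<in> carrier \<Gamma> \<Longrightarrow> \<phi> f = 0 \<longleftrightarrow> f = 0"
  using Aut_eq_iff[of \<phi> f 0] by (simp add: Aut_zero)

lemma Aut_inv_closed: "\<phi> \<in> carrier \<Gamma> \<Longrightarrow> inv\<^bsub>\<Gamma>\<^esub> \<phi> \<in> carrier \<Gamma>"
  by (rule group.inv_closed[OF group_Aut_fps])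

lemma Aut_inv_left: "\<phi> \<in> carrier \<Gamma> \<Longrightarrow> (inv\<^bsub>\<Gamma>\<^esub> \<phi>) (\<phi> f) = f"
  by (metis Aut_eq_iff Aut_fps_inv)

text \<open>Elements of \<Gamma> are not assumed continuous. They preserve units, hence the maximal
  ideal, and this makes X-adic arguments apply to them.\<close>

lemma Aut_nth_0:
  assumes "\<phi> \<in> carrier \<Gamma>" "f $ 0 = (0::'k::field)"
  shows "\<phi> f $ 0 = 0"
proof (rule ccontr)
  assume "\<phi> f $ 0 \<noteq> 0"
  then have "inverse (\<phi> f) * \<phi> f = 1" by (rule inverse_mult_eq_1)
  then have "(inv\<^bsub>\<Gamma>\<^esub> \<phi>) (inverse (\<phi> f)) * f = 1"
    by (metis Aut_inv_closed Aut_inv_left Aut_mult Aut_one assms(1))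
  then have "((inv\<^bsub>\<Gamma>\<^esub> \<phi>) (inverse (\<phi> f)) * f) $ 0 = 1" by simp
  then show False using assms(2) by simp
qed

text \<open>Splitting f as f(0) + X f_1 gives A f - B f = A(X) (A f_1 - B f_1), and A(X) contributes
  a factor X in each round.\<close>

lemma fps_hom_ext:
  fixes A B :: "'a::comm_ring_1 fps \<Rightarrow> 'a fps"
  assumes A: "\<And>f g. A (f + g) = A f + A g" "\<And>f g. A (f * g) = A f * A g" "\<And>a. A (fps_const a) = fps_const a"
    and B: "\<And>f g. B (f + g) = B f + B g" "\<And>f g. B (f * g) = B f * B g" "\<And>a. B (fps_const a) = fps_const a"
    and X: "A fps_X = B fps_X" "A fps_X $ 0 = 0"
  shows "A f = B f"
proof -
  have "fps_X ^ n dvd A f - B f" for n f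
  proof (induction n arbitrary: f)
    case (Suc n)
    have "A f - B f = A fps_X * (A (fps_shift 1 f) - B (fps_shift 1 f))"
      using arg_cong[OF fps_X_decompose[of f], of A] arg_cong[OF fps_X_decompose[of f], of B]
      by (simp add: A B X(1)[symmetric] algebra_simps)
    moreover have "A fps_X = fps_X * fps_shift 1 (A fps_X)"
      using fps_X_decompose[of "A fps_X"] X(2) by simp
    ultimately show ?case using Suc[of "fps_shift 1 f"] by (metis dvd_triv_left mult_dvd_mono power_Suc)
  qed simp
  then have "A f - B f = 0" by (rule fps_X_adic_separated)
  then show ?thesis by simp
qed

lemma Aut_eq_compose:
  assumes "\<phi> \<in> carrier \<Gamma>"
  shows "\<phi> f = f oo \<phi> (fps_X :: 'k::field fps)"
proof (rule fps_hom_ext[of \<phi> "\<lambda>f. f oo \<phi> fps_X"])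
  show "\<phi> fps_X $ 0 = 0" using Aut_nth_0[OF assms] by simp
  then show "\<phi> fps_X = fps_X oo \<phi> fps_X" "\<And>f g. f * g oo \<phi> fps_X = (f oo \<phi> fps_X) * (g oo \<phi> fps_X)"
    by (simp_all add: fps_compose_mult_distrib)
qed (use assms in \<open>auto simp: Aut_add Aut_mult Aut_const fps_compose_add_distrib\<close>)

lemma Aut_X_nonzero: "\<phi> \<in> carrier \<Gamma> \<Longrightarrow> \<phi> (fps_X :: 'k::field fps) \<noteq> 0"
  by (simp add: Aut_eq_0_iff)

lemma Aut_X_nth_0: "\<phi> \<in> carrier \<Gamma> \<Longrightarrow> \<phi> (fps_X :: 'k::field fps) $ 0 = 0"
  by (simp add: Aut_nth_0)

text \<open>Subdegrees multiply under composition, so those of \<phi>(X) and \<phi>^-1(X) have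
  product 1.\<close>

lemma Aut_subdegree:
  assumes "\<phi> \<in> carrier \<Gamma>"
  shows "subdegree (\<phi> f) = subdegree (f :: 'k::field fps)"
proof -
  have 1: "subdegree (\<psi> fps_X) > 0" if "\<psi> \<in> carrier \<Gamma>" for \<psi> :: "'k fps \<Rightarrow> 'k fps"
    using Aut_X_nonzero[OF that] Aut_X_nth_0[OF that] subdegree_eq_0_iff by blast
  have "fps_X = \<phi> ((inv\<^bsub>\<Gamma>\<^esub> \<phi>) fps_X)" using Aut_fps_inv[OF assms] by simp
  also have "\<dots> = (inv\<^bsub>\<Gamma>\<^esub> \<phi>) fps_X oo \<phi> fps_X" by (rule Aut_eq_compose[OF assms])
  finally have "subdegree ((inv\<^bsub>\<Gamma>\<^esub> \<phi>) fps_X) * subdegree (\<phi> (fps_X :: 'k fps)) = 1"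
    by (metis Aut_X_nth_0[OF assms] subdegree_fps_X subdegree_fps_compose)
  then have "subdegree (\<phi> (fps_X :: 'k fps)) = 1" by simp
  then show ?thesis
    using Aut_eq_compose[OF assms, of f] Aut_X_nth_0[OF assms] by (metis mult.right_neutral subdegree_fps_compose)
qed

lemma Aut_ext:
  "\<phi> \<in> carrier \<Gamma> \<Longrightarrow> \<psi> \<in> carrier \<Gamma> \<Longrightarrow> \<phi> fps_X = \<psi> fps_X \<Longrightarrow> \<phi> = (\<psi> :: 'k::field fps \<Rightarrow> _)"
  by (rule ext, metis Aut_eq_compose)

lemma Der_add: "d \<in> carrier \<Theta> \<Longrightarrow> d (f + g) = d f + d g"
  and Der_mult: "d \<in> carrier \<Theta> \<Longrightarrow> d (f * g) = f * d g + g * d f"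
  and Der_const: "d \<in> carrier \<Theta> \<Longrightarrow> d (fps_const a) = 0"
  by (simp_all add: Der_fps_def)

text \<open>The defect \<open>e\<close> is again a derivation and kills constants and X; splitting
  off constant terms repeatedly makes its values divisible by every power of X.\<close>

lemma Der_eq_deriv:
  assumes "d \<in> carrier \<Theta>"
  shows "d f = fps_deriv f * d fps_X"
proof -
  define e where "e = (\<lambda>f. d f - fps_deriv f * d fps_X)"
  have "fps_X ^ n dvd e f" for n f
  proof (induction n arbitrary: f)
    case (Suc n)
    have "e (a + b) = e a + e b" "e (a * b) = a * e b + b * e a" "e (fps_const c) = 0" "e fps_X = 0" for a b c
      by (simp_all add: e_def Der_add[OF assms] Der_mult[OF assms] Der_const[OF assms] algebra_simps)
    then have "e f = fps_X * e (fps_shift 1 f)"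
      by (subst fps_X_decompose[of f]) simp
    then show ?case using Suc[of "fps_shift 1 f"] by (simp add: mult_dvd_mono)
  qed simp
  then have "e f = 0" by (rule fps_X_adic_separated)
  then show ?thesis by (simp add: e_def)
qed

lemma deriv_mult_in_Der: "(\<lambda>f. fps_deriv f * h) \<in> carrier \<Theta>"
  by (simp add: Der_fps_def algebra_simps)

lemma Der_ext: "d \<in> carrier \<Theta> \<Longrightarrow> e \<in> carrier \<Theta> \<Longrightarrow> d fps_X = e fps_X \<Longrightarrow> d = e"
  by (rule ext, metis Der_eq_deriv)

subsection \<open>Finite group actions\<close>

lemma poly_eq_0_if_card_roots:
  fixes p :: "'a::idom poly"
  assumes "inj_on a A" "\<And>x. x \<in> A \<Longrightarrow> poly p (a x) = 0" "degree p < card A"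
  shows "p = 0"
proof (rule ccontr)
  assume nz: "p \<noteq> 0"
  have "card (a ` A) \<le> card {x. poly p x = 0}"
    using assms(2) by (intro card_mono) (auto simp: poly_roots_finite nz)
  also have "\<dots> \<le> degree p" by (rule card_poly_roots_bound[OF nz])
  finally show False using assms(1,3) by (simp add: card_image)
qed

lemma fps_deriv_poly:
  fixes p :: "'a::idom fps poly"
  shows "fps_deriv (poly p x) = poly (map_poly fps_deriv p) x + poly (pderiv p) x * fps_deriv x"
  by (induction p) (simp_all add: map_poly_pCons pderiv_pCons algebra_simps)

text \<open>Stated with bare homomorphism hypotheses because it serves both the automorphisms and
  the embedding of power series in Laurent series.\<close>

lemma hom_coeff_prod:
  fixes h :: "'a::comm_ring_1 \<Rightarrow> 'b::comm_ring_1"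
  assumes add: "\<And>x y. h (x + y) = h x + h y" and mult: "\<And>x y. h (x * y) = h x * h y"
    and "h 0 = 0" "h 1 = 1"
  shows "h (coeff (\<Prod>x\<in>A. [:- a x, 1:]) i) = coeff (\<Prod>x\<in>A. [:- h (a x), 1:]) i"
proof -
  have neg: "h (- x) = - h x" for x using add[of "- x" x] assms(3) by (simp add: add_eq_0_iff)
  show ?thesis
  proof (induction A arbitrary: i rule: infinite_finite_induct)
    case (insert x A)
    then show ?case by (cases i) (simp_all add: add mult neg diff_conv_add_uminus del: add_uminus_conv_diff)
  qed (auto simp: coeff_1 assms)
qed

lemma Aut_coeff_prod:
  "\<phi> \<in> carrier \<Gamma> \<Longrightarrow> \<phi> (coeff (\<Prod>x\<in>A. [:- a x, 1:]) i) = coeff (\<Prod>x\<in>A. [:- \<phi> (a x), 1:]) i"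
  by (rule hom_coeff_prod) (simp_all add: Aut_add Aut_mult Aut_zero Aut_one)

lemma (in group) prod_translate:
  "g \<in> carrier G \<Longrightarrow> (\<Prod>s\<in>carrier G. h (g \<otimes> s)) = (\<Prod>s\<in>carrier G. h s)"
  by (rule prod.reindex_bij_witness[of _ "\<lambda>s. inv g \<otimes> s" "\<lambda>s. g \<otimes> s"]) (auto simp: m_assoc[symmetric])

locale fps_action = group G for G (structure) +
  fixes \<rho> :: "'a \<Rightarrow> 'k::field fps \<Rightarrow> 'k fps"
  assumes finite_G: "finite (carrier G)"
    and rho_hom: "\<rho> \<in> hom G \<Gamma>"
begin

lemma rho_closed: "g \<in> carrier G \<Longrightarrow> \<rho> g \<in> carrier \<Gamma>"
  using rho_hom by (auto simp: hom_def)

lemma rho_mult: "g \<in> carrier G \<Longrightarrow> h \<in> carrier G \<Longrightarrow> \<rho> (g \<otimes> h) f = \<rho> g (\<rho> h f)"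
  using hom_mult[OF rho_hom, of g h] by (simp add: Aut_fps_mult)

lemma rho_one: "\<rho> \<one> f = f"
proof -
  have "\<rho> \<one> (\<rho> \<one> f) = \<rho> \<one> f" using rho_mult[of \<one> \<one> f] by simp
  then show ?thesis using Aut_eq_iff[OF rho_closed, of \<one>] by simp
qed

lemma rho_inv_left: "g \<in> carrier G \<Longrightarrow> \<rho> (inv g) (\<rho> g f) = f"
  and rho_inv_right: "g \<in> carrier G \<Longrightarrow> \<rho> g (\<rho> (inv g) f) = f"
  using rho_mult[of "inv g" g f] rho_mult[of g "inv g" f] by (simp_all add: rho_one)

lemma inv_rho: "g \<in> carrier G \<Longrightarrow> inv\<^bsub>\<Gamma>\<^esub> (\<rho> g) = \<rho> (inv g)"
  by (rule ext, metis Aut_inv_left rho_closed rho_inv_right)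

lemmas rho_add = Aut_add[OF rho_closed] and rho_times = Aut_mult[OF rho_closed]
  and rho_const = Aut_const[OF rho_closed] and rho_diff = Aut_diff[OF rho_closed]
  and rho_uminus = Aut_uminus[OF rho_closed] and rho_zero = Aut_zero[OF rho_closed]
  and rho_eq_0_iff = Aut_eq_0_iff[OF rho_closed]

abbreviation y_G :: "'k fps" where "y_G \<equiv> orbit_prod (carrier G) \<rho>"

lemma card_pos: "card (carrier G) > 0"
  using finite_G by (simp add: card_gt_0_iff, blast)

lemma subdegree_y: "subdegree y_G = card (carrier G)"
proof -
  have "subdegree (\<Prod>g\<in>A. \<rho> g fps_X) = card A \<and> (\<Prod>g\<in>A. \<rho> g fps_X) \<noteq> 0"
    if "finite A" "A \<subseteq> carrier G" for A
    using that by (induction A)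
      (auto simp: Aut_subdegree[OF rho_closed] rho_eq_0_iff)
  then show ?thesis using finite_G by (simp add: orbit_prod_def)
qed

lemma y_nonzero: "y_G \<noteq> 0" and y_nth_0: "y_G $ 0 = 0"
  using subdegree_y card_pos by (metis subdegree_0 less_irrefl, metis nth_less_subdegree_zero)

lemma rho_y: "g \<in> carrier G \<Longrightarrow> \<rho> g y_G = y_G"
proof -
  assume g: "g \<in> carrier G"
  have "\<rho> g y_G = (\<Prod>s\<in>carrier G. \<rho> (g \<otimes> s) fps_X)"
    using g by (simp add: orbit_prod_def Aut_prod[OF rho_closed] rho_mult)
  also have "\<dots> = y_G" unfolding orbit_prod_def by (rule prod_translate[OF g])
  finally show ?thesis .
qed

lemma rho_compose_y:
  assumes "g \<in> carrier G"
  shows "\<rho> g (F oo y_G) = F oo y_G"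
  by (metis Aut_X_nth_0 Aut_eq_compose assms fps_compose_assoc rho_closed rho_y y_nth_0)

end

locale faithful_fps_action = fps_action +
  assumes rho_inj: "inj_on \<rho> (carrier G)"
begin

lemma rho_X_inj: "inj_on (\<lambda>g. \<rho> g fps_X) (carrier G)"
  by (meson Aut_ext inj_onD inj_onI rho_closed rho_inj)

text \<open>Weierstrass division gives f = c_0(y) + c_1(y) t + ... with n = |G| terms. For invariant
  f, the polynomial obtained by replacing t by an unknown and subtracting f vanishes at all
  conjugates of t. These are n distinct roots, by faithfulness, of a polynomial of degree below n;
  so it is zero, and its constant coefficient says f = c_0(y).\<close>

lemma invariant_iff_compose: "(\<forall>g\<in>carrier G. \<rho> g f = f) \<longleftrightarrow> (\<exists>F. f = F oo y_G)"
proof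
  assume inv: "\<forall>g\<in>carrier G. \<rho> g f = f"
  define n where "n = card (carrier G)"
  obtain c where c: "f = (\<Sum>i<n. (c i oo y_G) * fps_X ^ i)"
    using weierstrass_division[of y_G f] card_pos by (auto simp: subdegree_y n_def)
  define p where "p = (\<Sum>i<n. monom (c i oo y_G) i) - [:f:]"
  have roots: "poly p (\<rho> g fps_X) = 0" if g: "g \<in> carrier G" for g
  proof -
    have "f = \<rho> g f" using inv g by simp
    also have "\<dots> = (\<Sum>i<n. (c i oo y_G) * \<rho> g fps_X ^ i)"
      by (subst (1) c) (simp add: Aut_sum[OF rho_closed] Aut_power[OF rho_closed] rho_times rho_compose_y g)
    finally show ?thesis by (simp add: p_def poly_sum poly_monom)
  qed
  have "degree p \<le> n - 1"
    unfolding p_def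
    by (intro degree_diff_le degree_sum_le) (auto intro!: order.trans[OF degree_monom_le])
  then have "p = 0"
    using card_pos by (intro poly_eq_0_if_card_roots[OF rho_X_inj roots]) (auto simp: n_def)
  then have "coeff p 0 = 0" by simp
  moreover have "coeff p 0 = (\<Sum>i<n. if i = 0 then c i oo y_G else 0) - f"
    by (simp add: p_def coeff_sum)
  ultimately show "\<exists>F. f = F oo y_G" using card_pos by (auto simp: n_def)
qed (auto simp: rho_compose_y)

text \<open>The coefficients of the minimal polynomial \<open>f\<close> of \<open>t\<close> over \<open>k[[y]]\<close> are power series in
  \<open>y\<close>, the constant one being \<open>\<plusminus> y\<close>. Differentiating \<open>f(t) = 0\<close> with respect to \<open>t\<close> therefore
  expresses \<open>f'(t)\<close> as a unit times \<open>dy/dt\<close>.\<close>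

lemma deriv_y:
  obtains U where "U $ 0 \<noteq> 0" "fps_deriv y_G * U = (\<Prod>h\<in>carrier G - {\<one>}. fps_X - \<rho> h fps_X)"
proof -
  define n where "n = card (carrier G)"
  define f where "f = (\<Prod>h\<in>carrier G. [:- \<rho> h fps_X, 1:])"
  have inv: "\<rho> g (coeff f i) = coeff f i" if g: "g \<in> carrier G" for g i
  proof -
    have "\<rho> g (coeff f i) = coeff (\<Prod>h\<in>carrier G. [:- \<rho> (g \<otimes> h) fps_X, 1:]) i"
      using g by (simp add: f_def Aut_coeff_prod[OF rho_closed] rho_mult)
    also have "(\<Prod>h\<in>carrier G. [:- \<rho> (g \<otimes> h) fps_X, 1:]) = f"
      unfolding f_def by (rule prod_translate[OF g])
    finally show ?thesis .
  qed
  then have "\<forall>i. \<exists>A. coeff f i = A oo y_G" using invariant_iff_compose by metis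
  then obtain A where A: "\<And>i. coeff f i = A i oo y_G" by metis
  have "coeff f 0 = (-1) ^ n * y_G"
    by (simp add: f_def orbit_prod_def n_def poly_prod prod_uminus flip: poly_0_coeff_0)
  also have "\<dots> = ((-1) ^ n * fps_X) oo y_G"
    by (cases "even n") (simp_all add: y_nth_0 fps_compose_uminus)
  finally have A0: "A 0 = (-1) ^ n * fps_X"
    using A fps_compose_cancel[OF y_nth_0 y_nonzero] by metis
  have one: "\<one> \<in> carrier G" by simp
  have "poly f fps_X = 0"
    unfolding f_def poly_prod using one finite_G by (intro prod_zero) (auto simp: rho_one intro!: bexI[OF _ one])
  then have "poly (map_poly fps_deriv f) fps_X + poly (pderiv f) fps_X = 0"
    using fps_deriv_poly[of f fps_X] by simp
  \<comment> \<open>By the product rule; a summand with \<open>a\<close> different from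
    \<open>\<one>\<close> contains the factor t - \<rho>(1)(t) = 0.\<close>
  moreover have "poly (pderiv f) fps_X = (\<Prod>h\<in>carrier G - {\<one>}. fps_X - \<rho> h fps_X)"
  proof -
    have "poly (pderiv f) fps_X = (\<Sum>a\<in>carrier G. \<Prod>h\<in>carrier G - {a}. fps_X - \<rho> h fps_X)"
      by (simp add: f_def pderiv_prod poly_sum poly_prod pderiv_pCons)
    also have "\<dots> = (\<Sum>a\<in>{\<one>}. \<Prod>h\<in>carrier G - {a}. fps_X - \<rho> h fps_X)"
      using finite_G one
      by (intro sum.mono_neutral_right ballI prod_zero bexI[of _ \<one>]) (auto simp: rho_one)
    finally show ?thesis by simp
  qed
  moreover
  define U where "U = - (\<Sum>i\<le>degree f. (fps_deriv (A i) oo y_G) * fps_X ^ i)"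
  have "poly (map_poly fps_deriv f) fps_X = (\<Sum>i\<le>degree f. fps_deriv (coeff f i) * fps_X ^ i)"
    unfolding poly_altdef
  proof (rule sum.mono_neutral_cong_left)
    show "{..degree (map_poly fps_deriv f)} \<subseteq> {..degree f}"
      using map_poly_degree_leq[of fps_deriv f] by auto
    show "\<forall>i\<in>{..degree f} - {..degree (map_poly fps_deriv f)}. fps_deriv (coeff f i) * fps_X ^ i = 0"
      using coeff_eq_0[of "map_poly fps_deriv f"] by (auto simp: coeff_map_poly simp del: fps_deriv_eq_0_iff)
  qed (simp_all add: coeff_map_poly)
  then have "poly (map_poly fps_deriv f) fps_X = - (fps_deriv y_G * U)"
    by (simp add: A fps_compose_deriv[OF y_nth_0] U_def sum_distrib_left mult_ac)
  \<comment> \<open>The summands with i > 0 carry a factor t, and the derivative of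
    \<open>A 0\<close> is 1 or -1; hence U is a unit.\<close>
  moreover have "U $ 0 = - (\<Sum>i\<in>{0}. ((fps_deriv (A i) oo y_G) * fps_X ^ i) $ 0)"
    unfolding U_def fps_neg_nth fps_sum_nth
    by (subst sum.mono_neutral_right[of _ "{0}"]) (auto simp: fps_mult_nth_0)
  then have "U $ 0 \<noteq> 0" by (cases "even n") (simp_all add: A0)
  ultimately show ?thesis using that[of U] by (simp add: add_eq_0_iff)
qed

text \<open>In characteristic p a nonconstant series may have derivative zero. Here a multiple of
  the derivative is a product of differences t - \<rho>(h)(t), none of which vanishes by
  faithfulness.\<close>

lemma deriv_y_nonzero: "fps_deriv y_G \<noteq> 0"
proof -
  obtain U where U: "fps_deriv y_G * U = (\<Prod>h\<in>carrier G - {\<one>}. fps_X - \<rho> h fps_X)" by (rule deriv_y)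
  have "fps_X \<noteq> \<rho> h fps_X" if "h \<in> carrier G - {\<one>}" for h
    using inj_onD[OF rho_X_inj, of \<one> h] that by (auto simp: rho_one)
  then have "(\<Prod>h\<in>carrier G - {\<one>}. fps_X - \<rho> h fps_X) \<noteq> 0"
    using finite_G by (simp add: prod_zero_iff)
  then show ?thesis using U by auto
qed

end

subsection \<open>The induced action on the invariants\<close>

declare mult_FactGroup [simp del]

lemma compose_partial_sum:
  fixes f h :: "'a::comm_ring_1 fps"
  assumes "h $ 0 = 0" "m < M"
  shows "(\<Sum>n<M. fps_const (f $ n) * h ^ n) $ m = (f oo h) $ m"
  using assms(2) unfolding fps_sum_nth fps_compose_nth
  by (intro sum.mono_neutral_cong_right) (auto simp: startsby_zero_power_prefix[OF assms(1)])

lemma fps_subst_sums: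
  fixes f h :: "'a::comm_ring_1 fps"
  assumes "h $ 0 = 0"
  shows "(\<lambda>n. fps_const (f $ n) * h ^ n) sums (f oo h)"
  unfolding sums_def
proof (rule tendsto_fpsI)
  show "\<forall>\<^sub>F M in sequentially. (\<Sum>n<M. fps_const (f $ n) * h ^ n) $ m = (f oo h) $ m" for m
    using eventually_gt_at_top[of m] by eventually_elim (rule compose_partial_sum[OF assms])
qed

lemma fps_subst_eq_compose: "h $ 0 = 0 \<Longrightarrow> fps_subst h f = f oo h"
  unfolding fps_subst_def using fps_subst_sums by (metis sums_unique)

locale normal_fps_action = faithful_fps_action + N: normal N G for N
begin

abbreviation "Q \<equiv> G Mod N"
abbreviation "\<rho>s \<equiv> sharp G N \<rho>"
abbreviation "y_N \<equiv> orbit_prod N \<rho>"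

sublocale N: faithful_fps_action "G\<lparr>carrier := N\<rparr>" \<rho>
  rewrites "carrier (G\<lparr>carrier := N\<rparr>) = N"
proof -
  have "group (G\<lparr>carrier := N\<rparr>)" by (rule N.subgroup_is_group[OF group_axioms])
  then show "faithful_fps_action (G\<lparr>carrier := N\<rparr>) \<rho>"
    using finite_subset[OF N.subset finite_G] rho_hom N.subset inj_on_subset[OF rho_inj N.subset]
    by (auto simp: faithful_fps_action_def fps_action_def fps_action_axioms_def
        faithful_fps_action_axioms_def hom_def subset_iff)
qed simp

lemma N_in_G: "n \<in> N \<Longrightarrow> n \<in> carrier G"
  using N.subset by auto

lemma from_inv_eq: "from_inv N \<rho> f = f oo y_N"
  by (simp add: from_inv_def fps_subst_eq_compose N.y_nth_0)

lemma compose_y_N_cancel: "F oo y_N = F' oo y_N \<longleftrightarrow> F = F'"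
  by (rule fps_compose_cancel[OF N.y_nth_0 N.y_nonzero])

lemma to_inv_compose [simp]: "to_inv N \<rho> (F oo y_N) = F"
  by (simp add: to_inv_def from_inv_eq compose_y_N_cancel)

lemma fps_inv_N_iff: "f \<in> fps_inv N \<rho> \<longleftrightarrow> (\<exists>F. f = F oo y_N)"
  using N.invariant_iff_compose by (simp add: fps_inv_def)

lemma compose_in_fps_inv: "F oo y_N \<in> fps_inv N \<rho>"
  using fps_inv_N_iff by blast

lemma to_inv_in: "f \<in> fps_inv N \<rho> \<Longrightarrow> to_inv N \<rho> f oo y_N = f"
  by (auto simp: fps_inv_N_iff)

lemma y_N_in: "y_N \<in> fps_inv N \<rho>"
  by (auto simp: fps_inv_def N.rho_y)

lemma fps_inv_G_subset: "f \<in> fps_inv (carrier G) \<rho> \<Longrightarrow> f \<in> fps_inv N \<rho>"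
  using N_in_G by (auto simp: fps_inv_def)

lemma rho_fps_inv:
  assumes "g \<in> carrier G" "f \<in> fps_inv N \<rho>"
  shows "\<rho> g f \<in> fps_inv N \<rho>"
  unfolding fps_inv_def
proof safe
  fix n assume n: "n \<in> N"
  have m: "inv g \<otimes> n \<otimes> g \<in> N" by (rule N.inv_op_closed1[OF assms(1) n])
  have "\<rho> n (\<rho> g f) = \<rho> (g \<otimes> (inv g \<otimes> n \<otimes> g)) f"
    using assms(1) N_in_G[OF n] by (simp add: rho_mult[symmetric] m_assoc[symmetric])
  also have "\<dots> = \<rho> g f" using assms m N_in_G[OF m] by (simp add: rho_mult fps_inv_def)
  finally show "\<rho> n (\<rho> g f) = \<rho> g f" .
qed

lemma coset_in_G: "C \<in> carrier Q \<Longrightarrow> g \<in> C \<Longrightarrow> g \<in> carrier G"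
  using N.rcosets_carrier[OF group_axioms] by (auto simp: FactGroup_def)

lemma coset_eq':
  assumes "C \<in> carrier Q" "g \<in> C"
  shows "C = N #> g"
proof -
  obtain h where h: "h \<in> carrier G" "C = N #> h" using assms(1) by (auto simp: carrier_FactGroup)
  show ?thesis
    unfolding h(2) by (rule repr_independence[OF _ h(1) N.subgroup_axioms]) (use assms(2) h(2) in simp)
qed

lemma rho_coset:
  assumes "C \<in> carrier Q" "g \<in> C" "h \<in> C" "f \<in> fps_inv N \<rho>"
  shows "\<rho> g f = \<rho> h f"
proof -
  have "g \<in> N #> h" using assms coset_eq' by blast
  then obtain n where n: "n \<in> N" "g = n \<otimes> h" by (auto simp: r_coset_def)
  then show ?thesis
    using rho_fps_inv[OF _ assms(4), of h] coset_in_G[OF assms(1,3)] N_in_G[OF n(1)]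
    by (simp add: rho_mult fps_inv_def)
qed

lemma coset_mem: "g \<in> carrier G \<Longrightarrow> g \<in> N #> g"
  by (rule rcos_self[OF _ N.subgroup_axioms])

lemma coset_in_Q: "g \<in> carrier G \<Longrightarrow> N #> g \<in> carrier Q"
  by (auto simp: carrier_FactGroup)

lemma coset_nonempty: "C \<in> carrier Q \<Longrightarrow> \<exists>g\<in>carrier G. g \<in> C"
  using coset_mem by (auto simp: carrier_FactGroup)

text \<open>Replaces the definite descriptions in \<open>sharp\<close> for \<open>\<rho>\<close>
  itself: as composition with \<open>y_N\<close> is injective, identities for \<open>\<rho>s\<close>
  are checked as identities for \<open>\<rho>\<close> on k[[t]]^N.\<close>

lemma sharp_compose:
  assumes "C \<in> carrier Q" "g \<in> C"
  shows "\<rho>s C f oo y_N = \<rho> g (f oo y_N)"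
proof -
  have r: "\<rho> h (f oo y_N) = \<rho> g (f oo y_N)" if "h \<in> C" for h
    using rho_coset[OF assms(1) that assms(2) compose_in_fps_inv] .
  have "\<rho>s C f = (THE f'. \<forall>h\<in>C. f' = to_inv N \<rho> (\<rho> h (f oo y_N)))"
    using assms by (simp add: sharp_def from_inv_eq)
  also have "\<dots> = to_inv N \<rho> (\<rho> g (f oo y_N))"
  proof (rule the_equality)
    show "\<forall>h\<in>C. to_inv N \<rho> (\<rho> g (f oo y_N)) = to_inv N \<rho> (\<rho> h (f oo y_N))"
      using r by metis
  qed (use assms(2) in blast)
  finally show ?thesis
    using to_inv_in rho_fps_inv[OF coset_in_G[OF assms] compose_in_fps_inv] by simp
qed

lemma sharp_eqI: "C \<in> carrier Q \<Longrightarrow> g \<in> C \<Longrightarrow> F oo y_N = \<rho> g (f oo y_N) \<Longrightarrow> \<rho>s C f = F"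
  using sharp_compose compose_y_N_cancel by metis

lemma group_Q: "group Q"
  by (rule N.factorgroup_is_group)

lemma coset_mult: "g \<in> carrier G \<Longrightarrow> h \<in> carrier G \<Longrightarrow> (N #> g) \<otimes>\<^bsub>Q\<^esub> (N #> h) = N #> (g \<otimes> h)"
  by (simp add: mult_FactGroup N.rcos_sum)

lemma coset_one: "\<one>\<^bsub>Q\<^esub> = N"
  by simp

lemma sharp_mult:
  assumes "C \<in> carrier Q" "D \<in> carrier Q"
  shows "\<rho>s (C \<otimes>\<^bsub>Q\<^esub> D) f = \<rho>s C (\<rho>s D f)"
proof -
  obtain g h where g: "g \<in> carrier G" "C = N #> g" and h: "h \<in> carrier G" "D = N #> h"
    using assms by (auto simp: carrier_FactGroup)
  have gh: "g \<otimes> h \<in> C \<otimes>\<^bsub>Q\<^esub> D" unfolding g(2) h(2) coset_mult[OF g(1) h(1)]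
    using g h by (intro coset_mem) auto
  have CD: "C \<otimes>\<^bsub>Q\<^esub> D \<in> carrier Q" using group_Q assms by (simp add: group.is_monoid monoid.m_closed)
  have gC: "g \<in> C" and hD: "h \<in> D" using g h coset_mem by auto
  show ?thesis
  proof (rule sharp_eqI[OF CD gh])
    have "\<rho>s C (\<rho>s D f) oo y_N = \<rho> g (\<rho> h (f oo y_N))"
      by (simp only: sharp_compose[OF assms(1) gC] sharp_compose[OF assms(2) hD])
    then show "\<rho>s C (\<rho>s D f) oo y_N = \<rho> (g \<otimes> h) (f oo y_N)"
      by (simp only: rho_mult[OF g(1) h(1)])
  qed
qed

lemma sharp_one: "\<rho>s N f = f"
proof (rule sharp_eqI)
  show "\<one> \<in> N" by simp
  show "N \<in> carrier Q" using monoid.one_closed[OF group.is_monoid[OF group_Q]] by simp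
qed (simp add: rho_one)

lemma sharp_closed:
  assumes "C \<in> carrier Q"
  shows "\<rho>s C \<in> carrier \<Gamma>"
proof -
  interpret Q: group Q by (rule group_Q)
  obtain g where g: "g \<in> carrier G" "g \<in> C" using coset_nonempty[OF assms] by auto
  have "\<rho>s C (\<rho>s (inv\<^bsub>Q\<^esub> C) f) = f" "\<rho>s (inv\<^bsub>Q\<^esub> C) (\<rho>s C f) = f" for f
    using assms sharp_mult[of C "inv\<^bsub>Q\<^esub> C" f] sharp_mult[of "inv\<^bsub>Q\<^esub> C" C f] sharp_one by simp_all
  then have "bij (\<rho>s C)" by (intro o_bij[of "\<rho>s (inv\<^bsub>Q\<^esub> C)"]) auto
  moreover have "\<rho>s C (a + b) = \<rho>s C a + \<rho>s C b" "\<rho>s C (a * b) = \<rho>s C a * \<rho>s C b"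
    "\<rho>s C (fps_const c) = fps_const c" for a b c
    by (rule sharp_eqI[OF assms g(2)],
        simp add: sharp_compose[OF assms g(2)] fps_compose_add_distrib fps_compose_mult_distrib
          N.y_nth_0 rho_add rho_times rho_const g)+
  ultimately show ?thesis by (simp add: Aut_fps_def)
qed

lemma sharp_hom: "\<rho>s \<in> hom Q \<Gamma>"
  by (intro homI sharp_closed) (auto simp: sharp_mult Aut_fps_def fun_eq_iff)

text \<open>An element of \<open>G\<close> fixing \<open>k[[t]]\<^sup>N\<close> fixes the coefficients of \<open>\<Prod>\<^bsub>n \<in> N\<^esub> (T - \<rho>(n)(t))\<close>,
  hence permutes its roots.\<close>

lemma fixes_fps_inv_imp_mem:
  assumes h: "h \<in> carrier G" and fixed: "\<And>f. f \<in> fps_inv N \<rho> \<Longrightarrow> \<rho> h f = f"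
  shows "h \<in> N"
proof -
  define p where "p = (\<Prod>n\<in>N. [:- \<rho> n fps_X, 1:])"
  have "coeff p i \<in> fps_inv N \<rho>" for i
    unfolding fps_inv_def
  proof safe
    fix n assume n: "n \<in> N"
    have "\<rho> n (coeff p i) = coeff (\<Prod>s\<in>N. [:- \<rho> (n \<otimes> s) fps_X, 1:]) i"
      using n by (simp add: p_def Aut_coeff_prod[OF N.rho_closed] rho_mult N_in_G)
    also have "(\<Prod>s\<in>N. [:- \<rho> (n \<otimes> s) fps_X, 1:]) = p"
      unfolding p_def using N.prod_translate[OF n] by simp
    finally show "\<rho> n (coeff p i) = coeff p i" .
  qed
  then have c: "\<rho> h (coeff p i) = coeff p i" for i using fixed by auto
  have "poly p fps_X = 0"
    unfolding p_def poly_prod using N.finite_G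
    by (intro prod_zero bexI[of _ \<one>]) (auto simp: rho_one)
  then have "\<rho> h (poly p fps_X) = 0" using h by (simp add: rho_zero)
  then have "poly p (\<rho> h fps_X) = 0"
    using h by (simp add: poly_altdef Aut_sum[OF rho_closed] rho_times Aut_power[OF rho_closed] c)
  then obtain n where "n \<in> N" "\<rho> h fps_X = \<rho> n fps_X"
    using N.finite_G by (auto simp: p_def poly_prod prod_zero_iff)
  then show ?thesis using inj_onD[OF rho_X_inj _ h N_in_G] by auto
qed

lemma sharp_inj: "inj_on \<rho>s (carrier Q)"
proof (rule inj_onI)
  fix C D assume CD: "C \<in> carrier Q" "D \<in> carrier Q" "\<rho>s C = \<rho>s D"
  obtain g where g: "g \<in> carrier G" "g \<in> C" using coset_nonempty[OF CD(1)] by auto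
  obtain h where h: "h \<in> carrier G" "h \<in> D" using coset_nonempty[OF CD(2)] by auto
  have "\<rho> (inv h \<otimes> g) f = f" if f: "f \<in> fps_inv N \<rho>" for f
  proof -
    obtain F where F: "f = F oo y_N" using f by (auto simp: fps_inv_N_iff)
    have "\<rho> g f = \<rho> h f"
      unfolding F by (metis sharp_compose[OF CD(1) g(2)] sharp_compose[OF CD(2) h(2)] CD(3))
    then show ?thesis by (simp add: rho_mult[OF inv_closed[OF h(1)] g(1)] rho_inv_left[OF h(1)])
  qed
  then have m: "inv h \<otimes> g \<in> N" using g h by (intro fixes_fps_inv_imp_mem) auto
  \<comment> \<open>Elements of G/N are right cosets N h, so membership is a condition on g h^-1,
    while the Galois argument controls h^-1 g; normality converts one into the other.\<close>
  have "g \<otimes> inv h = h \<otimes> (inv h \<otimes> g) \<otimes> inv h"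
    using g h by (simp add: m_assoc[symmetric])
  then have "g \<otimes> inv h \<in> N" using N.inv_op_closed2[OF h(1) m] by simp
  then have "g \<in> N #> h"
    using g h by (auto simp: r_coset_def m_assoc intro!: bexI[of _ "g \<otimes> inv h"])
  then have "g \<in> D" using coset_eq'[OF CD(2) h(2)] by simp
  then show "C = D" using coset_eq'[OF CD(1) g(2)] coset_eq'[OF CD(2)] by metis
qed

lemma finite_Q: "finite (carrier Q)"
  using finite_G by (simp add: carrier_FactGroup)

sublocale Q: faithful_fps_action "G Mod N" "sharp G N \<rho>"
  using group_Q finite_Q sharp_hom sharp_inj
  by (simp add: faithful_fps_action_def fps_action_def fps_action_axioms_def faithful_fps_action_axioms_def)

text \<open>Norms are transitive: the factors of \<open>y_G\<close> belonging to one coset multiply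
  to one conjugate of \<open>y_N\<close>.\<close>

lemma compose_y_Q: "Q.y_G oo y_N = y_G"
proof -
  have "(\<Prod>g\<in>C. \<rho> g fps_X) = \<rho>s C fps_X oo y_N" if C: "C \<in> carrier Q" for C
  proof -
    obtain g where g: "g \<in> carrier G" "g \<in> C" using coset_nonempty[OF C] by auto
    have "C = g <# N" using coset_eq'[OF C g(2)] N.coset_eq g(1) by blast
    then have "(\<Prod>g\<in>C. \<rho> g fps_X) = (\<Prod>n\<in>N. \<rho> (g \<otimes> n) fps_X)"
      using g N_in_G
      by (auto simp: l_coset_def intro!: prod.reindex_bij_witness[of _ "\<lambda>n. g \<otimes> n" "\<lambda>s. inv g \<otimes> s"]
          simp: m_assoc[symmetric])
    also have "\<dots> = \<rho> g y_N"
      using g N_in_G by (simp add: orbit_prod_def Aut_prod[OF rho_closed] rho_mult)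
    finally show ?thesis using sharp_compose[OF C g(2), of fps_X] by (simp add: N.y_nth_0)
  qed
  then have "Q.y_G oo y_N = (\<Prod>C\<in>carrier Q. \<Prod>g\<in>C. \<rho> g fps_X)"
    by (simp add: orbit_prod_def[of "carrier Q"] fps_compose_prod_distrib[OF N.y_nth_0])
  also have "\<dots> = (\<Prod>g\<in>\<Union>(carrier Q). \<rho> g fps_X)"
  proof -
    have "\<forall>C\<in>carrier Q. finite C" using coset_in_G finite_subset[OF _ finite_G] by blast
    moreover have "\<forall>C\<in>carrier Q. \<forall>D\<in>carrier Q. C \<noteq> D \<longrightarrow> C \<inter> D = {}"
      using coset_eq' by blast
    ultimately show ?thesis using prod.Union_disjoint[of "carrier Q" "\<lambda>g. \<rho> g fps_X"] by simp
  qed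
  also have "\<Union>(carrier Q) = carrier G"
    using rcosets_part_G[OF N.subgroup_axioms] by (simp add: FactGroup_def)
  finally show ?thesis by (simp add: orbit_prod_def)
qed

text \<open>\<open>w = dy\<^sub>G/dy\<^sub>N\<close>, which will turn out to generate the different of \<open>k[[t]]\<^sup>N\<close> over \<open>k[[t]]\<^sup>G\<close>.\<close>

definition w where "w = fps_deriv Q.y_G oo y_N"

lemma w_in: "w \<in> fps_inv N \<rho>"
  by (simp add: w_def compose_in_fps_inv)

lemma deriv_y_G: "fps_deriv y_G = w * fps_deriv y_N"
  by (metis N.y_nth_0 compose_y_Q fps_compose_deriv w_def)

lemma w_nonzero: "w \<noteq> 0"
  using deriv_y_nonzero deriv_y_G by auto

text \<open>The Jacobian of the action of C in the coordinate \<open>y_N\<close>, as an element of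
  k[[t]].\<close>

definition jac where "jac C = fps_deriv (\<rho>s C fps_X) oo y_N"

lemma deriv_sharp:
  assumes "C \<in> carrier Q" "g \<in> C"
  shows "fps_deriv (\<rho>s C F) oo y_N = \<rho> g (fps_deriv F oo y_N) * jac C"
proof -
  note X0 = Aut_X_nth_0[OF Q.rho_closed[OF assms(1)]]
  have "fps_deriv (\<rho>s C F) = (fps_deriv F oo \<rho>s C fps_X) * fps_deriv (\<rho>s C fps_X)"
    using Aut_eq_compose[OF Q.rho_closed[OF assms(1)], of F] fps_compose_deriv[OF X0] by metis
  also have "fps_deriv F oo \<rho>s C fps_X = \<rho>s C (fps_deriv F)"
    using Aut_eq_compose[OF Q.rho_closed[OF assms(1)]] by metis
  finally show ?thesis
    by (simp add: fps_compose_mult_distrib[OF N.y_nth_0] sharp_compose[OF assms] jac_def)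
qed

text \<open>Obtained by differentiating the invariance of \<open>Q.y_G\<close>. So w is N-invariant
  but only semi-invariant under G.\<close>

lemma rho_w: "C \<in> carrier Q \<Longrightarrow> g \<in> C \<Longrightarrow> w = \<rho> g w * jac C"
  using deriv_sharp[of C g Q.y_G] Q.rho_y[of C] by (simp add: w_def)

end

subsection \<open>The different\<close>

text \<open>Euler's formula. Lagrange interpolation at the nodes \<open>a x\<close> reproduces T^i
  for i < n, where n is the number of nodes; the claim compares coefficients of T^(n-1), since the
  products \<open>q x\<close> are monic of that degree.\<close>

lemma lagrange_power_sum:
  fixes a :: "'x \<Rightarrow> 'l::field"
  assumes fin: "finite A" and inj: "inj_on a A" and i: "i < card A"
  shows "(\<Sum>x\<in>A. a x ^ i / (\<Prod>z\<in>A - {x}. a x - a z)) = (if i = card A - 1 then 1 else 0)"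
proof -
  define D where "D = (\<lambda>x. \<Prod>z\<in>A - {x}. a x - a z)"
  define q where "q = (\<lambda>x. \<Prod>z\<in>A - {x}. [:- a z, 1:])"
  define p where "p = (\<Sum>x\<in>A. smult (a x ^ i / D x) (q x)) - monom 1 i"
  have D: "D x \<noteq> 0" if "x \<in> A" for x
    using that fin inj by (auto simp: D_def prod_zero_iff dest: inj_onD)
  have deg: "degree (q x) = card A - 1" if "x \<in> A" for x
    unfolding q_def by (subst degree_prod_eq_sum_degree) (use that fin in auto)
  have "lead_coeff (q x) = 1" for x unfolding q_def lead_coeff_prod by simp
  then have lead: "coeff (q x) (card A - 1) = 1" if "x \<in> A" for x using deg[OF that] by metis
  have roots: "poly p (a x) = 0" if x: "x \<in> A" for x
  proof -
    have "(\<Sum>z\<in>A. a z ^ i / D z * poly (q z) (a x)) = (\<Sum>z\<in>{x}. a z ^ i / D z * poly (q z) (a x))"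
      using fin x by (intro sum.mono_neutral_right) (auto simp: q_def poly_prod prod_zero_iff)
    moreover have "poly (q x) (a x) = D x" by (simp add: q_def D_def poly_prod)
    ultimately show ?thesis using D[OF x] by (simp add: p_def poly_sum poly_monom)
  qed
  have "degree p \<le> card A - 1"
    unfolding p_def using i deg fin
    by (intro degree_diff_le degree_sum_le order.trans[OF degree_smult_le])
      (auto intro!: order.trans[OF degree_monom_le])
  then have "p = 0" using i by (intro poly_eq_0_if_card_roots[OF inj roots]) auto
  then have "coeff p (card A - 1) = 0" by simp
  then have "(\<Sum>x\<in>A. a x ^ i / D x) = coeff (monom 1 i) (card A - 1)"
    by (simp add: p_def coeff_sum lead del: One_nat_def)
  then show ?thesis by (simp add: D_def)
qed

section \<open>Fraction fields of the invariant rings and their Galois group\<close>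

lemma fps_fracI: "a \<in> T \<Longrightarrow> b \<in> T \<Longrightarrow> b \<noteq> 0 \<Longrightarrow> fps_to_fls a / fps_to_fls b \<in> fps_frac T"
  by (auto simp: fps_frac_def)

context fps_action
begin

lemma fps_inv_add: "H \<subseteq> carrier G \<Longrightarrow> f \<in> fps_inv H \<rho> \<Longrightarrow> g \<in> fps_inv H \<rho> \<Longrightarrow> f + g \<in> fps_inv H \<rho>"
  and fps_inv_mult: "H \<subseteq> carrier G \<Longrightarrow> f \<in> fps_inv H \<rho> \<Longrightarrow> g \<in> fps_inv H \<rho> \<Longrightarrow> f * g \<in> fps_inv H \<rho>"
  and fps_inv_0: "H \<subseteq> carrier G \<Longrightarrow> 0 \<in> fps_inv H \<rho>"
  and fps_inv_1: "H \<subseteq> carrier G \<Longrightarrow> 1 \<in> fps_inv H \<rho>"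
  by (auto simp: fps_inv_def rho_add rho_times rho_zero Aut_one[OF rho_closed] subset_iff)

lemma fps_inv_sum:
  "H \<subseteq> carrier G \<Longrightarrow> (\<And>i. i \<in> I \<Longrightarrow> f i \<in> fps_inv H \<rho>) \<Longrightarrow> (\<Sum>i\<in>I. f i) \<in> fps_inv H \<rho>"
  by (induction I rule: infinite_finite_induct) (auto simp: fps_inv_0 fps_inv_add)

lemma fps_inv_prod:
  "H \<subseteq> carrier G \<Longrightarrow> (\<And>i. i \<in> I \<Longrightarrow> f i \<in> fps_inv H \<rho>) \<Longrightarrow> (\<Prod>i\<in>I. f i) \<in> fps_inv H \<rho>"
  by (induction I rule: infinite_finite_induct) (auto simp: fps_inv_1 fps_inv_mult)

lemma fps_inv_power: "H \<subseteq> carrier G \<Longrightarrow> f \<in> fps_inv H \<rho> \<Longrightarrow> f ^ n \<in> fps_inv H \<rho>"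
  by (induction n) (auto simp: fps_inv_1 fps_inv_mult)

lemma fps_frac_mult:
  assumes "H \<subseteq> carrier G" "x \<in> fps_frac (fps_inv H \<rho>)" "y \<in> fps_frac (fps_inv H \<rho>)"
  shows "x * y \<in> fps_frac (fps_inv H \<rho>)"
proof -
  obtain a b c d where "x = fps_to_fls a / fps_to_fls b" "y = fps_to_fls c / fps_to_fls d"
    and "a \<in> fps_inv H \<rho>" "b \<in> fps_inv H \<rho>" "b \<noteq> 0" "c \<in> fps_inv H \<rho>" "d \<in> fps_inv H \<rho>" "d \<noteq> 0"
    using assms by (auto simp: fps_frac_def)
  then show ?thesis
    using fps_inv_mult[OF assms(1)] fps_fracI[of "a * c" "fps_inv H \<rho>" "b * d"]
    by (simp add: fls_times_fps_to_fls)
qed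

lemma fps_frac_add:
  assumes "H \<subseteq> carrier G" "x \<in> fps_frac (fps_inv H \<rho>)" "y \<in> fps_frac (fps_inv H \<rho>)"
  shows "x + y \<in> fps_frac (fps_inv H \<rho>)"
proof -
  obtain a b c d where "x = fps_to_fls a / fps_to_fls b" "y = fps_to_fls c / fps_to_fls d"
    and "a \<in> fps_inv H \<rho>" "b \<in> fps_inv H \<rho>" "b \<noteq> 0" "c \<in> fps_inv H \<rho>" "d \<in> fps_inv H \<rho>" "d \<noteq> 0"
    using assms by (auto simp: fps_frac_def)
  then show ?thesis
    using fps_inv_mult[OF assms(1)] fps_inv_add[OF assms(1)]
      fps_fracI[of "a * d + c * b" "fps_inv H \<rho>" "b * d"]
    by (simp add: fls_times_fps_to_fls add_frac_eq)
qed

lemma fps_frac_of_fps: "H \<subseteq> carrier G \<Longrightarrow> f \<in> fps_inv H \<rho> \<Longrightarrow> fps_to_fls f \<in> fps_frac (fps_inv H \<rho>)"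
  using fps_fracI[of f _ 1] by (simp add: fps_inv_1)

end

lemma fps_to_fls_sum: "fps_to_fls (\<Sum>i\<in>I. f i) = (\<Sum>i\<in>I. fps_to_fls (f i :: 'a::comm_ring_1 fps))"
  by (induction I rule: infinite_finite_induct) (auto simp: fps_to_fls_plus)

lemma fps_to_fls_prod: "fps_to_fls (\<Prod>i\<in>I. f i) = (\<Prod>i\<in>I. fps_to_fls (f i :: 'a::comm_ring_1 fps))"
  by (induction I rule: infinite_finite_induct) (auto simp: fls_times_fps_to_fls)

context normal_fps_action
begin

abbreviation "S \<equiv> fps_inv N \<rho>"
abbreviation "R \<equiv> fps_inv (carrier G) \<rho>"
abbreviation "\<iota> \<equiv> fps_to_fls"

definition yc where "yc C = \<rho>s C fps_X oo y_N"

lemma yc_rho: "C \<in> carrier Q \<Longrightarrow> g \<in> C \<Longrightarrow> \<rho> g y_N = yc C"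
  using sharp_compose[of C g fps_X] by (simp add: yc_def N.y_nth_0)

lemma N_in_Q: "N \<in> carrier Q"
  using Q.one_closed by simp

lemma yc_N: "yc N = y_N"
  using sharp_one[of fps_X] by (simp add: yc_def N.y_nth_0)

lemma yc_in: "yc C \<in> S"
  by (simp add: yc_def compose_in_fps_inv)

lemma yc_inj: "inj_on yc (carrier Q)"
  using Q.rho_X_inj by (simp add: inj_on_def yc_def compose_y_N_cancel)

lemma rho_yc:
  assumes "C \<in> carrier Q" "D \<in> carrier Q" "g \<in> D"
  shows "\<rho> g (yc C) = yc (D \<otimes>\<^bsub>Q\<^esub> C)"
  using sharp_compose[OF assms(2,3), of "\<rho>s C fps_X"] sharp_mult[OF assms(2,1), of fps_X]
  by (simp add: yc_def)

lemma prod_translate_minus: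
  assumes D: "D \<in> carrier Q"
  shows "(\<Prod>C\<in>carrier Q - {N}. h (D \<otimes>\<^bsub>Q\<^esub> C)) = (\<Prod>C\<in>carrier Q - {D}. h C)"
proof -
  have *: "inv\<^bsub>Q\<^esub> D \<otimes>\<^bsub>Q\<^esub> (D \<otimes>\<^bsub>Q\<^esub> C) = C" "D \<otimes>\<^bsub>Q\<^esub> (inv\<^bsub>Q\<^esub> D \<otimes>\<^bsub>Q\<^esub> C) = C" if "C \<in> carrier Q" for C
    using that D Q.m_assoc[of "inv\<^bsub>Q\<^esub> D" D C] Q.m_assoc[of D "inv\<^bsub>Q\<^esub> D" C] by (simp_all del: coset_one add: Q.l_one[unfolded coset_one])
  have **: "D \<otimes>\<^bsub>Q\<^esub> N = D" using Q.r_one[OF D] by simp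
  have ***: "D \<otimes>\<^bsub>Q\<^esub> C \<noteq> D" if "C \<in> carrier Q - {N}" for C
    using that *(1)[of C] *(1)[OF N_in_Q] ** by auto
  show ?thesis
  proof (rule prod.reindex_bij_witness[of _ "\<lambda>C. inv\<^bsub>Q\<^esub> D \<otimes>\<^bsub>Q\<^esub> C" "\<lambda>C. D \<otimes>\<^bsub>Q\<^esub> C"])
    fix C assume C: "C \<in> carrier Q - {D}"
    then have "inv\<^bsub>Q\<^esub> D \<otimes>\<^bsub>Q\<^esub> C \<noteq> N" using *(2)[of C] ** by auto
    then show "inv\<^bsub>Q\<^esub> D \<otimes>\<^bsub>Q\<^esub> C \<in> carrier Q - {N}" using C D by simp
  qed (use * *** D in simp_all)
qed

text \<open>Weierstrass division inside k[[y_N]] by \<open>Q.y_G\<close>, the expression of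
  \<open>y_G\<close> in the coordinate \<open>y_N\<close>; its subdegree is the order of
  G/N.\<close>

lemma fps_inv_basis:
  assumes "s \<in> S"
  obtains r where "\<And>i. r i \<in> R" "s = (\<Sum>i<card (carrier Q). r i * y_N ^ i)"
proof -
  obtain F where F: "s = F oo y_N" using assms by (auto simp: fps_inv_N_iff)
  obtain c where "F = (\<Sum>i<card (carrier Q). (c i oo Q.y_G) * fps_X ^ i)"
    using weierstrass_division[of Q.y_G F] Q.card_pos by (auto simp: Q.subdegree_y)
  then have "s = (\<Sum>i<card (carrier Q). (c i oo y_G) * y_N ^ i)"
    by (simp add: F fps_compose_sum_distrib fps_compose_mult_distrib N.y_nth_0 Q.y_nth_0
        fps_compose_power[symmetric] fps_compose_assoc[symmetric] compose_y_Q)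
  moreover have "c i oo y_G \<in> R" for i
    by (simp add: fps_inv_def rho_compose_y)
  ultimately show ?thesis using that[of "\<lambda>i. c i oo y_G"] by simp
qed

definition ext where "ext g x = fls_compose_fps x (\<rho> g fps_X)"

lemma ext_of_fps: "g \<in> carrier G \<Longrightarrow> ext g (\<iota> f) = \<iota> (\<rho> g f)"
  using Aut_eq_compose[OF rho_closed, of g f]
  by (simp add: ext_def Aut_X_nonzero[OF rho_closed] Aut_X_nth_0[OF rho_closed])

lemma ext_add: "g \<in> carrier G \<Longrightarrow> ext g (x + y) = ext g x + ext g y"
  and ext_mult: "g \<in> carrier G \<Longrightarrow> ext g (x * y) = ext g x * ext g y"
  and ext_divide: "g \<in> carrier G \<Longrightarrow> ext g (x / y) = ext g x / ext g y"
  by (simp_all add: ext_def fls_compose_fps_add fls_compose_fps_mult fls_compose_fps_divide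
      Aut_X_nonzero[OF rho_closed] Aut_X_nth_0[OF rho_closed])

lemma frac_cases:
  assumes "x \<in> fps_frac T"
  obtains a b where "a \<in> T" "b \<in> T" "b \<noteq> 0" "x = \<iota> a / \<iota> b"
  using assms by (auto simp: fps_frac_def)

lemma ext_closed: "g \<in> carrier G \<Longrightarrow> x \<in> fps_frac S \<Longrightarrow> ext g x \<in> fps_frac S"
  by (erule frac_cases) (simp add: ext_divide ext_of_fps rho_eq_0_iff rho_fps_inv fps_fracI)

lemma ext_inv:
  assumes "g \<in> carrier G" "x \<in> fps_frac S"
  shows "ext g (ext (inv g) x) = x" "ext (inv g) (ext g x) = x"
  using assms by (auto elim!: frac_cases simp: ext_divide ext_of_fps rho_inv_left rho_inv_right)

lemma ext_fixes: "g \<in> carrier G \<Longrightarrow> x \<in> fps_frac R \<Longrightarrow> ext g x = x"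
  by (erule frac_cases) (simp add: ext_divide ext_of_fps fps_inv_def)

lemma ext_coset:
  assumes "C \<in> carrier Q" "g \<in> C" "h \<in> C" "x \<in> fps_frac S"
  shows "ext g x = ext h x"
  using assms(4) by (rule frac_cases)
    (simp add: ext_divide ext_of_fps coset_in_G[OF assms(1,2)] coset_in_G[OF assms(1,3)] rho_coset[OF assms(1-3)])

definition rep :: "'a set \<Rightarrow> 'a" where "rep C = (SOME g. g \<in> C)"

lemma rep_mem: "C \<in> carrier Q \<Longrightarrow> rep C \<in> C"
  by (metis coset_nonempty rep_def someI)

lemma rep_in_G: "C \<in> carrier Q \<Longrightarrow> rep C \<in> carrier G"
  using rep_mem coset_in_G by blast

text \<open>The trace is defined by all field automorphisms, so these must be determined. One that
  fixes Frac R is known from its value at \<open>y_N\<close>, because powers of \<open>y_N\<close>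
  span S over R. That value is a root of the orbit polynomial of \<open>y_N\<close>, whose
  coefficients lie in R, hence some conjugate \<open>yc C\<close>; the automorphism then agrees with
  the action of C.\<close>

lemma bij_betw_Gal:
  "bij_betw (\<lambda>C. \<lambda>x\<in>fps_frac S. ext (rep C) x) (carrier Q) (Gal (fps_frac S) (fps_frac R))"
proof (rule bij_betw_imageI)
  note yL = fps_frac_of_fps[OF N.subset y_N_in]
  show "inj_on (\<lambda>C. \<lambda>x\<in>fps_frac S. ext (rep C) x) (carrier Q)"
  proof (rule inj_onI)
    fix C D assume CD: "C \<in> carrier Q" "D \<in> carrier Q"
      and eq: "(\<lambda>x\<in>fps_frac S. ext (rep C) x) = (\<lambda>x\<in>fps_frac S. ext (rep D) x)"
    have "ext (rep C) (\<iota> y_N) = ext (rep D) (\<iota> y_N)" using fun_cong[OF eq, of "\<iota> y_N"] yL by simp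
    then have "yc C = yc D" using CD by (simp add: ext_of_fps rep_in_G yc_rho rep_mem)
    then show "C = D" using yc_inj CD by (auto dest: inj_onD)
  qed
  show "(\<lambda>C. \<lambda>x\<in>fps_frac S. ext (rep C) x) ` carrier Q = Gal (fps_frac S) (fps_frac R)"
  proof (intro equalityI subsetI)
    fix \<tau> assume "\<tau> \<in> (\<lambda>C. \<lambda>x\<in>fps_frac S. ext (rep C) x) ` carrier Q"
    then obtain g where g: "g \<in> carrier G" and \<tau>: "\<tau> = (\<lambda>x\<in>fps_frac S. ext g x)"
      using rep_in_G by blast
    have "bij_betw \<tau> (fps_frac S) (fps_frac S)"
      by (rule bij_betw_byWitness[of _ "ext (inv g)"]) (auto simp: \<tau> g ext_inv ext_closed)
    moreover have "fps_frac R \<subseteq> fps_frac S"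
      using fps_inv_G_subset by (auto simp: fps_frac_def)
    ultimately show "\<tau> \<in> Gal (fps_frac S) (fps_frac R)"
      using g by (auto simp: Gal_def \<tau> fps_frac_add[OF N.subset] fps_frac_mult[OF N.subset] ext_add ext_mult ext_fixes)
  next
    fix \<tau> assume "\<tau> \<in> Gal (fps_frac S) (fps_frac R)"
    then have ex: "\<tau> \<in> extensional (fps_frac S)" and bij: "bij_betw \<tau> (fps_frac S) (fps_frac S)"
      and add: "\<And>x y. x \<in> fps_frac S \<Longrightarrow> y \<in> fps_frac S \<Longrightarrow> \<tau> (x + y) = \<tau> x + \<tau> y"
      and mult: "\<And>x y. x \<in> fps_frac S \<Longrightarrow> y \<in> fps_frac S \<Longrightarrow> \<tau> (x * y) = \<tau> x * \<tau> y"
      and K: "\<And>x. x \<in> fps_frac R \<Longrightarrow> \<tau> x = x"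
      by (auto simp: Gal_def)
    note SL = fps_frac_of_fps[OF N.subset]
    have R: "\<tau> (\<iota> r) = \<iota> r" if "r \<in> R" for r using K fps_frac_of_fps[OF order.refl that] by blast
    have one: "\<tau> 1 = 1" and zero: "\<tau> 0 = 0"
      using R[OF fps_inv_1[OF order.refl]] R[OF fps_inv_0[OF order.refl]] by simp_all
    have pow: "\<tau> (\<iota> (y_N ^ i)) = \<tau> (\<iota> y_N) ^ i" for i
    proof (induction i)
      case (Suc i)
      then show ?case using mult[OF yL SL[OF fps_inv_power[OF N.subset y_N_in], of i]]
        by (simp add: fls_times_fps_to_fls)
    qed (simp add: one)
    have comb: "\<tau> (\<iota> (\<Sum>i\<in>I. r i * y_N ^ i)) = (\<Sum>i\<in>I. \<iota> (r i) * \<tau> (\<iota> y_N) ^ i)"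
      if r: "\<And>i. r i \<in> R" for r and I :: "nat set"
    proof (induction I rule: infinite_finite_induct)
      case (insert i I)
      have S: "r j * y_N ^ j \<in> S" for j
        by (intro fps_inv_mult[OF N.subset] fps_inv_power[OF N.subset] y_N_in fps_inv_G_subset r)
      have "\<tau> (\<iota> (r i * y_N ^ i)) = \<iota> (r i) * \<tau> (\<iota> y_N) ^ i"
        using mult[OF SL[OF fps_inv_G_subset[OF r]] SL[OF fps_inv_power[OF N.subset y_N_in]], of i i]
        by (simp add: fls_times_fps_to_fls pow R[OF r])
      moreover have "\<tau> (\<iota> (r i * y_N ^ i + (\<Sum>i\<in>I. r i * y_N ^ i)))
          = \<tau> (\<iota> (r i * y_N ^ i)) + \<tau> (\<iota> (\<Sum>i\<in>I. r i * y_N ^ i))"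
        using add[OF SL[OF S] SL[OF fps_inv_sum[OF N.subset S]]] by (simp add: fps_to_fls_plus)
      ultimately show ?case using insert by simp
    qed (simp_all add: zero)
    define f where "f = (\<Prod>C\<in>carrier Q. [:- yc C, 1:])"
    have fR: "coeff f i \<in> R" for i
      unfolding fps_inv_def
    proof safe
      fix g assume g: "g \<in> carrier G"
      have "\<rho> g (coeff f i) = coeff (\<Prod>C\<in>carrier Q. [:- yc ((N #> g) \<otimes>\<^bsub>Q\<^esub> C), 1:]) i"
        using g rho_yc[OF _ coset_in_Q[OF g] coset_mem[OF g]]
        by (simp add: f_def Aut_coeff_prod[OF rho_closed])
      then show "\<rho> g (coeff f i) = coeff f i"
        by (simp add: f_def Q.prod_translate[OF coset_in_Q[OF g], of "\<lambda>C. [:- yc C, 1:]"])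
    qed
    have "poly f y_N = 0"
      unfolding f_def poly_prod using finite_Q N_in_Q by (intro prod_zero bexI[of _ N]) (auto simp: yc_N)
    then have "\<tau> (\<iota> (\<Sum>i\<le>degree f. coeff f i * y_N ^ i)) = 0" by (simp add: poly_altdef zero)
    then have "(\<Sum>i\<le>degree f. \<iota> (coeff f i) * \<tau> (\<iota> y_N) ^ i) = 0" by (simp add: comb fR)
    moreover have "coeff (\<Prod>C\<in>carrier Q. [:- \<iota> (yc C), 1:]) i = \<iota> (coeff f i)" for i
      unfolding f_def by (rule hom_coeff_prod[symmetric]) (auto simp: fps_to_fls_plus fls_times_fps_to_fls)
    moreover have "degree (\<Prod>C\<in>carrier Q. [:- \<iota> (yc C), 1:]) = degree f"
      unfolding f_def by (subst (1 2) degree_prod_eq_sum_degree) auto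
    ultimately have "poly (\<Prod>C\<in>carrier Q. [:- \<iota> (yc C), 1:]) (\<tau> (\<iota> y_N)) = 0"
      by (simp add: poly_altdef)
    then obtain C where C: "C \<in> carrier Q" "\<tau> (\<iota> y_N) = \<iota> (yc C)"
      using finite_Q by (auto simp: poly_prod prod_zero_iff)
    have \<tau>S: "\<tau> (\<iota> s) = \<iota> (\<rho> (rep C) s)" if s: "s \<in> S" for s
    proof -
      obtain r where r: "\<And>i. r i \<in> R" "s = (\<Sum>i<card (carrier Q). r i * y_N ^ i)"
        using fps_inv_basis[OF s] by blast
      have "\<rho> (rep C) s = (\<Sum>i<card (carrier Q). r i * yc C ^ i)"
        using r(1) rep_in_G[OF C(1)]
        by (simp add: r(2) Aut_sum[OF rho_closed] rho_times Aut_power[OF rho_closed] yc_rho[OF C(1) rep_mem[OF C(1)]])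
          (simp add: fps_inv_def)
      moreover have "\<tau> (\<iota> s) = (\<Sum>i<card (carrier Q). \<iota> (r i) * \<iota> (yc C) ^ i)"
        using comb[of r "{..<card (carrier Q)}", OF r(1)] C(2) r(2) by simp
      ultimately show ?thesis by (simp add: fps_to_fls_sum fls_times_fps_to_fls fps_to_fls_power)
    qed
    have "\<tau> x = ext (rep C) x" if x: "x \<in> fps_frac S" for x
    proof -
      obtain a b where ab: "a \<in> S" "b \<in> S" "b \<noteq> 0" "x = \<iota> a / \<iota> b" using x by (rule frac_cases)
      have "\<tau> (x * \<iota> b) = \<tau> x * \<tau> (\<iota> b)" using x SL[OF ab(2)] by (rule mult)
      moreover have "x * \<iota> b = \<iota> a" using ab by simp
      ultimately have "\<tau> x * \<iota> (\<rho> (rep C) b) = \<iota> (\<rho> (rep C) a)" using \<tau>S ab by simp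
      then have "\<tau> x = \<iota> (\<rho> (rep C) a) / \<iota> (\<rho> (rep C) b)"
        using ab(3) rho_eq_0_iff[OF rep_in_G[OF C(1)]] by (simp add: eq_divide_eq)
      also have "\<dots> = ext (rep C) x"
        using rep_in_G[OF C(1)] by (simp add: ab(4) ext_divide ext_of_fps)
      finally show ?thesis .
    qed
    then have "\<tau> = (\<lambda>x\<in>fps_frac S. ext (rep C) x)" using ex by (auto simp: extensional_def)
    then show "\<tau> \<in> (\<lambda>C. \<lambda>x\<in>fps_frac S. ext (rep C) x) ` carrier Q" using C(1) by blast
  qed
qed

lemma Gal_trace_eq:
  "x \<in> fps_frac S \<Longrightarrow> Gal_trace (fps_frac S) (fps_frac R) x = (\<Sum>C\<in>carrier Q. ext (rep C) x)"
  unfolding Gal_trace_def by (subst sum.reindex_bij_betw[OF bij_betw_Gal, symmetric]) simp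

section \<open>The different of k[[t]]^N over k[[t]]^G\<close>

text \<open>The derivative at \<open>y_N\<close> of the orbit polynomial of
  \<open>y_N\<close>.\<close>

definition fy where "fy = (\<Prod>C\<in>carrier Q - {N}. y_N - yc C)"

lemma fy_in: "fy \<in> S"
proof -
  have "y_N - yc C \<in> S" for C
    using y_N_in yc_in N_in_G by (auto simp: fps_inv_def rho_diff)
  then show ?thesis unfolding fy_def by (intro fps_inv_prod[OF N.subset])
qed

lemma fy_nonzero: "fy \<noteq> 0"
proof -
  have "y_N \<noteq> yc C" if "C \<in> carrier Q - {N}" for C
    using that yc_inj N_in_Q yc_N by (auto dest: inj_onD)
  then show ?thesis using finite_Q by (simp add: fy_def prod_zero_iff)
qed

text \<open>Let \<open>f C\<close> be the orbit polynomial divided by its factor T -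
  \<open>yc C\<close>. The action of C carries the coefficients of \<open>f N\<close> to those of
  \<open>f C\<close>, and \<open>f C\<close> vanishes at \<open>y_N\<close> unless C = N. So x
  f_N(y_N) equals the sum over all C of the conjugates of x f_N, evaluated at \<open>y_N\<close>.
  Read coefficient by coefficient, this sum is a combination of powers of \<open>y_N\<close> with
  traces Tr(x b) as coefficients, where b is a coefficient of f_N in S.\<close>

lemma codifferent_times_fy:
  assumes x: "x \<in> codifferent S R"
  shows "x * \<iota> fy \<in> \<iota> ` S"
proof -
  have xL: "x \<in> fps_frac S" and tr: "\<And>s. s \<in> S \<Longrightarrow> Gal_trace (fps_frac S) (fps_frac R) (x * \<iota> s) \<in> \<iota> ` R"
    using x by (auto simp: codifferent_def)
  define f where "f = (\<lambda>C. \<Prod>D\<in>carrier Q - {C}. [:- yc D, 1:])"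
  define m where "m = card (carrier Q)"
  have b: "coeff (f N) i \<in> S" for i
    unfolding fps_inv_def
  proof safe
    fix n assume n: "n \<in> N"
    then have "\<rho> n (yc D) = yc D" for D using yc_in by (auto simp: fps_inv_def)
    then show "\<rho> n (coeff (f N) i) = coeff (f N) i"
      using Aut_coeff_prod[OF rho_closed[OF N_in_G[OF n]], of yc "carrier Q - {N}" i] by (simp add: f_def)
  qed
  have fC: "\<rho> (rep C) (coeff (f N) i) = coeff (f C) i" if C: "C \<in> carrier Q" for C i
    using Aut_coeff_prod[OF rho_closed[OF rep_in_G[OF C]], of yc "carrier Q - {N}" i]
      rho_yc[OF _ C rep_mem[OF C]] prod_translate_minus[OF C, of "\<lambda>C. [:- yc C, 1:]"]
    by (simp add: f_def)
  have deg: "degree (f C) \<le> m" for C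
    unfolding f_def m_def using finite_Q
    by (subst degree_prod_eq_sum_degree) (auto intro: card_mono)
  have poly_f: "poly (f C) y_N = (\<Sum>i\<le>m. coeff (f C) i * y_N ^ i)" for C
    unfolding poly_altdef using deg[of C]
    by (intro sum.mono_neutral_left) (auto simp: coeff_eq_0)
  have 0: "poly (f C) y_N = 0" if "C \<in> carrier Q - {N}" for C
    unfolding f_def poly_prod using that N_in_Q finite_Q
    by (intro prod_zero bexI[of _ N]) (auto simp: yc_N)
  have N: "poly (f N) y_N = fy" by (simp add: f_def fy_def poly_prod)
  have extN: "ext (rep N) x = x"
    using ext_coset[OF N_in_Q rep_mem[OF N_in_Q] _ xL, of \<one>] xL
    by (auto elim!: frac_cases simp: ext_divide ext_of_fps rho_one)
  have "x * \<iota> fy = (\<Sum>C\<in>{N}. ext (rep C) x * \<iota> (poly (f C) y_N))"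
    by (simp add: N extN)
  also have "\<dots> = (\<Sum>C\<in>carrier Q. ext (rep C) x * \<iota> (poly (f C) y_N))"
    using finite_Q N_in_Q 0 by (intro sum.mono_neutral_left) auto
  also have "\<dots> = (\<Sum>C\<in>carrier Q. \<Sum>i\<le>m. ext (rep C) (x * \<iota> (coeff (f N) i)) * \<iota> (y_N ^ i))"
    by (intro sum.cong refl)
      (simp add: poly_f fps_to_fls_sum sum_distrib_left fls_times_fps_to_fls ext_mult ext_of_fps rep_in_G fC mult_ac)
  also have "\<dots> = (\<Sum>i\<le>m. (\<Sum>C\<in>carrier Q. ext (rep C) (x * \<iota> (coeff (f N) i))) * \<iota> (y_N ^ i))"
    by (subst sum.swap) (simp add: sum_distrib_right)
  also have "\<dots> = (\<Sum>i\<le>m. Gal_trace (fps_frac S) (fps_frac R) (x * \<iota> (coeff (f N) i)) * \<iota> (y_N ^ i))"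
    by (simp add: Gal_trace_eq fps_frac_mult[OF N.subset] fps_frac_of_fps[OF N.subset] b xL)
  also have "\<dots> \<in> \<iota> ` S"
  proof -
    define t where "t = (\<lambda>i. inv_into R \<iota> (Gal_trace (fps_frac S) (fps_frac R) (x * \<iota> (coeff (f N) i))))"
    have t: "t i \<in> R" "Gal_trace (fps_frac S) (fps_frac R) (x * \<iota> (coeff (f N) i)) = \<iota> (t i)" for i
      unfolding t_def using inv_into_into[OF tr[OF b]] f_inv_into_f[OF tr[OF b]] by simp_all
    have "(\<Sum>i\<le>m. t i * y_N ^ i) \<in> S"
      by (intro fps_inv_sum[OF N.subset] fps_inv_mult[OF N.subset] fps_inv_power[OF N.subset] y_N_in fps_inv_G_subset t)
    moreover have "(\<Sum>i\<le>m. \<iota> (t i) * \<iota> (y_N ^ i)) = \<iota> (\<Sum>i\<le>m. t i * y_N ^ i)"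
      by (simp add: fps_to_fls_sum fls_times_fps_to_fls)
    ultimately show ?thesis by (simp add: t(2))
  qed
  finally show ?thesis .
qed

text \<open>After expanding s in powers of \<open>y_N\<close>, only traces of y_N^i / fy occur, and
  Euler's formula makes them 0 or 1.\<close>

lemma inverse_fy_codifferent: "1 / \<iota> fy \<in> codifferent S R"
  unfolding codifferent_def
proof safe
  show L: "1 / \<iota> fy \<in> fps_frac S"
    using fps_fracI[of 1 S fy] fy_in fy_nonzero fps_inv_1[OF N.subset] by simp
  fix s assume s: "s \<in> S"
  define m where "m = card (carrier Q)"
  obtain r where r: "\<And>i. r i \<in> R" "s = (\<Sum>i<m. r i * y_N ^ i)"
    unfolding m_def using fps_inv_basis[OF s] by blast
  define D where "D = (\<lambda>C. \<Prod>E\<in>carrier Q - {C}. yc C - yc E)"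
  have fyC: "\<rho> (rep C) fy = D C" if C: "C \<in> carrier Q" for C
  proof -
    have "\<rho> (rep C) fy = (\<Prod>E\<in>carrier Q - {N}. yc C - yc (C \<otimes>\<^bsub>Q\<^esub> E))"
      using C by (simp add: fy_def Aut_prod[OF rho_closed] rho_diff rep_in_G yc_rho rep_mem rho_yc)
    then show ?thesis using prod_translate_minus[OF C, of "\<lambda>E. yc C - yc E"] by (simp add: D_def)
  qed
  have sC: "\<rho> (rep C) s = (\<Sum>i<m. r i * yc C ^ i)" if C: "C \<in> carrier Q" for C
    using r(1) rep_in_G[OF C]
    by (simp add: r(2) Aut_sum[OF rho_closed] rho_times Aut_power[OF rho_closed] yc_rho[OF C rep_mem[OF C]])
      (simp add: fps_inv_def)
  have "Gal_trace (fps_frac S) (fps_frac R) (1 / \<iota> fy * \<iota> s) = (\<Sum>C\<in>carrier Q. ext (rep C) (\<iota> s / \<iota> fy))"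
    using fps_frac_mult[OF N.subset L fps_frac_of_fps[OF N.subset s]] by (simp add: Gal_trace_eq)
  also have "\<dots> = (\<Sum>C\<in>carrier Q. \<Sum>i<m. \<iota> (r i) * (\<iota> (yc C) ^ i / \<iota> (D C)))"
    by (intro sum.cong refl)
      (simp add: ext_divide ext_of_fps rep_in_G fyC sC fps_to_fls_sum fls_times_fps_to_fls fps_to_fls_power sum_divide_distrib)
  also have "\<dots> = (\<Sum>i<m. \<iota> (r i) * (\<Sum>C\<in>carrier Q. \<iota> (yc C) ^ i / \<iota> (D C)))"
    by (subst sum.swap) (simp add: sum_distrib_left)
  also have "\<dots> = (\<Sum>i<m. \<iota> (r i) * (if i = m - 1 then 1 else 0))"
  proof (intro sum.cong refl, goal_cases)
    case (1 i)
    have "inj_on (\<lambda>C. \<iota> (yc C)) (carrier Q)" using yc_inj by (simp add: inj_on_def)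
    then have "(\<Sum>C\<in>carrier Q. \<iota> (yc C) ^ i / \<iota> (D C)) = (if i = m - 1 then 1 else 0)"
      using lagrange_power_sum[OF finite_Q, of "\<lambda>C. \<iota> (yc C)" i] 1
      by (simp add: D_def fps_to_fls_prod m_def fps_to_fls_minus)
    then show ?case by simp
  qed
  also have "\<dots> = \<iota> (\<Sum>i<m. r i * (if i = m - 1 then 1 else 0))"
    by (simp add: fps_to_fls_sum fls_times_fps_to_fls if_distrib cong: if_cong)
  also have "\<dots> \<in> \<iota> ` R"
    using r(1) by (intro imageI fps_inv_sum[OF order.refl]) (auto simp: fps_inv_0)
  finally show "Gal_trace (fps_frac S) (fps_frac R) (1 / \<iota> fy * \<iota> s) \<in> \<iota> ` R" .
qed

text \<open>The codifferent contains 1/fy and is contained in (1/fy) S; each bound gives one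
  inclusion.\<close>

lemma different_eq: "different S R = {fy * s | s. s \<in> S}"
proof (intro equalityI subsetI)
  fix s assume "s \<in> different S R"
  then have "\<iota> s * (1 / \<iota> fy) \<in> \<iota> ` S" using inverse_fy_codifferent by (auto simp: different_def)
  then obtain h where h: "h \<in> S" "\<iota> s / \<iota> fy = \<iota> h" by auto
  then have "\<iota> s = \<iota> (fy * h)" using fy_nonzero by (simp add: field_simps fls_times_fps_to_fls)
  then show "s \<in> {fy * s | s. s \<in> S}" using h(1) by auto
next
  fix f assume "f \<in> {fy * s | s. s \<in> S}"
  then obtain s where s: "s \<in> S" "f = fy * s" by auto
  show "f \<in> different S R"
    unfolding different_def
  proof safe
    show "f \<in> S" using s fy_in by (simp add: fps_inv_mult[OF N.subset])
    fix x assume "x \<in> codifferent S R"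
    then obtain h where "h \<in> S" "x * \<iota> fy = \<iota> h" using codifferent_times_fy by blast
    then have "h * s \<in> S" "\<iota> f * x = \<iota> (h * s)"
      using s by (simp_all add: fps_inv_mult[OF N.subset] fls_times_fps_to_fls mult_ac)
    then show "\<iota> f * x \<in> \<iota> ` S" by blast
  qed
qed

text \<open>This is \<open>deriv_y\<close> for the action of G/N on k[[y_N]], transported to
  k[[t]].\<close>

lemma fy_eq_w: obtains u where "u $ 0 \<noteq> 0" "fy = w * u"
proof -
  obtain U where U: "U $ 0 \<noteq> 0"
    "fps_deriv Q.y_G * U = (\<Prod>C\<in>carrier Q - {\<one>\<^bsub>Q\<^esub>}. fps_X - \<rho>s C fps_X)"
    by (rule Q.deriv_y)
  have "fy = (\<Prod>C\<in>carrier Q - {\<one>\<^bsub>Q\<^esub>}. fps_X - \<rho>s C fps_X) oo y_N"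
    by (simp add: fy_def yc_def fps_compose_prod_distrib N.y_nth_0 fps_compose_sub_distrib)
  then have "fy = fps_deriv Q.y_G * U oo y_N" by (simp only: U(2))
  then have "fy = w * (U oo y_N)"
    by (simp add: w_def fps_compose_mult_distrib N.y_nth_0)
  then show ?thesis using that[of "U oo y_N"] U(1) by simp
qed

text \<open>\<open>fy\<close> and w differ by a unit, so they generate the same ideal. From here on
  the different enters only through w.\<close>

lemma carrier_Theta1: "carrier (Theta1 G N \<rho>) = {f. w dvd f}"
proof -
  interpret module "(*) :: 'c fps \<Rightarrow> 'c fps \<Rightarrow> 'c fps"
    by unfold_locales (simp_all add: algebra_simps)
  obtain u where u: "u $ 0 \<noteq> 0" "fy = w * u" by (rule fy_eq_w)
  have "span (different S R) = {f. w dvd f}"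
  proof (intro equalityI)
    show "span (different S R) \<subseteq> {f. w dvd f}"
    proof (rule span_minimal)
      show "different S R \<subseteq> {f. w dvd f}" by (auto simp: different_eq u(2) intro: dvd_mult2)
      show "subspace {f. w dvd f}"
        by (simp add: subspace_def dvd_add)
    qed
    show "{f. w dvd f} \<subseteq> span (different S R)"
    proof safe
      fix f assume "w dvd f"
      then obtain h where h: "f = w * h" by (rule dvdE)
      have "fy \<in> different S R"
        unfolding different_eq using fps_inv_1[OF N.subset] by (intro CollectI exI[of _ 1]) simp
      then have "(h * inverse u) * fy \<in> span (different S R)" by (intro span_scale span_base)
      moreover have "(h * inverse u) * fy = f * (inverse u * u)" unfolding u(2) h by (simp only: mult_ac)
      ultimately show "f \<in> span (different S R)" using inverse_mult_eq_1[OF u(1)] by simp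
    qed
  qed
  then show ?thesis by (simp add: Theta1_def)
qed

end

subsection \<open>Group cohomology\<close>

lemma (in group) mult_inv_cancel:
  "x \<in> carrier G \<Longrightarrow> y \<in> carrier G \<Longrightarrow> x \<otimes> (inv x \<otimes> y) = y"
  by (simp add: m_assoc[symmetric])

lemma (in comm_group) comm_group_subgroup:
  assumes "subgroup H G"
  shows "comm_group (G\<lparr>carrier := H\<rparr>)"
proof -
  interpret H: subgroup H G by fact
  have "group (G\<lparr>carrier := H\<rparr>)" by (rule H.subgroup_is_group[OF group_axioms])
  then show ?thesis by (rule group.group_comm_groupI) (simp add: m_comm)
qed

locale gmodule = group G + M: comm_group M
  for G :: "('g, 'x) monoid_scheme" (structure) and M :: "('m, 'y) monoid_scheme" +
  fixes a :: "'g \<Rightarrow> 'm \<Rightarrow> 'm"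
  assumes act_closed: "g \<in> carrier G \<Longrightarrow> m \<in> carrier M \<Longrightarrow> a g m \<in> carrier M"
    and act_distrib: "g \<in> carrier G \<Longrightarrow> m \<in> carrier M \<Longrightarrow> m' \<in> carrier M
      \<Longrightarrow> a g (m \<otimes>\<^bsub>M\<^esub> m') = a g m \<otimes>\<^bsub>M\<^esub> a g m'"
    and act_mult: "g \<in> carrier G \<Longrightarrow> h \<in> carrier G \<Longrightarrow> m \<in> carrier M \<Longrightarrow> a (g \<otimes> h) m = a g (a h m)"
    and act_1: "m \<in> carrier M \<Longrightarrow> a \<one> m = m"
begin

lemma act_hom: "g \<in> carrier G \<Longrightarrow> group_hom M M (a g)"
  by unfold_locales (auto simp: hom_def act_closed act_distrib)

lemma act_one [simp]: "g \<in> carrier G \<Longrightarrow> a g \<one>\<^bsub>M\<^esub> = \<one>\<^bsub>M\<^esub>"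
  by (rule group_hom.hom_one[OF act_hom])

lemma act_inv: "g \<in> carrier G \<Longrightarrow> m \<in> carrier M \<Longrightarrow> a g (inv\<^bsub>M\<^esub> m) = inv\<^bsub>M\<^esub> (a g m)"
  by (rule group_hom.hom_inv[OF act_hom])

lemma act_inv_cancel:
  "g \<in> carrier G \<Longrightarrow> m \<in> carrier M \<Longrightarrow> a g (a (inv g) m) = m"
  "g \<in> carrier G \<Longrightarrow> m \<in> carrier M \<Longrightarrow> a (inv g) (a g m) = m"
  by (simp_all add: act_mult[symmetric] act_1)

abbreviation "Z \<equiv> cocycles1 G M a"
abbreviation "cls \<equiv> H1_class G M a"
abbreviation "cob m \<equiv> (\<lambda>g\<in>carrier G. a g m \<otimes>\<^bsub>M\<^esub> inv\<^bsub>M\<^esub> m)"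

lemma Z_iff: "z \<in> Z \<longleftrightarrow> z \<in> carrier G \<rightarrow>\<^sub>E carrier M \<and>
    (\<forall>g\<in>carrier G. \<forall>h\<in>carrier G. z (g \<otimes> h) = z g \<otimes>\<^bsub>M\<^esub> a g (z h))"
  by (simp add: cocycles1_def cochains1_def)

lemma Z_closed: "z \<in> Z \<Longrightarrow> g \<in> carrier G \<Longrightarrow> z g \<in> carrier M"
  and Z_mult: "z \<in> Z \<Longrightarrow> g \<in> carrier G \<Longrightarrow> h \<in> carrier G \<Longrightarrow> z (g \<otimes> h) = z g \<otimes>\<^bsub>M\<^esub> a g (z h)"
  and Z_ext: "z \<in> Z \<Longrightarrow> z \<in> extensional (carrier G)"
  by (auto simp: Z_iff PiE_def)

lemma Z_one: "z \<in> Z \<Longrightarrow> z \<one> = \<one>\<^bsub>M\<^esub>"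
  using Z_mult[of z \<one> \<one>] Z_closed[of z \<one>] by (simp add: act_1)

lemma Z_eqI: "z \<in> Z \<Longrightarrow> z' \<in> Z \<Longrightarrow> (\<And>g. g \<in> carrier G \<Longrightarrow> z g = z' g) \<Longrightarrow> z = z'"
  using Z_ext extensionalityI by blast

lemma cob_in_Z:
  assumes m: "m \<in> carrier M"
  shows "cob m \<in> Z"
  unfolding Z_iff
proof (intro conjI ballI)
  fix g h assume gh: "g \<in> carrier G" "h \<in> carrier G"
  have c: "a g m \<in> carrier M" "a h m \<in> carrier M" "a g (a h m) \<in> carrier M"
    using gh m by (simp_all add: act_closed)
  have "a g m \<otimes>\<^bsub>M\<^esub> inv\<^bsub>M\<^esub> m \<otimes>\<^bsub>M\<^esub> (a g (a h m) \<otimes>\<^bsub>M\<^esub> inv\<^bsub>M\<^esub> (a g m))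
      = (a g m \<otimes>\<^bsub>M\<^esub> inv\<^bsub>M\<^esub> (a g m)) \<otimes>\<^bsub>M\<^esub> (a g (a h m) \<otimes>\<^bsub>M\<^esub> inv\<^bsub>M\<^esub> m)"
    using m c by (simp add: M.m_ac M.mult_inv_cancel)
  then show "cob m (g \<otimes> h) = cob m g \<otimes>\<^bsub>M\<^esub> a g (cob m h)"
    using gh m c by (simp add: act_mult act_distrib act_inv)
qed (use m in \<open>auto simp: act_closed\<close>)

abbreviation "Zgrp \<equiv> (cochains1 G M)\<lparr>carrier := Z\<rparr>"

lemma Zgrp_simps: "carrier Zgrp = Z" "\<one>\<^bsub>Zgrp\<^esub> = (\<lambda>g\<in>carrier G. \<one>\<^bsub>M\<^esub>)"
  "z \<otimes>\<^bsub>Zgrp\<^esub> z' = (\<lambda>g\<in>carrier G. z g \<otimes>\<^bsub>M\<^esub> z' g)"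
  by (simp_all add: cochains1_def)

lemma Z_times: "z \<in> Z \<Longrightarrow> z' \<in> Z \<Longrightarrow> (\<lambda>g\<in>carrier G. z g \<otimes>\<^bsub>M\<^esub> z' g) \<in> Z"
  by (subst Z_iff) (auto simp: act_distrib Z_closed Z_mult M.m_ac act_closed)

lemma Z_inv: "z \<in> Z \<Longrightarrow> (\<lambda>g\<in>carrier G. inv\<^bsub>M\<^esub> (z g)) \<in> Z"
  by (subst Z_iff) (auto simp: act_inv Z_closed Z_mult M.inv_mult act_closed)

lemma Z_trivial: "(\<lambda>g\<in>carrier G. \<one>\<^bsub>M\<^esub>) \<in> Z"
  unfolding Z_iff by auto

lemma comm_group_Zgrp: "comm_group Zgrp"
proof (rule comm_groupI, unfold Zgrp_simps)
  fix x y z assume xyz: "x \<in> Z" "y \<in> Z" "z \<in> Z"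
  show "(\<lambda>g\<in>carrier G. (\<lambda>g\<in>carrier G. x g \<otimes>\<^bsub>M\<^esub> y g) g \<otimes>\<^bsub>M\<^esub> z g)
      = (\<lambda>g\<in>carrier G. x g \<otimes>\<^bsub>M\<^esub> (\<lambda>g\<in>carrier G. y g \<otimes>\<^bsub>M\<^esub> z g) g)"
    by (rule restrict_ext) (simp add: M.m_assoc Z_closed[OF xyz(1)] Z_closed[OF xyz(2)] Z_closed[OF xyz(3)])
next
  fix x y assume xy: "x \<in> Z" "y \<in> Z"
  show "(\<lambda>g\<in>carrier G. x g \<otimes>\<^bsub>M\<^esub> y g) = (\<lambda>g\<in>carrier G. y g \<otimes>\<^bsub>M\<^esub> x g)"
    by (rule restrict_ext) (simp add: M.m_comm Z_closed[OF xy(1)] Z_closed[OF xy(2)])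
next
  fix x assume x: "x \<in> Z"
  show "(\<lambda>g\<in>carrier G. (\<lambda>g\<in>carrier G. \<one>\<^bsub>M\<^esub>) g \<otimes>\<^bsub>M\<^esub> x g) = x"
    by (rule extensionalityI[OF restrict_extensional Z_ext[OF x]]) (simp add: Z_closed[OF x])
  show "\<exists>y\<in>Z. (\<lambda>g\<in>carrier G. y g \<otimes>\<^bsub>M\<^esub> x g) = (\<lambda>g\<in>carrier G. \<one>\<^bsub>M\<^esub>)"
    by (rule bexI[OF _ Z_inv[OF x]], rule restrict_ext) (simp add: Z_closed[OF x])
qed (simp_all add: Z_times Z_trivial)

lemma coboundaries_eq: "coboundaries1 G M a = cob ` carrier M"
  by (auto simp: coboundaries1_def)

lemma cob_mult:
  assumes "m \<in> carrier M" "m' \<in> carrier M"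
  shows "(\<lambda>g\<in>carrier G. cob m g \<otimes>\<^bsub>M\<^esub> cob m' g) = cob (m \<otimes>\<^bsub>M\<^esub> m')"
  by (rule restrict_ext) (use assms in \<open>simp add: act_distrib M.inv_mult act_closed M.m_ac\<close>)

lemma subgroup_coboundaries: "subgroup (coboundaries1 G M a) Zgrp"
proof -
  interpret Zg: comm_group Zgrp by (rule comm_group_Zgrp)
  show ?thesis
  proof (rule Zg.subgroupI, unfold Zgrp_simps coboundaries_eq)
    show "cob ` carrier M \<subseteq> Z" using cob_in_Z by auto
    show "cob ` carrier M \<noteq> {}" using M.one_closed by blast
    fix x assume "x \<in> cob ` carrier M"
    then obtain m where m: "m \<in> carrier M" "x = cob m" by auto
    have inv_eq: "inv\<^bsub>Zgrp\<^esub> x = cob (inv\<^bsub>M\<^esub> m)"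
    proof (rule Zg.inv_equality)
      show "x \<in> carrier Zgrp" "cob (inv\<^bsub>M\<^esub> m) \<in> carrier Zgrp"
        using m cob_in_Z by (simp_all only: Zgrp_simps M.inv_closed)
      show "cob (inv\<^bsub>M\<^esub> m) \<otimes>\<^bsub>Zgrp\<^esub> x = \<one>\<^bsub>Zgrp\<^esub>"
        unfolding Zgrp_simps m(2) cob_mult[OF M.inv_closed[OF m(1)] m(1)]
        using m(1) by (intro restrict_ext) simp
    qed
    show "inv\<^bsub>Zgrp\<^esub> x \<in> cob ` carrier M" unfolding inv_eq by (rule imageI[OF M.inv_closed[OF m(1)]])
    fix y assume "y \<in> cob ` carrier M"
    then obtain m' where m': "m' \<in> carrier M" "y = cob m'" by auto
    show "(\<lambda>g\<in>carrier G. x g \<otimes>\<^bsub>M\<^esub> y g) \<in> cob ` carrier M"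
      unfolding m(2) m'(2) cob_mult[OF m(1) m'(1)] using m m' by simp
  qed
qed

lemma cls_eq_coset: "cls z = coboundaries1 G M a #>\<^bsub>Zgrp\<^esub> z"
  by (simp add: H1_class_def r_coset_def)

lemma comm_group_H1: "comm_group (H1 G M a)"
  unfolding H1_def by (rule comm_group.abelian_FactGroup[OF comm_group_Zgrp subgroup_coboundaries])

lemma carrier_H1: "carrier (H1 G M a) = cls ` Z"
  by (simp add: H1_def carrier_FactGroup cls_eq_coset)

lemma cls_in_H1: "z \<in> Z \<Longrightarrow> cls z \<in> carrier (H1 G M a)"
  by (simp add: carrier_H1)

lemma H1_mult:
  assumes "z \<in> Z" "z' \<in> Z"
  shows "cls z \<otimes>\<^bsub>H1 G M a\<^esub> cls z' = cls (\<lambda>g\<in>carrier G. z g \<otimes>\<^bsub>M\<^esub> z' g)"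
proof -
  interpret B: normal "coboundaries1 G M a" Zgrp
    by (rule comm_group.subgroup_imp_normal[OF comm_group_Zgrp subgroup_coboundaries])
  show ?thesis
    using B.rcos_sum[of z z'] assms
    by (simp only: H1_def mult_FactGroup cls_eq_coset Zgrp_simps)
qed

lemma mem_cls: "y \<in> cls z \<longleftrightarrow> (\<exists>m\<in>carrier M. y = (\<lambda>g\<in>carrier G. a g m \<otimes>\<^bsub>M\<^esub> inv\<^bsub>M\<^esub> m \<otimes>\<^bsub>M\<^esub> z g))"
  unfolding cls_eq_coset r_coset_def Zgrp_simps coboundaries_eq
  by (auto cong: restrict_cong)

lemma cls_eq_iff_mem:
  assumes "z \<in> Z" "z' \<in> Z"
  shows "cls z = cls z' \<longleftrightarrow> z \<in> cls z'"
proof -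
  interpret Zg: comm_group Zgrp by (rule comm_group_Zgrp)
  have c: "z \<in> carrier Zgrp" "z' \<in> carrier Zgrp" using assms by simp_all
  show ?thesis
    unfolding cls_eq_coset
    using Zg.repr_independence[OF _ c(2) subgroup_coboundaries] Zg.rcos_self[OF c(1) subgroup_coboundaries]
    by blast
qed

lemma cls_eq_iff:
  assumes "z \<in> Z" "z' \<in> Z"
  shows "cls z = cls z' \<longleftrightarrow> (\<exists>m\<in>carrier M. \<forall>g\<in>carrier G. z g = a g m \<otimes>\<^bsub>M\<^esub> inv\<^bsub>M\<^esub> m \<otimes>\<^bsub>M\<^esub> z' g)"
  unfolding cls_eq_iff_mem[OF assms] mem_cls
  using Z_ext[OF assms(1)] by (intro bex_cong refl) (auto simp: fun_eq_iff extensional_def)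

lemma mem_cls_in_Z:
  assumes "z \<in> Z" "y \<in> cls z"
  shows "y \<in> Z"
proof -
  obtain m where m: "m \<in> carrier M" "y = (\<lambda>g\<in>carrier G. a g m \<otimes>\<^bsub>M\<^esub> inv\<^bsub>M\<^esub> m \<otimes>\<^bsub>M\<^esub> z g)"
    using assms(2) by (auto simp: mem_cls)
  then have "y = (\<lambda>g\<in>carrier G. cob m g \<otimes>\<^bsub>M\<^esub> z g)" by (auto cong: restrict_cong)
  then show ?thesis using Z_times[OF cob_in_Z[OF m(1)] assms(1)] by simp
qed

lemma cls_eqI: "z \<in> Z \<Longrightarrow> y \<in> cls z \<Longrightarrow> cls y = cls z"
  using cls_eq_iff_mem mem_cls_in_Z by blast

lemma self_mem_cls: "z \<in> Z \<Longrightarrow> z \<in> cls z"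
  using cls_eq_iff_mem by blast

lemma H1_one: "\<one>\<^bsub>H1 G M a\<^esub> = cls (\<lambda>g\<in>carrier G. \<one>\<^bsub>M\<^esub>)"
proof -
  interpret Zg: comm_group Zgrp by (rule comm_group_Zgrp)
  have "\<one>\<^bsub>H1 G M a\<^esub> = coboundaries1 G M a #>\<^bsub>Zgrp\<^esub> \<one>\<^bsub>Zgrp\<^esub>"
    unfolding H1_def using subgroup.subset[OF subgroup_coboundaries] by (simp only: one_FactGroup Zg.coset_mult_one)
  then show ?thesis by (simp only: cls_eq_coset Zgrp_simps)
qed

lemma H1_inv:
  assumes "z \<in> Z"
  shows "inv\<^bsub>H1 G M a\<^esub> (cls z) = cls (\<lambda>g\<in>carrier G. inv\<^bsub>M\<^esub> (z g))"
proof -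
  interpret H: comm_group "H1 G M a" by (rule comm_group_H1)
  show ?thesis
  proof (rule H.inv_equality)
    have "(\<lambda>g\<in>carrier G. (\<lambda>g\<in>carrier G. inv\<^bsub>M\<^esub> (z g)) g \<otimes>\<^bsub>M\<^esub> z g) = (\<lambda>g\<in>carrier G. \<one>\<^bsub>M\<^esub>)"
      by (rule restrict_ext) (simp add: Z_closed[OF assms])
    then show "cls (\<lambda>g\<in>carrier G. inv\<^bsub>M\<^esub> (z g)) \<otimes>\<^bsub>H1 G M a\<^esub> cls z = \<one>\<^bsub>H1 G M a\<^esub>"
      unfolding H1_mult[OF Z_inv[OF assms] assms] H1_one by simp
  qed (use assms in \<open>simp_all add: cls_in_H1 Z_inv\<close>)
qed

end

section \<open>Functoriality of H^1 and connecting maps\<close>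

text \<open>Collapses the union in \<open>H1_map\<close>: a coboundary of m changes the image by the
  coboundary of f m.\<close>

lemma H1_map_cls:
  assumes "gmodule G' M' a'" "gmodule G M a"
    and \<phi>: "\<And>g. g \<in> carrier G \<Longrightarrow> \<phi> g \<in> carrier G'"
      "\<And>g h. g \<in> carrier G \<Longrightarrow> h \<in> carrier G \<Longrightarrow> \<phi> (g \<otimes>\<^bsub>G\<^esub> h) = \<phi> g \<otimes>\<^bsub>G'\<^esub> \<phi> h"
    and f: "f \<in> hom M' M"
    and eq: "\<And>g m. g \<in> carrier G \<Longrightarrow> m \<in> carrier M' \<Longrightarrow> f (a' (\<phi> g) m) = a g (f m)"
    and z: "z \<in> cocycles1 G' M' a'"
  shows "(\<lambda>g\<in>carrier G. f (z (\<phi> g))) \<in> cocycles1 G M a"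
    and "H1_map G M a \<phi> f (H1_class G' M' a' z) = H1_class G M a (\<lambda>g\<in>carrier G. f (z (\<phi> g)))"
proof -
  interpret A: gmodule G' M' a' by fact
  interpret B: gmodule G M a by fact
  interpret f: group_hom M' M f
    by (simp add: group_hom_def group_hom_axioms_def f A.M.group_axioms B.M.group_axioms)
  have Z: "(\<lambda>g\<in>carrier G. f (z (\<phi> g))) \<in> B.Z" if "z \<in> A.Z" for z
    unfolding B.Z_iff by (auto simp: A.Z_closed[OF that] A.Z_mult[OF that] \<phi> eq A.act_closed)
  then show Zz: "(\<lambda>g\<in>carrier G. f (z (\<phi> g))) \<in> B.Z" using z by blast
  have "B.cls (\<lambda>g\<in>carrier G. f (y (\<phi> g))) = B.cls (\<lambda>g\<in>carrier G. f (z (\<phi> g)))"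
    if y: "y \<in> A.cls z" for y
  proof -
    obtain m where m: "m \<in> carrier M'"
      "y = (\<lambda>g\<in>carrier G'. a' g m \<otimes>\<^bsub>M'\<^esub> inv\<^bsub>M'\<^esub> m \<otimes>\<^bsub>M'\<^esub> z g)" using y by (auto simp: A.mem_cls)
    show ?thesis
      unfolding B.cls_eq_iff[OF Z[OF A.mem_cls_in_Z[OF z y]] Zz]
      by (rule bexI[of _ "f m"]) (auto simp: m \<phi> A.Z_closed[OF z] A.act_closed eq)
  qed
  then show "H1_map G M a \<phi> f (A.cls z) = B.cls (\<lambda>g\<in>carrier G. f (z (\<phi> g)))"
    unfolding H1_map_def using A.self_mem_cls[OF z] by blast
qed

text \<open>Evaluates a connecting map from one preimage m and any cochain z whose image is the
  coboundary of m. Another preimage is i x times m and changes z by the coboundary of x. All three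
  connecting maps of the statement are computed this way.\<close>

lemma connecting_eq:
  assumes "gmodule G A a" "gmodule G B b"
    and i: "i \<in> hom A B" "inj_on i (carrier A)"
    and eq: "\<And>g x. g \<in> carrier G \<Longrightarrow> x \<in> carrier A \<Longrightarrow> i (a g x) = b g (i x)"
    and m: "m \<in> carrier B"
    and p: "\<And>m'. m' \<in> carrier B \<Longrightarrow> p m' = p m \<longleftrightarrow> (\<exists>x\<in>carrier A. m' = i x \<otimes>\<^bsub>B\<^esub> m)"
    and z: "z \<in> carrier G \<rightarrow>\<^sub>E carrier A" "\<And>g. g \<in> carrier G \<Longrightarrow> i (z g) = b g m \<otimes>\<^bsub>B\<^esub> inv\<^bsub>B\<^esub> m"
  shows "z \<in> cocycles1 G A a" and "connecting G A a B b i p (p m) = H1_class G A a z"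
proof -
  interpret A: gmodule G A a by fact
  interpret B: gmodule G B b by fact
  interpret i: group_hom A B i
    by (simp add: group_hom_def group_hom_axioms_def i A.M.group_axioms B.M.group_axioms)
  show Z: "z \<in> A.Z"
    unfolding A.Z_iff
  proof (intro conjI ballI)
    fix g h assume gh: "g \<in> carrier G" "h \<in> carrier G"
    have c: "z g \<in> carrier A" "z h \<in> carrier A" "z (g \<otimes>\<^bsub>G\<^esub> h) \<in> carrier A"
      using z(1) gh by (auto simp: PiE_iff)
    have "i (z (g \<otimes>\<^bsub>G\<^esub> h)) = i (z g \<otimes>\<^bsub>A\<^esub> a g (z h))"
      using B.Z_mult[OF B.cob_in_Z[OF m] gh] gh c by (simp add: z(2) eq A.act_closed)
    then show "z (g \<otimes>\<^bsub>G\<^esub> h) = z g \<otimes>\<^bsub>A\<^esub> a g (z h)"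
      by (rule inj_onD[OF i(2)]) (use c gh in \<open>simp_all add: A.act_closed\<close>)
  qed (rule z(1))
  have "A.cls (\<lambda>g\<in>carrier G. inv_into (carrier A) i (b g m' \<otimes>\<^bsub>B\<^esub> inv\<^bsub>B\<^esub> m')) = A.cls z"
    if m': "m' \<in> carrier B" "p m' = p m" for m'
  proof -
    obtain x where x: "x \<in> carrier A" "m' = i x \<otimes>\<^bsub>B\<^esub> m" using p m' by blast
    have "inv_into (carrier A) i (b g m' \<otimes>\<^bsub>B\<^esub> inv\<^bsub>B\<^esub> m') = a g x \<otimes>\<^bsub>A\<^esub> inv\<^bsub>A\<^esub> x \<otimes>\<^bsub>A\<^esub> z g"
      if g: "g \<in> carrier G" for g
    proof -
      have zg: "z g \<in> carrier A" using z(1) g by (auto simp: PiE_iff)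
      have "b g m' \<otimes>\<^bsub>B\<^esub> inv\<^bsub>B\<^esub> m' = (b g (i x) \<otimes>\<^bsub>B\<^esub> inv\<^bsub>B\<^esub> (i x)) \<otimes>\<^bsub>B\<^esub> (b g m \<otimes>\<^bsub>B\<^esub> inv\<^bsub>B\<^esub> m)"
        using g m x(1) by (simp add: x(2) B.act_distrib B.M.inv_mult B.act_closed B.M.m_ac)
      also have "\<dots> = i (a g x \<otimes>\<^bsub>A\<^esub> inv\<^bsub>A\<^esub> x \<otimes>\<^bsub>A\<^esub> z g)"
        using g m x(1) zg by (simp add: eq[symmetric] A.act_closed z(2))
      finally have e: "i (a g x \<otimes>\<^bsub>A\<^esub> inv\<^bsub>A\<^esub> x \<otimes>\<^bsub>A\<^esub> z g) = b g m' \<otimes>\<^bsub>B\<^esub> inv\<^bsub>B\<^esub> m'" by simp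
      show ?thesis
        by (rule inv_into_f_eq[OF i(2) _ e]) (use g x(1) zg in \<open>simp add: A.act_closed\<close>)
    qed
    then have "(\<lambda>g\<in>carrier G. inv_into (carrier A) i (b g m' \<otimes>\<^bsub>B\<^esub> inv\<^bsub>B\<^esub> m')) \<in> A.cls z"
      unfolding A.mem_cls using x(1) by (auto cong: restrict_cong)
    then show ?thesis by (rule A.cls_eqI[OF Z])
  qed
  then show "connecting G A a B b i p (p m) = A.cls z"
    unfolding connecting_def using m by blast
qed

section \<open>Invariants, quotient modules, inflation, and the action of G on H^1(N, M)\<close>

context gmodule
begin

lemma subgroup_invariants:
  assumes "K \<subseteq> carrier G"
  shows "subgroup {m \<in> carrier M. \<forall>g\<in>K. a g m = m} M"
  by (rule M.subgroupI) (use assms in \<open>auto simp: act_inv act_distrib subset_iff\<close>)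

lemma comm_group_invariants: "K \<subseteq> carrier G \<Longrightarrow> comm_group (invariants (subgrp G K) M a)"
  unfolding invariants_def using M.comm_group_subgroup[OF subgroup_invariants, of K] by simp

lemma gmodule_subgroup:
  assumes "subgroup K G"
  shows "gmodule (subgrp G K) M a"
proof -
  interpret K: subgroup K G by fact
  have "group (subgrp G K)" by (rule K.subgroup_is_group[OF group_axioms])
  then show ?thesis
    unfolding gmodule_def gmodule_axioms_def
    using M.comm_group_axioms K.subset by (auto simp: act_closed act_distrib act_mult act_1 subset_iff)
qed

lemma gmodule_quotient:
  assumes H: "subgroup H M" and stable: "\<And>g m. g \<in> carrier G \<Longrightarrow> m \<in> H \<Longrightarrow> a g m \<in> H"
  shows "gmodule G (M Mod H) (act_quot a)"
    and "\<And>g m. g \<in> carrier G \<Longrightarrow> m \<in> carrier M \<Longrightarrow> act_quot a g (H #>\<^bsub>M\<^esub> m) = H #>\<^bsub>M\<^esub> a g m"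
proof -
  interpret H: subgroup H M by fact
  interpret HM: normal H M by (rule M.subgroup_imp_normal[OF H])
  show act: "act_quot a g (H #>\<^bsub>M\<^esub> m) = H #>\<^bsub>M\<^esub> a g m"
    if g: "g \<in> carrier G" and m: "m \<in> carrier M" for g m
  proof (intro equalityI subsetI)
    fix x assume "x \<in> act_quot a g (H #>\<^bsub>M\<^esub> m)"
    then obtain h where "h \<in> H" "x = a g (h \<otimes>\<^bsub>M\<^esub> m)" by (auto simp: act_quot_def r_coset_def)
    then show "x \<in> H #>\<^bsub>M\<^esub> a g m"
      using g m stable[OF g] H.subset by (auto simp: r_coset_def act_distrib)
  next
    fix x assume "x \<in> H #>\<^bsub>M\<^esub> a g m"
    then obtain h where h: "h \<in> H" "x = h \<otimes>\<^bsub>M\<^esub> a g m" by (auto simp: r_coset_def)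
    have "a (inv g) h \<in> H" using stable g h by simp
    moreover have "x = a g (a (inv g) h \<otimes>\<^bsub>M\<^esub> m)"
      using g h m H.subset by (simp add: act_distrib act_closed act_inv_cancel)
    ultimately show "x \<in> act_quot a g (H #>\<^bsub>M\<^esub> m)" by (auto simp: act_quot_def r_coset_def)
  qed
  have cg: "comm_group (M Mod H)" by (rule M.abelian_FactGroup[OF H])
  show "gmodule G (M Mod H) (act_quot a)"
    unfolding gmodule_def gmodule_axioms_def
  proof (intro conjI allI impI)
    show "group G" by (rule group_axioms)
    show "comm_group (M Mod H)" by (rule cg)
  next
    fix g m assume "g \<in> carrier G" "m \<in> carrier (M Mod H)"
    then show "act_quot a g m \<in> carrier (M Mod H)"
      by (auto simp: carrier_FactGroup act act_closed)
  next
    fix g m m' assume "g \<in> carrier G" "m \<in> carrier (M Mod H)" "m' \<in> carrier (M Mod H)"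
    then show "act_quot a g (m \<otimes>\<^bsub>M Mod H\<^esub> m') = act_quot a g m \<otimes>\<^bsub>M Mod H\<^esub> act_quot a g m'"
      by (auto simp: carrier_FactGroup mult_FactGroup HM.rcos_sum act act_closed act_distrib)
  next
    fix g h m assume "g \<in> carrier G" "h \<in> carrier G" "m \<in> carrier (M Mod H)"
    then show "act_quot a (g \<otimes> h) m = act_quot a g (act_quot a h m)"
      by (auto simp: carrier_FactGroup act act_closed act_mult)
  next
    fix m assume "m \<in> carrier (M Mod H)"
    then show "act_quot a \<one> m = m" by (auto simp: carrier_FactGroup act act_1)
  qed
qed

lemma act_Mod_eq:
  assumes "\<And>h. h \<in> C \<Longrightarrow> a h m = a g m" "g \<in> C"
  shows "act_Mod a C m = a g m"
  unfolding act_Mod_def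
proof (rule the_equality)
  show "\<forall>h\<in>C. a g m = a h m" using assms(1) by metis
qed (use assms(2) in blast)

lemma gmodule_inflation:
  assumes N: "N \<lhd> G"
  shows "gmodule (G Mod N) (invariants (subgrp G N) M a) (act_Mod a)"
    and "\<And>C g m. C \<in> carrier (G Mod N) \<Longrightarrow> g \<in> C \<Longrightarrow> m \<in> carrier (invariants (subgrp G N) M a)
      \<Longrightarrow> act_Mod a C m = a g m"
proof -
  interpret N: normal N G by fact
  let ?I = "invariants (subgrp G N) M a"
  have I: "m \<in> carrier ?I \<longleftrightarrow> m \<in> carrier M \<and> (\<forall>n\<in>N. a n m = m)" for m
    by (simp add: invariants_def)
  have mult: "x \<otimes>\<^bsub>?I\<^esub> y = x \<otimes>\<^bsub>M\<^esub> y" for x y by (simp add: invariants_def)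
  have NG: "n \<in> carrier G" if "n \<in> N" for n using that N.subset by auto
  have closed: "a g m \<in> carrier ?I" if g: "g \<in> carrier G" and m: "m \<in> carrier ?I" for g m
    unfolding I
  proof (intro conjI ballI)
    fix n assume n: "n \<in> N"
    have m': "inv g \<otimes> n \<otimes> g \<in> N" by (rule N.inv_op_closed1[OF g n])
    have "a n (a g m) = a (g \<otimes> (inv g \<otimes> n \<otimes> g)) m"
      using g m NG[OF n] by (simp add: act_mult[symmetric] I m_assoc[symmetric])
    also have "\<dots> = a g m" using g m NG[OF m'] m' I by (subst act_mult) auto
    finally show "a n (a g m) = a g m" .
  qed (use g m in \<open>simp add: I act_closed\<close>)
  have coset: "\<exists>g\<in>carrier G. C = N #> g" if "C \<in> carrier (G Mod N)" for C
    using that by (auto simp: carrier_FactGroup)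
  have act0: "act_Mod a (N #> g) m = a g m" if g: "g \<in> carrier G" and m: "m \<in> carrier ?I" for g m
  proof (rule act_Mod_eq)
    show "g \<in> N #> g" by (rule rcos_self[OF g N.subgroup_axioms])
    fix h assume "h \<in> N #> g"
    then obtain n where "n \<in> N" "h = n \<otimes> g" by (auto simp: r_coset_def)
    then show "a h m = a g m" using closed[OF g m] g m NG by (simp add: act_mult I)
  qed
  show act: "act_Mod a C m = a g m"
    if C: "C \<in> carrier (G Mod N)" and g: "g \<in> C" and m: "m \<in> carrier ?I" for C g m
  proof -
    obtain h where h: "h \<in> carrier G" "C = N #> h" using coset[OF C] by blast
    have gG: "g \<in> carrier G" using h g NG by (auto simp: r_coset_def)
    have "C = N #> g" unfolding h(2)
      by (rule repr_independence[OF _ h(1) N.subgroup_axioms]) (use g h in simp)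
    then show ?thesis using act0[OF gG m] by simp
  qed
  show "gmodule (G Mod N) ?I (act_Mod a)"
    unfolding gmodule_def gmodule_axioms_def
  proof (intro conjI allI impI)
    show "group (G Mod N)" by (rule N.factorgroup_is_group)
    show "comm_group ?I" by (rule comm_group_invariants[OF N.subset])
  next
    fix C m assume "C \<in> carrier (G Mod N)" "m \<in> carrier ?I"
    then show "act_Mod a C m \<in> carrier ?I" using coset[of C] by (auto simp: act0 closed)
  next
    fix C m m' assume "C \<in> carrier (G Mod N)" and m: "m \<in> carrier ?I" "m' \<in> carrier ?I"
    then show "act_Mod a C (m \<otimes>\<^bsub>?I\<^esub> m') = act_Mod a C m \<otimes>\<^bsub>?I\<^esub> act_Mod a C m'"
      using coset[of C] monoid.m_closed[OF comm_monoid.axioms(1)[OF comm_group.axioms(1)[OF comm_group_invariants[OF N.subset]]] m]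
      by (auto simp: act0) (simp add: mult act_distrib I)
  next
    fix C D m assume "C \<in> carrier (G Mod N)" "D \<in> carrier (G Mod N)" "m \<in> carrier ?I"
    then show "act_Mod a (C \<otimes>\<^bsub>G Mod N\<^esub> D) m = act_Mod a C (act_Mod a D m)"
      using coset[of C] coset[of D]
      by (auto simp: act0 closed mult_FactGroup N.rcos_sum) (simp add: I act_mult)
  next
    fix m assume "m \<in> carrier ?I"
    then show "act_Mod a \<one>\<^bsub>G Mod N\<^esub> m = m"
      using act0[of \<one> m] N.subset by (simp add: act_1 I coset_mult_one)
  qed
qed

lemma act_H1_cls:
  assumes N: "N \<lhd> G" and z: "z \<in> cocycles1 (subgrp G N) M a" and g: "g \<in> carrier G"
  shows "(\<lambda>n\<in>N. a g (z (inv g \<otimes> n \<otimes> g))) \<in> cocycles1 (subgrp G N) M a"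
    and "act_H1 G N a g (H1_class (subgrp G N) M a z)
      = H1_class (subgrp G N) M a (\<lambda>n\<in>N. a g (z (inv g \<otimes> n \<otimes> g)))"
proof -
  interpret N: normal N G by fact
  interpret NM: gmodule "subgrp G N" M a by (rule gmodule_subgroup[OF N.subgroup_axioms])
  have NG: "n \<in> carrier G" if "n \<in> N" for n using that N.subset by auto
  have zc: "z n \<in> carrier M" if "n \<in> N" for n using NM.Z_closed[OF z] that by simp
  have conj: "inv g \<otimes> n \<otimes> g \<in> N" if "n \<in> N" for n using N.inv_op_closed1[OF g that] .
  define f where "f = (\<lambda>y. \<lambda>n\<in>N. a g (y (inv g \<otimes> n \<otimes> g)))"
  show fz: "(\<lambda>n\<in>N. a g (z (inv g \<otimes> n \<otimes> g))) \<in> cocycles1 (subgrp G N) M a"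
    unfolding NM.Z_iff
  proof (intro conjI ballI)
    fix n n' assume "n \<in> carrier (subgrp G N)" "n' \<in> carrier (subgrp G N)"
    then have n: "n \<in> N" "n' \<in> N" by auto
    have e: "inv g \<otimes> (n \<otimes> n') \<otimes> g = (inv g \<otimes> n \<otimes> g) \<otimes> (inv g \<otimes> n' \<otimes> g)"
      using g NG[OF n(1)] NG[OF n(2)] by (simp add: m_assoc mult_inv_cancel)
    have "z (inv g \<otimes> (n \<otimes> n') \<otimes> g) = z (inv g \<otimes> n \<otimes> g) \<otimes>\<^bsub>M\<^esub> a (inv g \<otimes> n \<otimes> g) (z (inv g \<otimes> n' \<otimes> g))"
      unfolding e using NM.Z_mult[OF z, of "inv g \<otimes> n \<otimes> g" "inv g \<otimes> n' \<otimes> g"] conj n by simp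
    moreover have "a g (a (inv g \<otimes> n \<otimes> g) (z (inv g \<otimes> n' \<otimes> g))) = a n (a g (z (inv g \<otimes> n' \<otimes> g)))"
      using g NG[OF n(1)] zc[OF conj[OF n(2)]] by (simp add: act_mult[symmetric] m_assoc[symmetric])
    ultimately show "(\<lambda>n\<in>N. a g (z (inv g \<otimes> n \<otimes> g))) (n \<otimes>\<^bsub>subgrp G N\<^esub> n')
      = (\<lambda>n\<in>N. a g (z (inv g \<otimes> n \<otimes> g))) n \<otimes>\<^bsub>M\<^esub> a n ((\<lambda>n\<in>N. a g (z (inv g \<otimes> n \<otimes> g))) n')"
      using n g zc conj NG by (simp add: act_distrib act_closed)
  qed (use g zc conj in \<open>auto simp: act_closed\<close>)
  have eqf: "f (\<lambda>n\<in>N. a n m \<otimes>\<^bsub>M\<^esub> inv\<^bsub>M\<^esub> m \<otimes>\<^bsub>M\<^esub> z n) = (\<lambda>n\<in>N. a n (a g m) \<otimes>\<^bsub>M\<^esub> inv\<^bsub>M\<^esub> (a g m) \<otimes>\<^bsub>M\<^esub> f z n)"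
    if m: "m \<in> carrier M" for m
    unfolding f_def
  proof (rule restrict_ext)
    fix n assume n: "n \<in> N"
    have "a g (a (inv g \<otimes> n \<otimes> g) m) = a n (a g m)"
      using g NG[OF n] m by (simp add: act_mult[symmetric] m_assoc[symmetric])
    then show "a g ((\<lambda>n\<in>N. a n m \<otimes>\<^bsub>M\<^esub> inv\<^bsub>M\<^esub> m \<otimes>\<^bsub>M\<^esub> z n) (inv g \<otimes> n \<otimes> g))
      = a n (a g m) \<otimes>\<^bsub>M\<^esub> inv\<^bsub>M\<^esub> (a g m) \<otimes>\<^bsub>M\<^esub> (\<lambda>n\<in>N. a g (z (inv g \<otimes> n \<otimes> g))) n"
      using n g m conj zc NG by (simp add: act_distrib act_inv act_closed)
  qed
  show "act_H1 G N a g (NM.cls z) = NM.cls (\<lambda>n\<in>N. a g (z (inv g \<otimes> n \<otimes> g)))"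
  proof (intro equalityI subsetI)
    fix y assume "y \<in> act_H1 G N a g (NM.cls z)"
    then obtain m where "m \<in> carrier M" "y = f (\<lambda>n\<in>N. a n m \<otimes>\<^bsub>M\<^esub> inv\<^bsub>M\<^esub> m \<otimes>\<^bsub>M\<^esub> z n)"
      by (auto simp: act_H1_def NM.mem_cls f_def)
    then show "y \<in> NM.cls (\<lambda>n\<in>N. a g (z (inv g \<otimes> n \<otimes> g)))"
      unfolding NM.mem_cls using g eqf act_closed by (auto simp: f_def)
  next
    fix y assume "y \<in> NM.cls (\<lambda>n\<in>N. a g (z (inv g \<otimes> n \<otimes> g)))"
    then obtain m where m: "m \<in> carrier M" "y = (\<lambda>n\<in>N. a n m \<otimes>\<^bsub>M\<^esub> inv\<^bsub>M\<^esub> m \<otimes>\<^bsub>M\<^esub> f z n)"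
      by (auto simp: NM.mem_cls f_def)
    then have "y = f (\<lambda>n\<in>N. a n (a (inv g) m) \<otimes>\<^bsub>M\<^esub> inv\<^bsub>M\<^esub> (a (inv g) m) \<otimes>\<^bsub>M\<^esub> z n)"
      using eqf[of "a (inv g) m"] g by (simp add: act_closed act_inv_cancel)
    moreover have "(\<lambda>n\<in>N. a n (a (inv g) m) \<otimes>\<^bsub>M\<^esub> inv\<^bsub>M\<^esub> (a (inv g) m) \<otimes>\<^bsub>M\<^esub> z n) \<in> NM.cls z"
      unfolding NM.mem_cls using m g by (auto intro!: bexI[of _ "a (inv g) m"] simp: act_closed)
    ultimately show "y \<in> act_H1 G N a g (NM.cls z)"
      unfolding act_H1_def f_def[symmetric] by (rule image_eqI)
  qed
qed

text \<open>The hypothesis on \<open>m\<close> is the cocycle identity for the two factorizations of \<open>ng = g(g\<inverse>ng)\<close>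
  when \<open>m = z(g)\<close> is the value of a cocycle extending \<open>z\<close>.\<close>

lemma act_H1_fixes:
  assumes N: "N \<lhd> G" and z: "z \<in> cocycles1 (subgrp G N) M a" and g: "g \<in> carrier G" and m: "m \<in> carrier M"
    and eq: "\<And>n. n \<in> N \<Longrightarrow> m \<otimes>\<^bsub>M\<^esub> a g (z (inv g \<otimes> n \<otimes> g)) = z n \<otimes>\<^bsub>M\<^esub> a n m"
  shows "act_H1 G N a g (H1_class (subgrp G N) M a z) = H1_class (subgrp G N) M a z"
proof -
  interpret N: normal N G by fact
  interpret NM: gmodule "subgrp G N" M a by (rule gmodule_subgroup[OF N.subgroup_axioms])
  have "a g (z (inv g \<otimes> n \<otimes> g)) = a n m \<otimes>\<^bsub>M\<^esub> inv\<^bsub>M\<^esub> m \<otimes>\<^bsub>M\<^esub> z n" if n: "n \<in> N" for n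
  proof -
    have c: "a g (z (inv g \<otimes> n \<otimes> g)) \<in> carrier M" "a n m \<in> carrier M" "z n \<in> carrier M"
      using NM.Z_closed[OF z] N.inv_op_closed1[OF g n] n g m N.subset by (auto simp: act_closed)
    then have "a g (z (inv g \<otimes> n \<otimes> g)) = inv\<^bsub>M\<^esub> m \<otimes>\<^bsub>M\<^esub> (z n \<otimes>\<^bsub>M\<^esub> a n m)"
      using eq[OF n] m M.inv_solve_left by (metis M.m_closed)
    then show ?thesis using c m by (simp add: M.m_ac)
  qed
  then have "NM.cls (\<lambda>n\<in>N. a g (z (inv g \<otimes> n \<otimes> g))) = NM.cls z"
    using m by (subst NM.cls_eq_iff[OF act_H1_cls(1)[OF N z g] z]) auto
  then show ?thesis using act_H1_cls(2)[OF N z g] by simp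
qed

text \<open>A group acts trivially on its own cohomology: the cocycle changes by the coboundary of
  z(g). This lets the action of G descend to G/N.\<close>

lemma act_H1_trivial:
  assumes N: "N \<lhd> G" and z: "z \<in> cocycles1 (subgrp G N) M a" and g: "g \<in> N"
  shows "act_H1 G N a g (H1_class (subgrp G N) M a z) = H1_class (subgrp G N) M a z"
proof -
  interpret N: normal N G by fact
  interpret NM: gmodule "subgrp G N" M a by (rule gmodule_subgroup[OF N.subgroup_axioms])
  have NG: "n \<in> carrier G" if "n \<in> N" for n using that N.subset by auto
  show ?thesis
  proof (rule act_H1_fixes[OF N z NG[OF g]])
    show "z g \<in> carrier M" using NM.Z_closed[OF z] g by simp
    fix n assume n: "n \<in> N"
    have e: "g \<otimes> (inv g \<otimes> n \<otimes> g) = n \<otimes> g" using NG[OF g] NG[OF n] by (simp add: m_assoc[symmetric])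
    show "z g \<otimes>\<^bsub>M\<^esub> a g (z (inv g \<otimes> n \<otimes> g)) = z n \<otimes>\<^bsub>M\<^esub> a n (z g)"
      using NM.Z_mult[OF z, of g "inv g \<otimes> n \<otimes> g"] NM.Z_mult[OF z, of n g] g n N.inv_op_closed1[OF NG[OF g] n]
      by (simp add: e)
  qed
qed

text \<open>The value z(g), now with g outside N allowed, again supplies the coboundary, so classes
  restricted from G are invariant.\<close>

lemma act_H1_restrict:
  assumes N: "N \<lhd> G" and z: "z \<in> Z" and g: "g \<in> carrier G"
  shows "restrict z N \<in> cocycles1 (subgrp G N) M a"
    and "act_H1 G N a g (H1_class (subgrp G N) M a (restrict z N)) = H1_class (subgrp G N) M a (restrict z N)"
proof -
  interpret N: normal N G by fact
  interpret NM: gmodule "subgrp G N" M a by (rule gmodule_subgroup[OF N.subgroup_axioms])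
  have NG: "n \<in> carrier G" if "n \<in> N" for n using that N.subset by auto
  show r: "restrict z N \<in> NM.Z"
    unfolding NM.Z_iff by (auto simp: Z_closed[OF z] Z_mult[OF z] NG)
  show "act_H1 G N a g (NM.cls (restrict z N)) = NM.cls (restrict z N)"
  proof (rule act_H1_fixes[OF N r g Z_closed[OF z g]])
    fix n assume n: "n \<in> N"
    have e: "g \<otimes> (inv g \<otimes> n \<otimes> g) = n \<otimes> g" using g NG[OF n] by (simp add: m_assoc[symmetric])
    show "z g \<otimes>\<^bsub>M\<^esub> a g (restrict z N (inv g \<otimes> n \<otimes> g)) = restrict z N n \<otimes>\<^bsub>M\<^esub> a n (z g)"
      using Z_mult[OF z, of g "inv g \<otimes> n \<otimes> g"] Z_mult[OF z, of n g] g NG[OF n] n N.inv_op_closed1[OF g n]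
      by (simp add: e)
  qed
qed

lemma act_H1_mult:
  assumes N: "N \<lhd> G" and z: "z \<in> cocycles1 (subgrp G N) M a" and gh: "g \<in> carrier G" "h \<in> carrier G"
  shows "act_H1 G N a (g \<otimes> h) (H1_class (subgrp G N) M a z)
    = act_H1 G N a g (act_H1 G N a h (H1_class (subgrp G N) M a z))"
proof -
  interpret N: normal N G by fact
  interpret NM: gmodule "subgrp G N" M a by (rule gmodule_subgroup[OF N.subgroup_axioms])
  have NG: "n \<in> carrier G" if "n \<in> N" for n using that N.subset by auto
  have zc: "z n \<in> carrier M" if "n \<in> N" for n using NM.Z_closed[OF z] that by simp
  have "(\<lambda>n\<in>N. a (g \<otimes> h) (z (inv (g \<otimes> h) \<otimes> n \<otimes> (g \<otimes> h))))
      = (\<lambda>n\<in>N. a g ((\<lambda>n\<in>N. a h (z (inv h \<otimes> n \<otimes> h))) (inv g \<otimes> n \<otimes> g)))"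
  proof (rule restrict_ext)
    fix n assume n: "n \<in> N"
    have "inv (g \<otimes> h) \<otimes> n \<otimes> (g \<otimes> h) = inv h \<otimes> (inv g \<otimes> n \<otimes> g) \<otimes> h"
      using gh NG[OF n] by (simp add: inv_mult_group m_assoc)
    then show "a (g \<otimes> h) (z (inv (g \<otimes> h) \<otimes> n \<otimes> (g \<otimes> h)))
        = a g ((\<lambda>n\<in>N. a h (z (inv h \<otimes> n \<otimes> h))) (inv g \<otimes> n \<otimes> g))"
      using gh n N.inv_op_closed1[OF gh(1) n] N.inv_op_closed1[OF gh(2) N.inv_op_closed1[OF gh(1) n]]
      by (simp add: act_mult zc)
  qed
  then show ?thesis
    using gh by (simp add: act_H1_cls(2)[OF N] act_H1_cls(1)[OF N] z)
qed

text \<open>Resolves the definite description in \<open>act_Mod\<close>: elements of one coset act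
  alike because N acts trivially, so invariance may be tested on elements of G.\<close>

lemma invariants_H1:
  assumes N: "N \<lhd> G"
  shows "carrier (invariants (G Mod N) (H1 (subgrp G N) M a) (act_Mod (act_H1 G N a)))
    = {X \<in> carrier (H1 (subgrp G N) M a). \<forall>g\<in>carrier G. act_H1 G N a g X = X}"
proof -
  interpret N: normal N G by fact
  interpret NM: gmodule "subgrp G N" M a by (rule gmodule_subgroup[OF N.subgroup_axioms])
  have act: "act_Mod (act_H1 G N a) (N #> g) X = act_H1 G N a g X"
    if g: "g \<in> carrier G" and X: "X \<in> carrier (H1 (subgrp G N) M a)" for g X
    unfolding act_Mod_def
  proof (rule the_equality)
    obtain z where z: "z \<in> NM.Z" "X = NM.cls z" using X by (auto simp: NM.carrier_H1)
    show "\<forall>h\<in>N #> g. act_H1 G N a g X = act_H1 G N a h X"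
    proof
      fix h assume "h \<in> N #> g"
      then obtain n where n: "n \<in> N" "h = n \<otimes> g" by (auto simp: r_coset_def)
      have nG: "n \<in> carrier G" using n N.subset by auto
      show "act_H1 G N a g X = act_H1 G N a h X"
        unfolding n(2) z(2) act_H1_mult[OF N z(1) nG g] act_H1_cls(2)[OF N z(1) g]
        by (rule act_H1_trivial[OF N act_H1_cls(1)[OF N z(1) g] n(1), symmetric])
    qed
  qed (use rcos_self[OF g N.subgroup_axioms] in blast)
  then show ?thesis by (auto simp: invariants_def carrier_FactGroup)
qed

end

subsection \<open>Power series over the dual numbers\<close>

text \<open>The series x + \<epsilon> x' in k[\<epsilon>][[t]].\<close>

definition dfps :: "'k::comm_ring_1 fps \<Rightarrow> 'k fps \<Rightarrow> 'k dualnum fps" where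
  "dfps x x' = Abs_fps (\<lambda>n. DualNum (x $ n) (x' $ n))"

abbreviation "re \<equiv> fps_map dn_re"
abbreviation "im \<equiv> fps_map dn_im"

lemma dualnum_simps [simp]:
  fixes x y :: "'k::comm_ring_1 dualnum"
  shows "dn_re (x + y) = dn_re x + dn_re y" "dn_im (x + y) = dn_im x + dn_im y"
    "dn_re (x * y) = dn_re x * dn_re y" "dn_im (x * y) = dn_re x * dn_im y + dn_im x * dn_re y"
    "dn_re (0 :: 'k dualnum) = 0" "dn_im (0 :: 'k dualnum) = 0"
    "dn_re (1 :: 'k dualnum) = 1" "dn_im (1 :: 'k dualnum) = 0"
  by (simp_all add: plus_dualnum_def times_dualnum_def zero_dualnum_def one_dualnum_def)

lemma dn_sum: "dn_re (\<Sum>i\<in>I. f i) = (\<Sum>i\<in>I. dn_re (f i :: 'k::comm_ring_1 dualnum))"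
  "dn_im (\<Sum>i\<in>I. f i) = (\<Sum>i\<in>I. dn_im (f i))"
  by (induction I rule: infinite_finite_induct) auto

lemma dfps_nth: "dfps x x' $ n = DualNum (x $ n) (x' $ n)"
  by (simp add: dfps_def)

lemma re_dfps [simp]: "re (dfps x x') = x" and im_dfps [simp]: "im (dfps x x') = x'"
  by (simp_all add: fps_map_def dfps_def fps_eq_iff)

lemma dfps_re_im [simp]: "dfps (re f) (im f) = f"
  by (simp add: fps_map_def dfps_def fps_eq_iff)

lemma dfps_eq_iff [simp]: "dfps x x' = dfps y y' \<longleftrightarrow> x = y \<and> x' = y'"
  by (metis re_dfps im_dfps)

lemma dfps_add: "dfps x x' + dfps y y' = dfps (x + y) (x' + y')"
  by (simp add: fps_eq_iff dfps_nth plus_dualnum_def)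

lemma dfps_mult: "dfps x x' * dfps y y' = dfps (x * y) (x * y' + x' * y)"
  by (rule fps_ext, rule dualnum.expand)
    (simp add: fps_mult_nth dn_sum dfps_nth sum.distrib)

lemma dfps_const: "fps_const c = dfps (fps_const (dn_re c)) (fps_const (dn_im c))"
  by (auto simp: fps_eq_iff dfps_nth zero_dualnum_def)

lemma dfps_0: "0 = dfps 0 0" and dfps_1: "1 = dfps 1 0" and dfps_X: "fps_X = dfps fps_X 0"
  by (auto simp: fps_eq_iff dfps_nth zero_dualnum_def one_dualnum_def fps_X_def)

lemma re_add [simp]: "re (f + g) = re f + re g" and im_add [simp]: "im (f + g) = im f + im g"
  and re_mult [simp]: "re (f * g) = re f * re g" and im_mult [simp]: "im (f * g) = re f * im g + im f * re g"
  for f g :: "'k::comm_ring_1 dualnum fps"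
  using arg_cong[OF dfps_add[of "re f" "im f" "re g" "im g"], of re]
    arg_cong[OF dfps_add[of "re f" "im f" "re g" "im g"], of im]
    arg_cong[OF dfps_mult[of "re f" "im f" "re g" "im g"], of re]
    arg_cong[OF dfps_mult[of "re f" "im f" "re g" "im g"], of im] by simp_all

lemma re_const [simp]: "re (fps_const c) = fps_const (dn_re c :: 'k::comm_ring_1)"
  and im_const [simp]: "im (fps_const c) = fps_const (dn_im c)"
  by (simp_all add: dfps_const)

lemma re_prod: "re (\<Prod>i\<in>I. f i) = (\<Prod>i\<in>I. re (f i :: 'k::comm_ring_1 dualnum fps))"
  by (induction I rule: infinite_finite_induct) (auto simp: dfps_1)

lemma dfps_power: "dfps y z ^ n = dfps (y ^ n) (of_nat n * y ^ (n - 1) * z)"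
proof (induction n)
  case (Suc n)
  then show ?case by (cases n) (simp_all add: dfps_mult algebra_simps)
qed (simp add: dfps_1)

text \<open>Taylor expansion with \<epsilon>^2 = 0: F(y + \<epsilon> z) = F(y) + \<epsilon> F'(y) z.
  The constant term of z may be nonzero, so this is a genuine limit of partial sums and not an
  instance of composition.\<close>

lemma fps_subst_dfps:
  fixes y z F H :: "'k::comm_ring_1 fps"
  assumes y: "y $ 0 = 0"
  shows "fps_subst (dfps y z) (dfps F H) = dfps (F oo y) ((fps_deriv F oo y) * z + (H oo y))"
proof -
  have "(\<lambda>n. fps_const (dfps F H $ n) * dfps y z ^ n) sums dfps (F oo y) ((fps_deriv F oo y) * z + (H oo y))"
    unfolding sums_def
  proof (rule tendsto_fpsI)
    fix m
    show "\<forall>\<^sub>F M in sequentially. (\<Sum>n<M. fps_const (dfps F H $ n) * dfps y z ^ n) $ m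
        = dfps (F oo y) ((fps_deriv F oo y) * z + (H oo y)) $ m"
      using eventually_gt_at_top[of "Suc m"]
    proof eventually_elim
      case (elim M)
      have t: "fps_const (dfps F H $ n) * dfps y z ^ n
          = dfps (fps_const (F $ n) * y ^ n)
              (fps_const (of_nat n * F $ n) * y ^ (n - 1) * z + fps_const (H $ n) * y ^ n)" for n
        by (simp add: dfps_power dfps_const dfps_nth dfps_mult mult_ac fps_of_nat[symmetric]
            flip: fps_const_mult)
      have s: "(\<Sum>n<M. dfps (f n) (g n)) = dfps (\<Sum>n<M. f n) (\<Sum>n<M. g n)" for f g :: "nat \<Rightarrow> 'k fps"
        by (induction M) (auto simp: dfps_0 dfps_add)
      \<comment> \<open>Differentiation lowers the index by one: M terms of F give M - 1 terms of
        F', which must still reach coefficient m.\<close>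
      obtain M' where M': "M = Suc M'" "m < M'" using elim by (cases M) auto
      have "(\<Sum>n<M. fps_const (of_nat n * F $ n) * y ^ (n - 1) * z)
          = (\<Sum>n<M'. fps_const (fps_deriv F $ n) * y ^ n) * z"
        unfolding M'(1) by (subst sum.lessThan_Suc_shift) (simp add: sum_distrib_right)
      moreover have "((\<Sum>n<M'. fps_const (fps_deriv F $ n) * y ^ n) * z) $ m = ((fps_deriv F oo y) * z) $ m"
        unfolding fps_mult_nth using M'(2)
        by (intro sum.cong refl) (subst compose_partial_sum[OF y], auto)
      ultimately have "(\<Sum>n<M. fps_const (of_nat n * F $ n) * y ^ (n - 1) * z + fps_const (H $ n) * y ^ n) $ m
          = ((fps_deriv F oo y) * z + (H oo y)) $ m"
        using elim by (simp add: sum.distrib compose_partial_sum[OF y])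
      moreover have "(\<Sum>n<M. fps_const (F $ n) * y ^ n) $ m = (F oo y) $ m"
        using elim by (intro compose_partial_sum[OF y]) simp
      ultimately show ?case unfolding t s by (simp only: dfps_nth)
    qed
  qed
  then show ?thesis unfolding fps_subst_def by (rule sums_unique[symmetric])
qed

subsection \<open>Automorphisms over the dual numbers\<close>

lemma comm_group_Der: "comm_group (\<Theta> :: ('k::field fps \<Rightarrow> 'k fps) monoid)"
proof (rule comm_groupI)
  fix d :: "'k fps \<Rightarrow> 'k fps" assume "d \<in> carrier \<Theta>"
  then show "\<exists>e\<in>carrier \<Theta>. e \<otimes>\<^bsub>\<Theta>\<^esub> d = \<one>\<^bsub>\<Theta>\<^esub>"
    by (intro bexI[of _ "\<lambda>f. - d f"]) (auto simp: Der_fps_def)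
qed (auto simp: Der_fps_def algebra_simps)

lemma Der_times: "d \<otimes>\<^bsub>\<Theta>\<^esub> e = (\<lambda>f. d f + e f)" and Der_one: "\<one>\<^bsub>\<Theta>\<^esub> = (\<lambda>f. 0)"
  by (simp_all add: Der_fps_def)

lemma Der_minus: "d \<in> carrier \<Theta> \<Longrightarrow> (\<lambda>f. - d f) \<in> carrier \<Theta>"
  by (auto simp: Der_fps_def algebra_simps)

lemma Der_inv_eq: "d \<in> carrier \<Theta> \<Longrightarrow> inv\<^bsub>\<Theta>\<^esub> d = (\<lambda>f. - d f)"
  using comm_group.axioms(2)[OF comm_group_Der]
  by (intro group.inv_equality) (auto simp: Der_minus Der_times Der_one)

text \<open>\<open>cocycle_lift\<close> for a single automorphism. The derivation acts after \<phi>,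
  so composing two such maps adds d and the conjugate of the second derivation by \<phi>; this is
  the source of the cocycle identity.\<close>

definition aut_lift :: "('k::field fps \<Rightarrow> 'k fps) \<Rightarrow> ('k fps \<Rightarrow> 'k fps) \<Rightarrow> 'k dualnum fps \<Rightarrow> 'k dualnum fps"
  where "aut_lift \<phi> d f = dfps (\<phi> (re f)) (d (\<phi> (re f)) + \<phi> (im f))"

lemma aut_lift_dfps [simp]: "aut_lift \<phi> d (dfps x x') = dfps (\<phi> x) (d (\<phi> x) + \<phi> x')"
  by (simp add: aut_lift_def)

lemma aut_lift_closed:
  assumes \<phi>: "\<phi> \<in> carrier \<Gamma>" and d: "d \<in> carrier \<Theta>"
  shows "aut_lift \<phi> d \<in> carrier \<Gamma>"
proof -
  let ?\<psi> = "inv\<^bsub>\<Gamma>\<^esub> \<phi>"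
  let ?b = "\<lambda>f. dfps (?\<psi> (re f)) (?\<psi> (im f - d (re f)))"
  have "?b \<circ> aut_lift \<phi> d = id" "aut_lift \<phi> d \<circ> ?b = id"
    by (auto simp: fun_eq_iff aut_lift_def Aut_inv_left[OF \<phi>] Aut_fps_inv[OF \<phi>])
  then have "bij (aut_lift \<phi> d)" by (rule o_bij)
  then show ?thesis
    unfolding Aut_fps_def
    by (simp add: aut_lift_def dfps_add dfps_mult dfps_const[symmetric] Aut_add[OF \<phi>] Aut_mult[OF \<phi>]
        Aut_const[OF \<phi>] Der_add[OF d] Der_mult[OF d] Der_const[OF d] algebra_simps)
qed

lemma reduces_to_aut_lift: "reduces_to dn_re (aut_lift \<phi> d) \<phi>"
  by (simp add: reduces_to_def aut_lift_def)

lemma id_in_Aut: "id \<in> carrier \<Gamma>"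
  by (simp add: Aut_fps_def)

text \<open>By k[\<epsilon>]-linearity u is determined by its values on k[[t]], where it has the
  form 1 + \<epsilon> v; multiplicativity of u is the Leibniz rule for v.\<close>

lemma reduces_to_id_cases:
  assumes u: "u \<in> carrier \<Gamma>" "reduces_to dn_re u (id :: 'k::field fps \<Rightarrow> 'k fps)"
  obtains v where "v \<in> carrier \<Theta>" "u = aut_lift id v"
proof -
  define v where "v = (\<lambda>x. im (u (dfps x 0)))"
  have u0: "u (dfps x 0) = dfps x (v x)" for x
    using u(2) dfps_re_im[of "u (dfps x 0)"] by (simp add: v_def reduces_to_def)
  have u': "u (dfps x x') = dfps x (v x + x')" for x x'
  proof -
    have "dfps x x' = dfps x 0 + fps_const (DualNum 0 1) * dfps x' 0"
      by (simp add: dfps_const dfps_mult dfps_add)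
    then show ?thesis
      using Aut_add[OF u(1)] Aut_mult[OF u(1)] Aut_const[OF u(1)]
      by (simp add: u0) (simp add: dfps_const dfps_mult dfps_add)
  qed
  have "v \<in> carrier \<Theta>"
  proof -
    have "v (f + g) = v f + v g" for f g
      using Aut_add[OF u(1), of "dfps f 0" "dfps g 0"] by (simp add: dfps_add u0)
    moreover have "v (f * g) = f * v g + g * v f" for f g
      using Aut_mult[OF u(1), of "dfps f 0" "dfps g 0"] by (simp add: dfps_mult u0 mult.commute)
    moreover have "v (fps_const a) = 0" for a
      using Aut_const[OF u(1), of "DualNum a 0"] by (simp add: dfps_const u0)
    ultimately show ?thesis by (simp add: Der_fps_def)
  qed
  moreover have "u = aut_lift id v"
  proof
    fix f show "u f = aut_lift id v f" using u'[of "re f" "im f"] by (simp add: aut_lift_def)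
  qed
  ultimately show ?thesis using that by blast
qed

lemma inv_aut_lift_id:
  assumes "v \<in> carrier \<Theta>"
  shows "inv\<^bsub>\<Gamma>\<^esub> (aut_lift id v) = aut_lift id (\<lambda>f. - v f)"
proof (rule group.inv_equality[OF group_Aut_fps])
  show "aut_lift id (\<lambda>f. - v f) \<otimes>\<^bsub>\<Gamma>\<^esub> aut_lift id v = \<one>\<^bsub>\<Gamma>\<^esub>"
    by (simp add: fun_eq_iff Aut_fps_mult aut_lift_def) (simp add: Aut_fps_def)
qed (simp_all add: aut_lift_closed[OF id_in_Aut] assms Der_minus)

lemma cocycle_lift_eq: "g \<in> carrier G \<Longrightarrow> cocycle_lift G \<rho> z g = aut_lift (\<rho> g) (z g)"
  by (simp add: cocycle_lift_def aut_lift_def dfps_def Let_def fun_eq_iff)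

lemma equiv_class_subset:
  assumes "equiv A r" "x \<in> A" "T \<subseteq> r `` {x}" "T \<noteq> {}"
  shows "r `` T = r `` {x}"
  using assms unfolding equiv_def sym_def trans_def by blast

section \<open>Lifts to the dual numbers as 1-cocycles\<close>

context fps_action
begin

abbreviation (input) "clift \<equiv> cocycle_lift G \<rho>"

lemma der_act_eq: "g \<in> carrier G \<Longrightarrow> der_act \<rho> g d f = \<rho> g (d (\<rho> (inv g) f))"
  by (simp add: der_act_def inv_rho)

lemma der_act_rho: "g \<in> carrier G \<Longrightarrow> der_act \<rho> g d (\<rho> g f) = \<rho> g (d f)"
  by (simp add: der_act_eq rho_inv_left)

lemma gmodule_Der: "gmodule G \<Theta> (der_act \<rho>)"
  unfolding gmodule_def gmodule_axioms_def
proof (intro conjI allI impI comm_group_Der group_axioms)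
  fix g and d :: "'k fps \<Rightarrow> 'k fps" assume g: "g \<in> carrier G" and d: "d \<in> carrier \<Theta>"
  have ig: "inv g \<in> carrier G" using g by simp
  show "der_act \<rho> g d \<in> carrier \<Theta>"
    using g d ig by (simp add: Der_fps_def der_act_eq rho_add rho_times rho_const rho_inv_right rho_zero)
next
  fix g and d e :: "'k fps \<Rightarrow> 'k fps" assume "g \<in> carrier G"
  then show "der_act \<rho> g (d \<otimes>\<^bsub>\<Theta>\<^esub> e) = der_act \<rho> g d \<otimes>\<^bsub>\<Theta>\<^esub> der_act \<rho> g e"
    by (simp add: Der_times fun_eq_iff der_act_eq rho_add)
next
  fix g h and d :: "'k fps \<Rightarrow> 'k fps" assume "g \<in> carrier G" "h \<in> carrier G"
  then show "der_act \<rho> (g \<otimes> h) d = der_act \<rho> g (der_act \<rho> h d)"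
    by (simp add: fun_eq_iff der_act_eq inv_mult_group rho_mult)
next
  fix d :: "'k fps \<Rightarrow> 'k fps"
  show "der_act \<rho> \<one> d = d" by (simp add: fun_eq_iff der_act_eq rho_one)
qed

sublocale der: gmodule G \<Theta> "der_act \<rho>"
  by (rule gmodule_Der)

lemma cocycle_lift_in_lifts:
  assumes z: "z \<in> der.Z"
  shows "clift z \<in> lifts G \<rho> dn_re"
  unfolding lifts_def
proof (intro CollectI conjI ballI homI)
  fix g assume g: "g \<in> carrier G"
  show "clift z g \<in> carrier \<Gamma>"
    using g by (simp add: cocycle_lift_eq aut_lift_closed rho_closed der.Z_closed[OF z])
  show "reduces_to dn_re (clift z g) (\<rho> g)"
    using g by (simp add: cocycle_lift_eq reduces_to_aut_lift)
  fix h assume h: "h \<in> carrier G"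
  show "clift z (g \<otimes> h) = clift z g \<otimes>\<^bsub>\<Gamma>\<^esub> clift z h"
    using g h
    by (simp add: fun_eq_iff Aut_fps_mult cocycle_lift_eq aut_lift_def der.Z_mult[OF z] Der_times
        rho_mult der_act_rho rho_add)
qed (auto simp: cocycle_lift_def)

lemma cocycle_lift_inj: "inj_on (clift) der.Z"
proof (rule inj_onI, rule der.Z_eqI)
  fix z z' g assume z: "z \<in> der.Z" "z' \<in> der.Z" and eq: "clift z = clift z'"
    and g: "g \<in> carrier G"
  show "z g = z' g"
  proof
    fix f
    have "clift z g (dfps (\<rho> (inv g) f) 0) = clift z' g (dfps (\<rho> (inv g) f) 0)"
      using eq by simp
    then show "z g f = z' g f" using g by (simp add: cocycle_lift_eq rho_inv_right)
  qed
qed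

text \<open>Conjugation by 1 + \<epsilon> v adds v - g v to the cocycle, which is the coboundary of
  - v; hence the signs.\<close>

lemma conj_cocycle_lift:
  assumes z: "z \<in> der.Z" and v: "v \<in> carrier \<Theta>" and g: "g \<in> carrier G"
  shows "aut_lift id v \<otimes>\<^bsub>\<Gamma>\<^esub> clift z g \<otimes>\<^bsub>\<Gamma>\<^esub> inv\<^bsub>\<Gamma>\<^esub> (aut_lift id v)
    = clift (\<lambda>g\<in>carrier G. der_act \<rho> g (\<lambda>f. - v f) \<otimes>\<^bsub>\<Theta>\<^esub> inv\<^bsub>\<Theta>\<^esub> (\<lambda>f. - v f) \<otimes>\<^bsub>\<Theta>\<^esub> z g) g"
  using g v
  by (simp add: fun_eq_iff Aut_fps_mult inv_aut_lift_id cocycle_lift_eq aut_lift_def Der_times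
      Der_inv_eq Der_minus der_act_rho rho_diff rho_uminus)

lemma lift_class_cocycle_lift:
  assumes z: "z \<in> der.Z"
  shows "lift_equiv G \<rho> dn_re `` {clift z} = clift ` der.cls z"
proof (intro equalityI subsetI)
  fix \<tau> assume "\<tau> \<in> lift_equiv G \<rho> dn_re `` {clift z}"
  then obtain u where \<tau>: "\<tau> \<in> lifts G \<rho> dn_re" and u: "u \<in> carrier \<Gamma>" "reduces_to dn_re u (id :: 'k fps \<Rightarrow> _)"
    and eq: "\<And>g. g \<in> carrier G \<Longrightarrow> \<tau> g = u \<otimes>\<^bsub>\<Gamma>\<^esub> clift z g \<otimes>\<^bsub>\<Gamma>\<^esub> inv\<^bsub>\<Gamma>\<^esub> u"
    by (auto simp: lift_equiv_def)
  obtain v where v: "v \<in> carrier \<Theta>" "u = aut_lift id v" using reduces_to_id_cases[OF u] .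
  define y where "y = (\<lambda>g\<in>carrier G. der_act \<rho> g (\<lambda>f. - v f) \<otimes>\<^bsub>\<Theta>\<^esub> inv\<^bsub>\<Theta>\<^esub> (\<lambda>f. - v f) \<otimes>\<^bsub>\<Theta>\<^esub> z g)"
  have "\<tau> = clift y"
  proof (rule extensionalityI)
    show "\<tau> \<in> extensional (carrier G)" using \<tau> by (simp add: lifts_def)
    show "clift y \<in> extensional (carrier G)" by (simp add: cocycle_lift_def)
    fix g assume "g \<in> carrier G"
    then show "\<tau> g = clift y g"
      using eq conj_cocycle_lift[OF z v(1)] by (simp only: v(2) y_def)
  qed
  moreover have "y \<in> der.cls z" unfolding der.mem_cls y_def using Der_minus[OF v(1)] by blast
  ultimately show "\<tau> \<in> clift ` der.cls z" by blast
next
  fix \<tau> assume "\<tau> \<in> clift ` der.cls z"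
  then obtain y where y: "y \<in> der.cls z" "\<tau> = clift y" by blast
  then obtain m where m: "m \<in> carrier \<Theta>" "y = (\<lambda>g\<in>carrier G. der_act \<rho> g m \<otimes>\<^bsub>\<Theta>\<^esub> inv\<^bsub>\<Theta>\<^esub> m \<otimes>\<^bsub>\<Theta>\<^esub> z g)"
    by (auto simp: der.mem_cls)
  have "\<forall>g\<in>carrier G. \<tau> g = aut_lift id (\<lambda>f. - m f) \<otimes>\<^bsub>\<Gamma>\<^esub> clift z g
      \<otimes>\<^bsub>\<Gamma>\<^esub> inv\<^bsub>\<Gamma>\<^esub> (aut_lift id (\<lambda>f. - m f))"
    using conj_cocycle_lift[OF z Der_minus[OF m(1)]] by (simp add: y(2) m(2))
  moreover have "\<tau> \<in> lifts G \<rho> dn_re"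
    using cocycle_lift_in_lifts der.mem_cls_in_Z[OF z y(1)] y(2) by blast
  ultimately show "\<tau> \<in> lift_equiv G \<rho> dn_re `` {clift z}"
    unfolding lift_equiv_def
    using cocycle_lift_in_lifts[OF z] aut_lift_closed[OF id_in_Aut Der_minus[OF m(1)]] reduces_to_aut_lift
    by auto
qed

text \<open>Stated for a nonempty part T of a class because restriction and induction first produce
  only some lifts of the target class, which \<open>res_map\<close> and \<open>ind_map\<close> then
  saturate.\<close>

lemma lift_class_eq_tangent_id:
  assumes z: "z \<in> der.Z" and T: "T \<subseteq> clift ` der.cls z" "T \<noteq> {}"
  shows "lift_equiv G \<rho> dn_re `` T = tangent_id G \<rho> (der.cls z)"
    and "tangent_id G \<rho> (der.cls z) = clift ` der.cls z"
proof -
  note eq = equiv_lift_equiv[OF group_axioms, of \<rho> "dn_re :: 'k dualnum \<Rightarrow> 'k"]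
  note c = equiv_class_subset[OF eq cocycle_lift_in_lifts[OF z]]
  have "tangent_id G \<rho> (der.cls z) = lift_equiv G \<rho> dn_re `` {clift z}"
    unfolding tangent_id_def using der.self_mem_cls[OF z] by (intro c) (auto simp: lift_class_cocycle_lift[OF z])
  then show "tangent_id G \<rho> (der.cls z) = clift ` der.cls z"
    "lift_equiv G \<rho> dn_re `` T = tangent_id G \<rho> (der.cls z)"
    using c[of T] T by (simp_all add: lift_class_cocycle_lift[OF z])
qed

lemma tangent_id_cls: "z \<in> der.Z \<Longrightarrow> tangent_id G \<rho> (der.cls z) = clift ` der.cls z"
  using lift_class_eq_tangent_id(2)[of z "clift ` der.cls z"] der.self_mem_cls by blast

lemma tangent_id_inj: "inj_on (tangent_id G \<rho>) (carrier (H1 G \<Theta> (der_act \<rho>)))"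
proof (rule inj_onI)
  fix c c' assume "c \<in> carrier (H1 G \<Theta> (der_act \<rho>))" "c' \<in> carrier (H1 G \<Theta> (der_act \<rho>))"
    and eq: "tangent_id G \<rho> c = tangent_id G \<rho> c'"
  then obtain z z' where z: "z \<in> der.Z" "c = der.cls z" and z': "z' \<in> der.Z" "c' = der.cls z'"
    by (auto simp: der.carrier_H1)
  have "clift ` c = clift ` c'" using eq z z' tangent_id_cls by simp
  then show "c = c'"
    using inj_on_image_eq_iff[OF cocycle_lift_inj, of c c'] der.mem_cls_in_Z z z' by blast
qed

text \<open>The infinitesimal part of \<open>y\<^sub>A\<close>. As \<open>y\<^sub>A\<close> is invariant, it trivializes the restriction of
  the cocycle to \<open>k[[y]]\<close>.\<close>

definition zeta where "zeta z = im (orbit_prod (carrier G) (clift z))"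

lemma orbit_prod_cocycle_lift: "orbit_prod (carrier G) (clift z) = dfps y_G (zeta z)"
proof -
  have "re (orbit_prod (carrier G) (clift z)) = y_G"
    unfolding orbit_prod_def re_prod by (simp add: cocycle_lift_eq dfps_X)
  then show ?thesis using dfps_re_im by (metis zeta_def)
qed

lemma cocycle_y:
  assumes z: "z \<in> der.Z" and g: "g \<in> carrier G"
  shows "z g y_G = zeta z - \<rho> g (zeta z)"
proof -
  have h: "clift z \<in> hom G \<Gamma>" and c: "clift z g \<in> carrier \<Gamma>"
    using cocycle_lift_in_lifts[OF z] g by (auto simp: lifts_def hom_def)
  let ?Y = "orbit_prod (carrier G) (clift z)"
  have "clift z g ?Y = (\<Prod>s\<in>carrier G. clift z (g \<otimes> s) fps_X)"
    using g hom_mult[OF h g] by (simp add: orbit_prod_def Aut_prod[OF c] Aut_fps_mult)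
  also have "\<dots> = ?Y"
    unfolding orbit_prod_def by (rule prod_translate[OF g])
  finally have "dfps y_G (z g y_G + \<rho> g (zeta z)) = dfps y_G (zeta z)"
    using g by (simp add: orbit_prod_cocycle_lift cocycle_lift_eq rho_y)
  then show ?thesis by (simp add: algebra_simps)
qed

end

lemma (in group) rcoset_eq_iff:
  assumes H: "subgroup H G" and x: "x \<in> carrier G" "y \<in> carrier G"
  shows "H #> x = H #> y \<longleftrightarrow> x \<otimes> inv y \<in> H"
proof -
  interpret H: subgroup H G by fact
  have "x \<in> H #> y \<longleftrightarrow> x \<otimes> inv y \<in> H" using H.rcos_module[OF is_group x(2,1)] .
  then show ?thesis using repr_independence[OF _ x(2) H] rcos_self[OF x(1) H] by metis
qed

context normal_fps_action
begin

abbreviation (input) "pr1 \<equiv> Q1_proj G N \<rho>"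
abbreviation (input) "pr2 \<equiv> Q2_proj G N \<rho>"
abbreviation (input) "prs \<equiv> Qs_proj G N \<rho>"
abbreviation (input) "ThN \<equiv> Theta1_inv G N \<rho>"
abbreviation (input) "j12 \<equiv> Q1_to_Q2 G N \<rho>"
abbreviation (input) "j1s \<equiv> Q1_to_Qs G N \<rho>"
abbreviation (input) "p2H \<equiv> Q2_to_H1 G N \<rho>"
abbreviation (input) "acts \<equiv> Qs_act G N \<rho>"
abbreviation (input) "act1 \<equiv> Q1_act \<rho>"
abbreviation (input) "act2 \<equiv> Q2_act \<rho>"
abbreviation (input) "DerN \<equiv> Der_inv G N \<rho>"
abbreviation (input) "infl \<equiv> infl_connecting G N \<rho>"
abbreviation (input) "\<Phi> \<equiv> Phi_tangent G N \<rho>"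
abbreviation (input) "\<gamma> \<equiv> gamma_map G N \<rho>"
abbreviation (input) "\<sigma> \<equiv> sigma_map G N \<rho>"
abbreviation (input) "HN \<equiv> H1N G N \<rho>"
abbreviation (input) "HQ \<equiv> H1sharp G N \<rho>"
abbreviation (input) "HG \<equiv> H1G G \<rho>"
abbreviation (input) "M1 \<equiv> Q1 G N \<rho>"
abbreviation (input) "M2 \<equiv> Q2 G N \<rho>"
abbreviation (input) "Ms \<equiv> Qs G N \<rho>"

lemma normal_N: "N \<lhd> G"
  by (rule N.normal_axioms)

subsection \<open>Derivations as elements of \<open>k[[t]]\<close>\<close>

abbreviation v where "v \<equiv> fps_deriv y_G"
abbreviation "evG \<equiv> ev G \<rho>"
abbreviation "evs \<equiv> ev_sharp G N \<rho>"

lemma ev_eq: "d \<in> carrier \<Theta> \<Longrightarrow> evG d = v * d fps_X"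
  using Der_eq_deriv[of d y_G] by (simp add: ev_def)

text \<open>The chain rule through \<open>y_N\<close> puts derivations of k[[t]] on the same scale
  as those of k[[t]]^N, where \<open>evs_eq_w\<close> has the same factor w.\<close>

lemma ev_eq_w: "d \<in> carrier \<Theta> \<Longrightarrow> evG d = w * d y_N"
  using Der_eq_deriv[of d y_N] by (simp add: ev_eq deriv_y_G mult.assoc)

lemma evs_eq: "evs d = d Q.y_G oo y_N"
  by (simp add: ev_sharp_def compose_y_Q[symmetric] from_inv_eq del: compose_y_Q)

lemma evs_eq_w: "d \<in> carrier \<Theta> \<Longrightarrow> evs d = w * (d fps_X oo y_N)"
  using Der_eq_deriv[of d Q.y_G] by (simp add: evs_eq w_def fps_compose_mult_distrib N.y_nth_0)

lemma ev_rho: "g \<in> carrier G \<Longrightarrow> evG (der_act \<rho> g d) = \<rho> g (evG d)"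
  using der_act_rho[of g d y_G] by (simp add: ev_def rho_y)

lemma evs_rho: "C \<in> carrier Q \<Longrightarrow> g \<in> C \<Longrightarrow> evs (der_act \<rho>s C d) = \<rho> g (evs d)"
  using Q.der_act_rho[of C d Q.y_G] by (simp add: evs_eq Q.rho_y sharp_compose)

lemma ev_add: "evG (d \<otimes>\<^bsub>\<Theta>\<^esub> e) = evG d + evG e"
  and evs_add: "evs (d \<otimes>\<^bsub>\<Theta>\<^esub> e) = evs d + evs e"
  by (simp_all add: ev_def evs_eq Der_times fps_compose_add_distrib)

lemma ev_inv: "d \<in> carrier \<Theta> \<Longrightarrow> evG (inv\<^bsub>\<Theta>\<^esub> d) = - evG d"
  and evs_inv: "d \<in> carrier \<Theta> \<Longrightarrow> evs (inv\<^bsub>\<Theta>\<^esub> d) = - evs d"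
  by (simp_all add: ev_def evs_eq Der_inv_eq fps_compose_uminus)

lemma ev_one: "evG \<one>\<^bsub>\<Theta>\<^esub> = 0" and evs_one: "evs \<one>\<^bsub>\<Theta>\<^esub> = 0"
  by (simp_all add: ev_def evs_eq Der_one)

lemma ev_inj: "inj_on evG (carrier \<Theta>)"
  by (rule inj_onI) (use deriv_y_nonzero in \<open>auto simp: ev_eq intro: Der_ext\<close>)

lemma evs_inj: "inj_on evs (carrier \<Theta>)"
  by (rule inj_onI) (use w_nonzero in \<open>auto simp: evs_eq_w compose_y_N_cancel intro: Der_ext\<close>)

lemma ev_image: "evG ` carrier \<Theta> = {f. v dvd f}"
proof (intro equalityI subsetI)
  fix f assume "f \<in> {f. v dvd f}"
  then obtain h where "f = v * h" by auto
  then have "f = evG (\<lambda>x. fps_deriv x * h)" by (simp add: ev_def)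
  then show "f \<in> evG ` carrier \<Theta>" using deriv_mult_in_Der by blast
qed (auto simp: ev_eq)

lemma evs_image: "evs ` carrier \<Theta> = {f \<in> S. w dvd f}"
proof (intro equalityI subsetI)
  fix f assume "f \<in> {f \<in> S. w dvd f}"
  then obtain h where f: "f \<in> S" "f = w * h" by auto
  have "h \<in> S"
    using f w_in w_nonzero N_in_G by (auto simp: fps_inv_def rho_times)
  then obtain H where H: "h = H oo y_N" by (auto simp: fps_inv_N_iff)
  then have "f = evs (\<lambda>x. fps_deriv x * H)"
    by (simp add: evs_eq_w[OF deriv_mult_in_Der] f)
  then show "f \<in> evs ` carrier \<Theta>" using deriv_mult_in_Der by blast
qed (auto simp: evs_eq_w w_in compose_in_fps_inv fps_inv_mult[OF N.subset])

lemma inv_into_ev: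
  assumes "v dvd f"
  shows "inv_into (carrier \<Theta>) evG f \<in> carrier \<Theta>" "evG (inv_into (carrier \<Theta>) evG f) = f"
proof -
  have "f \<in> evG ` carrier \<Theta>" unfolding ev_image using assms by simp
  then show "inv_into (carrier \<Theta>) evG f \<in> carrier \<Theta>" "evG (inv_into (carrier \<Theta>) evG f) = f"
    by (rule inv_into_into, rule f_inv_into_f)
qed

lemma inv_into_evs:
  assumes "f \<in> S" "w dvd f"
  shows "inv_into (carrier \<Theta>) evs f \<in> carrier \<Theta>" "evs (inv_into (carrier \<Theta>) evs f) = f"
proof -
  have "f \<in> evs ` carrier \<Theta>" unfolding evs_image using assms by simp
  then show "inv_into (carrier \<Theta>) evs f \<in> carrier \<Theta>" "evs (inv_into (carrier \<Theta>) evs f) = f"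
    by (rule inv_into_into, rule f_inv_into_f)
qed

lemma obtain_ev: assumes "v dvd f" obtains d where "d \<in> carrier \<Theta>" "evG d = f"
  by (rule that[OF inv_into_ev[OF assms]])

lemma obtain_evs: assumes "f \<in> S" "w dvd f" obtains d where "d \<in> carrier \<Theta>" "evs d = f"
  by (rule that[OF inv_into_evs[OF assms]])

lemma v_dvd_ev: "d \<in> carrier \<Theta> \<Longrightarrow> v dvd evG d"
  using ev_image by auto

lemma evs_in: "d \<in> carrier \<Theta> \<Longrightarrow> evs d \<in> S" "d \<in> carrier \<Theta> \<Longrightarrow> w dvd evs d"
  using evs_image by auto

lemma w_dvd_v: "v dvd f \<Longrightarrow> w dvd f"
  by (auto simp: deriv_y_G)

lemma v_dvd_rho: assumes g: "g \<in> carrier G" and f: "v dvd f" shows "v dvd \<rho> g f"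
proof -
  obtain d where d: "d \<in> carrier \<Theta>" "evG d = f" using obtain_ev[OF f] .
  show ?thesis using v_dvd_ev[OF der.act_closed[OF g d(1)]] g d by (simp add: ev_rho)
qed

text \<open>w is itself the value of a derivation of k[[t]]^N, and conjugation by G/N preserves
  these derivations; so the ideal generated by w is G-stable.\<close>

lemma w_dvd_rho: assumes g: "g \<in> carrier G" and f: "w dvd f" shows "w dvd \<rho> g f"
proof -
  obtain h where h: "f = w * h" using f by auto
  obtain d where d: "d \<in> carrier \<Theta>" "evs d = w" using obtain_evs[OF w_in dvd_refl] .
  have "w dvd evs (der_act \<rho>s (N #> g) d)"
    by (rule evs_in(2)[OF Q.der.act_closed[OF coset_in_Q[OF g] d(1)]])
  then have "w dvd \<rho> g w"
    using d by (simp add: evs_rho[OF coset_in_Q[OF g] coset_mem[OF g]])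
  then show ?thesis using g by (simp add: h rho_times)
qed

lemma Der_inv_iff: "d \<in> carrier (DerN) \<longleftrightarrow> d \<in> carrier \<Theta> \<and> evG d \<in> S"
proof -
  have "der_act \<rho> n d = d \<longleftrightarrow> \<rho> n (evG d) = evG d" if "n \<in> N" "d \<in> carrier \<Theta>" for n
    using inj_onD[OF ev_inj _ der.act_closed[OF N_in_G[OF that(1)] that(2)] that(2)] ev_rho[OF N_in_G[OF that(1)], of d]
    by auto
  then show ?thesis by (auto simp: Der_inv_def invariants_def fps_inv_def)
qed

lemma ev_Der_inv: "evG ` carrier (DerN) = {f \<in> S. v dvd f}"
proof (intro equalityI subsetI)
  fix f assume f: "f \<in> {f \<in> S. v dvd f}"
  then obtain d where "d \<in> carrier \<Theta>" "evG d = f" using obtain_ev by blast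
  then show "f \<in> evG ` carrier (DerN)" using f Der_inv_iff by blast
qed (use Der_inv_iff v_dvd_ev in blast)

lemma der_restrict:
  assumes d: "d \<in> carrier (DerN)"
  shows "der_restrict N \<rho> d \<in> carrier \<Theta>" "evs (der_restrict N \<rho> d) = evG d"
proof -
  have d\<Theta>: "d \<in> carrier \<Theta>" and inv: "\<And>n. n \<in> N \<Longrightarrow> der_act \<rho> n d = d"
    using d by (auto simp: Der_inv_def invariants_def)
  have "d (f oo y_N) \<in> S" for f
    unfolding fps_inv_def
  proof safe
    fix n assume n: "n \<in> N"
    show "\<rho> n (d (f oo y_N)) = d (f oo y_N)"
      using der_act_rho[OF N_in_G[OF n], of d "f oo y_N"] inv[OF n] N.rho_compose_y[OF n] by simp
  qed
  then have c: "der_restrict N \<rho> d f oo y_N = d (f oo y_N)" for f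
    by (simp add: der_restrict_def from_inv_eq to_inv_in)
  have "der_restrict N \<rho> d (f + g) = der_restrict N \<rho> d f + der_restrict N \<rho> d g"
    "der_restrict N \<rho> d (f * g) = f * der_restrict N \<rho> d g + g * der_restrict N \<rho> d f"
    "der_restrict N \<rho> d (fps_const a) = 0" for f g a
    by (rule compose_y_N_cancel[THEN iffD1], simp add: c fps_compose_add_distrib fps_compose_mult_distrib
        N.y_nth_0 Der_add[OF d\<Theta>] Der_mult[OF d\<Theta>] Der_const[OF d\<Theta>])+
  then show "der_restrict N \<rho> d \<in> carrier \<Theta>" by (simp add: Der_fps_def)
  show "evs (der_restrict N \<rho> d) = evG d" by (simp add: evs_eq c compose_y_Q ev_def)
qed

text \<open>Under \<open>evs\<close> the submodule \<open>\<Theta>\<^sup>N\<close> of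
  \<open>\<Theta>\<^sup>\<sharp>\<close> becomes the values divisible by v. Hence equality in each
  of the quotients \<open>M1\<close>, \<open>M2\<close> and \<open>Ms\<close> is the same congruence
  modulo v.\<close>

lemma der_restrict_image:
  "der_restrict N \<rho> ` carrier (DerN) = {d \<in> carrier \<Theta>. v dvd evs d}"
proof (intro equalityI subsetI)
  fix d assume d: "d \<in> {d \<in> carrier \<Theta>. v dvd evs d}"
  then have "evs d \<in> evG ` carrier (DerN)" using evs_in(1) by (simp add: ev_Der_inv)
  then obtain e where e: "e \<in> carrier (DerN)" "evs d = evG e" by blast
  then have "d = der_restrict N \<rho> e"
    using d der_restrict[OF e(1)] by (intro inj_onD[OF evs_inj]) simp_all
  then show "d \<in> der_restrict N \<rho> ` carrier (DerN)" using e(1) by (rule image_eqI)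
next
  fix d assume "d \<in> der_restrict N \<rho> ` carrier (DerN)"
  then obtain e where e: "e \<in> carrier (DerN)" "d = der_restrict N \<rho> e" by blast
  then show "d \<in> {d \<in> carrier \<Theta>. v dvd evs d}"
    using der_restrict[OF e(1)] v_dvd_ev[of e] by (simp add: Der_inv_iff)
qed

subsection \<open>The modules and their quotients\<close>

abbreviation "Th1 \<equiv> Theta1 G N \<rho>"

lemma Th1_carrier: "carrier Th1 = {f. w dvd f}"
  by (rule carrier_Theta1)

lemma Th1_simps [simp]: "x \<otimes>\<^bsub>Th1\<^esub> y = x + y" "\<one>\<^bsub>Th1\<^esub> = 0"
  by (simp_all add: Theta1_def)

lemma comm_group_Th1: "comm_group Th1"
proof (rule comm_groupI)
  fix x assume "x \<in> carrier Th1"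
  then show "\<exists>y\<in>carrier Th1. y \<otimes>\<^bsub>Th1\<^esub> x = \<one>\<^bsub>Th1\<^esub>"
    by (intro bexI[of _ "- x"]) (auto simp: Th1_carrier)
qed (auto simp: Th1_carrier)

lemma Th1_inv: "x \<in> carrier Th1 \<Longrightarrow> inv\<^bsub>Th1\<^esub> x = - x"
  using comm_group.axioms(2)[OF comm_group_Th1]
  by (intro group.inv_equality) (auto simp: Th1_carrier)

lemma gmodule_Th1: "gmodule G Th1 \<rho>"
  unfolding gmodule_def gmodule_axioms_def
  using comm_group_Th1 group_axioms
  by (auto simp: Th1_carrier w_dvd_rho rho_add rho_mult rho_one)

sublocale th1: gmodule G Th1 \<rho>
  by (rule gmodule_Th1)

sublocale th1N: gmodule "G\<lparr>carrier := N\<rparr>" Th1 \<rho>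
  rewrites "carrier (G\<lparr>carrier := N\<rparr>) = N"
  by (rule th1.gmodule_subgroup[OF N.subgroup_axioms]) simp

sublocale th1i: gmodule Q "ThN" "act_Mod \<rho>"
  unfolding Theta1_inv_def by (rule th1.gmodule_inflation(1)[OF normal_N])

lemma Th1i_carrier: "carrier (ThN) = {f \<in> S. w dvd f}"
  by (auto simp: Theta1_inv_def invariants_def Th1_carrier fps_inv_def)

lemma Th1i_simps [simp]: "x \<otimes>\<^bsub>ThN\<^esub> y = x + y" "\<one>\<^bsub>ThN\<^esub> = 0"
  by (simp_all add: Theta1_inv_def invariants_def)

lemma fps_inv_minus: "f \<in> S \<Longrightarrow> - f \<in> S"
  using N_in_G by (auto simp: fps_inv_def rho_uminus)

lemma fps_inv_diff: "f \<in> S \<Longrightarrow> g \<in> S \<Longrightarrow> f - g \<in> S"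
  using N_in_G by (auto simp: fps_inv_def rho_diff)

lemma Th1i_inv: "x \<in> carrier (ThN) \<Longrightarrow> inv\<^bsub>ThN\<^esub> x = - x"
  by (rule th1i.M.inv_equality) (auto simp: Th1i_carrier fps_inv_minus)

lemma act_Mod_Th1i:
  "C \<in> carrier Q \<Longrightarrow> g \<in> C \<Longrightarrow> x \<in> carrier (ThN) \<Longrightarrow> act_Mod \<rho> C x = \<rho> g x"
  unfolding Theta1_inv_def by (rule th1.gmodule_inflation(2)[OF normal_N])

sublocale deri: gmodule Q "DerN" "act_Mod (der_act \<rho>)"
  unfolding Der_inv_def by (rule der.gmodule_inflation(1)[OF normal_N])

lemma act_Mod_Der_inv:
  "C \<in> carrier Q \<Longrightarrow> g \<in> C \<Longrightarrow> d \<in> carrier (DerN) \<Longrightarrow> act_Mod (der_act \<rho>) C d = der_act \<rho> g d"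
  unfolding Der_inv_def by (rule der.gmodule_inflation(2)[OF normal_N])

abbreviation "E \<equiv> {f. v dvd f}"
abbreviation "EN \<equiv> {f \<in> S. v dvd f}"
abbreviation "Ds \<equiv> {d \<in> carrier \<Theta>. v dvd evs d}"

lemma subgroup_E: "subgroup E Th1"
  by (rule th1.M.subgroupI) (auto simp: Th1_carrier w_dvd_v Th1_inv)

lemma subgroup_EN: "subgroup EN (ThN)"
proof (rule th1i.M.subgroupI)
  show "EN \<noteq> {}" using fps_inv_0[OF N.subset] by force
qed (auto simp: Th1i_carrier w_dvd_v Th1i_inv fps_inv_minus fps_inv_add[OF N.subset])

lemma subgroup_Ds: "subgroup Ds \<Theta>"
proof (rule der.M.subgroupI)
  show "Ds \<noteq> {}" using der.M.one_closed by (force simp: evs_one)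
qed (auto simp: evs_inv evs_add)

sublocale q1: gmodule Q "M1" "act1"
  unfolding Q1_def ev_Der_inv
proof (rule th1i.gmodule_quotient(1)[OF subgroup_EN])
  fix C x assume C: "C \<in> carrier Q" and x: "x \<in> EN"
  obtain g where g: "g \<in> carrier G" "g \<in> C" using coset_nonempty[OF C] by auto
  show "act_Mod \<rho> C x \<in> EN"
    using x g by (subst act_Mod_Th1i[OF C g(2)]) (auto simp: Th1i_carrier w_dvd_v rho_fps_inv v_dvd_rho)
qed

lemma Q1_carrier: "carrier (M1) = pr1 ` {f \<in> S. w dvd f}"
  by (simp add: Q1_def Q1_proj_def carrier_FactGroup Th1i_carrier)

lemma Q1_proj_eq_iff:
  assumes "x \<in> S" "w dvd x" "y \<in> S" "w dvd y"
  shows "pr1 x = pr1 y \<longleftrightarrow> v dvd x - y"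
  unfolding Q1_proj_def ev_Der_inv
  using th1i.M.rcoset_eq_iff[OF subgroup_EN, of x y] assms
  by (auto simp: Th1i_carrier Th1i_inv fps_inv_diff)

lemma Q1_proj_add:
  assumes "x \<in> S" "w dvd x" "y \<in> S" "w dvd y"
  shows "pr1 x \<otimes>\<^bsub>M1\<^esub> pr1 y = pr1 (x + y)"
  unfolding Q1_proj_def Q1_def ev_Der_inv mult_FactGroup
  using normal.rcos_sum[OF th1i.M.subgroup_imp_normal[OF subgroup_EN], of x y] assms
  by (simp add: Th1i_carrier)

lemma Q1_act_proj:
  assumes "C \<in> carrier Q" "g \<in> C" "x \<in> S" "w dvd x"
  shows "act1 C (pr1 x) = pr1 (\<rho> g x)"
proof -
  have st: "act_Mod \<rho> D y \<in> EN" if D: "D \<in> carrier Q" and y: "y \<in> EN" for D y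
  proof -
    obtain g where g: "g \<in> carrier G" "g \<in> D" using coset_nonempty[OF D] by auto
    show ?thesis
      using y g by (subst act_Mod_Th1i[OF D g(2)]) (auto simp: Th1i_carrier w_dvd_v rho_fps_inv v_dvd_rho)
  qed
  show ?thesis
    using th1i.gmodule_quotient(2)[OF subgroup_EN st assms(1), of x] assms act_Mod_Th1i[OF assms(1,2), of x]
    by (simp add: Q1_proj_def ev_Der_inv Th1i_carrier)
qed

lemma E_stable: "g \<in> carrier G \<Longrightarrow> x \<in> E \<Longrightarrow> \<rho> g x \<in> E"
  by (simp add: v_dvd_rho)

sublocale q2: gmodule Q "M2" "act2"
  unfolding Q2_def ev_image
  by (rule gmodule.gmodule_inflation(1)[OF th1.gmodule_quotient(1)[OF subgroup_E E_stable] normal_N])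

lemma Q2_proj_eq_iff:
  assumes "w dvd x" "w dvd y"
  shows "pr2 x = pr2 y \<longleftrightarrow> v dvd x - y"
  unfolding Q2_proj_def ev_image
  using th1.M.rcoset_eq_iff[OF subgroup_E, of x y] assms by (auto simp: Th1_carrier Th1_inv)

lemma act_quot_Q2_proj:
  "g \<in> carrier G \<Longrightarrow> w dvd x \<Longrightarrow> act_quot \<rho> g (pr2 x) = pr2 (\<rho> g x)"
  using th1.gmodule_quotient(2)[OF subgroup_E E_stable, of g x] by (simp add: Q2_proj_def ev_image Th1_carrier)

lemma Q2_carrier: "carrier (M2) = pr2 ` {x. w dvd x \<and> (\<forall>n\<in>N. v dvd \<rho> n x - x)}"
proof -
  have "carrier (M2) = {X \<in> pr2 ` {x. w dvd x}. \<forall>n\<in>N. act_quot \<rho> n X = X}"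
    by (simp add: Q2_def invariants_def carrier_FactGroup Q2_proj_def Th1_carrier)
  also have "\<dots> = pr2 ` {x. w dvd x \<and> (\<forall>n\<in>N. v dvd \<rho> n x - x)}"
  proof -
    have "act_quot \<rho> n (pr2 x) = pr2 x \<longleftrightarrow> v dvd \<rho> n x - x"
      if "n \<in> N" "w dvd x" for n x
      using that N_in_G by (simp add: act_quot_Q2_proj Q2_proj_eq_iff w_dvd_rho)
    then show ?thesis by blast
  qed
  finally show ?thesis .
qed

lemma Q2_proj_add:
  assumes "w dvd x" "w dvd y"
  shows "pr2 x \<otimes>\<^bsub>M2\<^esub> pr2 y = pr2 (x + y)"
  unfolding Q2_proj_def Q2_def invariants_def ev_image
  using normal.rcos_sum[OF th1.M.subgroup_imp_normal[OF subgroup_E], of x y] assms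
  by (simp add: Th1_carrier mult_FactGroup)

lemma Q2_act_proj:
  assumes C: "C \<in> carrier Q" and g: "g \<in> C" and x: "w dvd x" "\<And>n. n \<in> N \<Longrightarrow> v dvd \<rho> n x - x"
  shows "act2 C (pr2 x) = pr2 (\<rho> g x)"
proof -
  have "pr2 x \<in> carrier (M2)" using x by (auto simp: Q2_carrier)
  then have m: "pr2 x \<in> carrier (invariants (subgrp G N) (Th1 Mod E) (act_quot \<rho>))"
    unfolding Q2_def ev_image .
  interpret T: gmodule G "Th1 Mod E" "act_quot \<rho>"
    by (rule th1.gmodule_quotient(1)[OF subgroup_E E_stable])
  have "act2 C (pr2 x) = act_quot \<rho> g (pr2 x)"
    by (rule T.gmodule_inflation(2)[OF normal_N C g m])
  then show ?thesis using x coset_in_G[OF C g] by (simp add: act_quot_Q2_proj)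
qed

lemma Q2_inv:
  assumes "w dvd x" "\<And>n. n \<in> N \<Longrightarrow> v dvd \<rho> n x - x"
  shows "inv\<^bsub>M2\<^esub> (pr2 x) = pr2 (- x)"
proof (rule q2.M.inv_equality)
  have "v dvd \<rho> n (- x) - (- x)" if "n \<in> N" for n
    using assms(2)[OF that] N_in_G[OF that] by (simp add: rho_uminus dvd_diff_commute)
  then show "pr2 x \<in> carrier (M2)" "pr2 (- x) \<in> carrier (M2)"
    using assms by (auto simp: Q2_carrier)
  have "\<one>\<^bsub>M2\<^esub> = pr2 0"
    using th1.M.coset_join2[OF th1.M.one_closed subgroup_E] by (simp add: Q2_def invariants_def Q2_proj_def ev_image)
  then show "pr2 (- x) \<otimes>\<^bsub>M2\<^esub> pr2 x = \<one>\<^bsub>M2\<^esub>"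
    using assms by (simp add: Q2_proj_add)
qed

lemma Ds_stable: assumes "C \<in> carrier Q" "d \<in> Ds" shows "der_act \<rho>s C d \<in> Ds"
proof -
  obtain g where g: "g \<in> carrier G" "g \<in> C" using coset_nonempty[OF assms(1)] by auto
  show ?thesis using assms g Q.der.act_closed by (simp add: evs_rho[OF assms(1) g(2)] v_dvd_rho)
qed

sublocale qs: gmodule Q "Ms" "acts"
  unfolding Qs_def der_restrict_image
  by (rule Q.der.gmodule_quotient(1)[OF subgroup_Ds Ds_stable])

lemma Qs_carrier: "carrier (Ms) = prs ` carrier \<Theta>"
  by (simp add: Qs_def Qs_proj_def carrier_FactGroup)

lemma Qs_proj_eq_iff:
  assumes "d \<in> carrier \<Theta>" "e \<in> carrier \<Theta>"
  shows "prs d = prs e \<longleftrightarrow> v dvd evs d - evs e"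
  unfolding Qs_proj_def der_restrict_image
  using der.M.rcoset_eq_iff[OF subgroup_Ds assms] assms by (simp add: evs_add evs_inv)

lemma Qs_proj_hom: "prs \<in> hom \<Theta> (Ms)"
  unfolding Qs_proj_def Qs_def der_restrict_image
  by (rule normal.r_coset_hom_Mod[OF der.M.subgroup_imp_normal[OF subgroup_Ds]])

lemma Qs_act_proj:
  "C \<in> carrier Q \<Longrightarrow> d \<in> carrier \<Theta> \<Longrightarrow> acts C (prs d) = prs (der_act \<rho>s C d)"
  unfolding Qs_proj_def der_restrict_image
  by (rule Q.der.gmodule_quotient(2)[OF subgroup_Ds Ds_stable])

lemma Q1_to_Q2_proj:
  assumes "x \<in> S" "w dvd x"
  shows "j12 (pr1 x) = pr2 x"
proof -
  have "pr2 y = pr2 x" if "y \<in> pr1 x" for y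
  proof -
    obtain h where "h \<in> EN" "y = h + x" using \<open>y \<in> pr1 x\<close>
      unfolding Q1_proj_def ev_Der_inv r_coset_def by auto
    then show ?thesis using assms by (simp add: Q2_proj_eq_iff w_dvd_v)
  qed
  moreover have "x \<in> pr1 x"
    unfolding Q1_proj_def ev_Der_inv using th1i.M.rcos_self[OF _ subgroup_EN, of x] assms by (simp add: Th1i_carrier)
  ultimately show ?thesis unfolding Q1_to_Q2_def by blast
qed

lemma Q1_to_Qs_proj:
  assumes d: "d \<in> carrier \<Theta>"
  shows "j1s (pr1 (evs d)) = prs d"
proof -
  have "evs e \<in> pr1 (evs d) \<longleftrightarrow> v dvd evs e - evs d" if e: "e \<in> carrier \<Theta>" for e
  proof
    assume "evs e \<in> pr1 (evs d)"
    then show "v dvd evs e - evs d" unfolding Q1_proj_def ev_Der_inv r_coset_def by auto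
  next
    assume "v dvd evs e - evs d"
    then have "evs e - evs d \<in> EN" using evs_in d e by (simp add: fps_inv_diff)
    then show "evs e \<in> pr1 (evs d)"
      unfolding Q1_proj_def ev_Der_inv r_coset_def by (auto intro!: bexI[of _ "evs e - evs d"])
  qed
  moreover have "e \<in> prs d \<longleftrightarrow> e \<in> carrier \<Theta> \<and> v dvd evs e - evs d" for e
  proof
    assume "e \<in> prs d"
    then show "e \<in> carrier \<Theta> \<and> v dvd evs e - evs d"
      using d unfolding Qs_proj_def der_restrict_image r_coset_def by (auto simp: evs_add)
  next
    assume e: "e \<in> carrier \<Theta> \<and> v dvd evs e - evs d"
    then have "prs e = prs d" using d by (simp add: Qs_proj_eq_iff)
    then show "e \<in> prs d"
      using der.M.rcos_self[OF _ subgroup_Ds, of e] e by (simp add: Qs_proj_def der_restrict_image)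
  qed
  ultimately show ?thesis by (auto simp: Q1_to_Qs_def)
qed

end

context normal_fps_action
begin

subsection \<open>The tangent map of \<open>(res, ind)\<close>\<close>

lemma restrict_in_Z: "z \<in> der.Z \<Longrightarrow> restrict z N \<in> N.der.Z"
  by (rule der.act_H1_restrict(1)[OF normal_N _ one_closed])

lemma rho_w_N: "n \<in> N \<Longrightarrow> \<rho> n w = w"
  using w_in by (simp add: fps_inv_def)

lemma ev_cocycle_N:
  assumes "y \<in> N.der.Z" "n \<in> N"
  shows "evG (y n) = w * N.zeta y - \<rho> n (w * N.zeta y)"
  using N.der.Z_closed[OF assms] N.cocycle_y[OF assms] N_in_G[OF assms(2)] rho_w_N[OF assms(2)]
  by (simp add: ev_eq_w rho_times right_diff_distrib)

text \<open>The value at \<open>y_G\<close> of the derivation \<zeta> d/dy_N; the factor w places it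
  in \<Theta>_1.\<close>

definition delta where "delta z = w * N.zeta (restrict z N)"
definition ind_val where "ind_val z g = evG (z g) + \<rho> g (delta z) - delta z"

lemma ind_val_mult:
  "z \<in> der.Z \<Longrightarrow> g \<in> carrier G \<Longrightarrow> h \<in> carrier G \<Longrightarrow> ind_val z (g \<otimes> h) = ind_val z g + \<rho> g (ind_val z h)"
  by (simp add: ind_val_def der.Z_mult ev_add ev_rho rho_mult rho_add rho_diff)

lemma ind_val_N:
  assumes "z \<in> der.Z" "n \<in> N"
  shows "ind_val z n = 0"
  using ev_cocycle_N[OF restrict_in_Z[OF assms(1)] assms(2)] assms(2) by (simp add: ind_val_def delta_def)

text \<open>Expand the value at n g = g (g^-1 n g) in both ways. As \<open>ind_val z\<close>
  vanishes on N, one expansion gives the n-translate of the value at g and the other the value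
  itself.\<close>

lemma ind_val_in:
  assumes z: "z \<in> der.Z" and g: "g \<in> carrier G"
  shows "ind_val z g \<in> S" "w dvd ind_val z g"
proof -
  show "ind_val z g \<in> S"
    unfolding fps_inv_def
  proof safe
    fix n assume n: "n \<in> N"
    have m: "inv g \<otimes> n \<otimes> g \<in> N" by (rule N.inv_op_closed1[OF g n])
    have "\<rho> n (ind_val z g) = ind_val z (n \<otimes> g)"
      using ind_val_mult[OF z N_in_G[OF n] g] ind_val_N[OF z n] by simp
    also have "n \<otimes> g = g \<otimes> (inv g \<otimes> n \<otimes> g)" using g N_in_G[OF n] by (simp add: m_assoc[symmetric])
    also have "ind_val z \<dots> = ind_val z g"
      using ind_val_mult[OF z g N_in_G[OF m]] ind_val_N[OF z m] g by (simp add: rho_zero)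
    finally show "\<rho> n (ind_val z g) = ind_val z g" .
  qed
  have "w dvd delta z" by (simp add: delta_def)
  then show "w dvd ind_val z g"
    using w_dvd_v[OF v_dvd_ev[OF der.Z_closed[OF z g]]] w_dvd_rho[OF g]
    by (simp add: ind_val_def dvd_diff)
qed

lemma ind_val_coset:
  assumes z: "z \<in> der.Z" and C: "C \<in> carrier Q" "g \<in> C" "h \<in> C"
  shows "ind_val z g = ind_val z h"
proof -
  have "g \<in> N #> h" using C coset_eq' by blast
  then obtain n where n: "n \<in> N" "g = n \<otimes> h" by (auto simp: r_coset_def)
  have h: "h \<in> carrier G" using coset_in_G C by blast
  show ?thesis
    using ind_val_mult[OF z N_in_G[OF n(1)] h] ind_val_N[OF z n(1)] ind_val_in(1)[OF z h] n
    by (simp add: fps_inv_def)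
qed

definition ind_coc where
  "ind_coc z = (\<lambda>C\<in>carrier Q. inv_into (carrier \<Theta>) evs (ind_val z (rep C)))"

lemma ind_coc:
  assumes z: "z \<in> der.Z" and C: "C \<in> carrier Q"
  shows "ind_coc z C \<in> carrier \<Theta>" "g \<in> C \<Longrightarrow> evs (ind_coc z C) = ind_val z g"
  using inv_into_evs[OF ind_val_in[OF z rep_in_G[OF C]]] ind_val_coset[OF z C rep_mem[OF C]] C
  by (auto simp: ind_coc_def)

lemma ind_coc_Z:
  assumes z: "z \<in> der.Z"
  shows "ind_coc z \<in> Q.der.Z"
  unfolding Q.der.Z_iff
proof (intro conjI ballI)
  fix C D assume CD: "C \<in> carrier Q" "D \<in> carrier Q"
  then obtain g h where g: "g \<in> carrier G" "C = N #> g" and h: "h \<in> carrier G" "D = N #> h"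
    by (auto simp: carrier_FactGroup)
  have m: "g \<in> C" "h \<in> D" "g \<otimes> h \<in> C \<otimes>\<^bsub>Q\<^esub> D"
    using g h coset_mem by (auto simp: coset_mult)
  have CD': "C \<otimes>\<^bsub>Q\<^esub> D \<in> carrier Q" using CD by simp
  show "ind_coc z (C \<otimes>\<^bsub>Q\<^esub> D) = ind_coc z C \<otimes>\<^bsub>\<Theta>\<^esub> der_act \<rho>s C (ind_coc z D)"
  proof (rule inj_onD[OF evs_inj])
    show "evs (ind_coc z (C \<otimes>\<^bsub>Q\<^esub> D)) = evs (ind_coc z C \<otimes>\<^bsub>\<Theta>\<^esub> der_act \<rho>s C (ind_coc z D))"
      by (simp add: evs_add evs_rho[OF CD(1) m(1)] ind_coc(2)[OF z CD(1) m(1)] ind_coc(2)[OF z CD(2) m(2)]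
          ind_coc(2)[OF z CD' m(3)] ind_val_mult[OF z g(1) h(1)])
  qed (use ind_coc(1)[OF z] CD CD' Q.der.act_closed der.M.m_closed in auto)
qed (use ind_coc(1)[OF z] in \<open>auto simp: ind_coc_def\<close>)

lemma Der_compose_y_N: "d \<in> carrier \<Theta> \<Longrightarrow> d (F oo y_N) = (fps_deriv F oo y_N) * d y_N"
  using Der_eq_deriv[of d "F oo y_N"] Der_eq_deriv[of d y_N]
  by (simp add: fps_compose_deriv N.y_nth_0 mult.assoc)

text \<open>For the lift, \<open>from_inv\<close> sends y to \<open>y_N\<close> + \<epsilon>
  \<zeta>, so F + \<epsilon> H goes to F(y_N) + \<epsilon> (F'(y_N) \<zeta> + H(y_N)). The fact
  \<open>key\<close> says that this map intertwines the lifted action of g with the lift attached to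
  \<open>ind_coc z\<close>. Real parts agree by \<open>sharp_compose\<close>; the \<epsilon>-parts
  reduce to the value of \<open>ind_val z\<close> at g.\<close>

lemma sharp_cocycle_lift:
  assumes z: "z \<in> der.Z"
  shows "sharp G N (clift z) = cocycle_lift Q \<rho>s (ind_coc z)"
proof -
  define A where "A = clift z"
  define \<zeta> where "\<zeta> = N.zeta (restrict z N)"
  have "orbit_prod N A = orbit_prod N (cocycle_lift (G\<lparr>carrier := N\<rparr>) \<rho> (restrict z N))"
    unfolding orbit_prod_def A_def by (intro prod.cong refl) (simp add: cocycle_lift_eq N_in_G)
  then have orb: "orbit_prod N A = dfps y_N \<zeta>"
    using N.orbit_prod_cocycle_lift[of "restrict z N"] by (simp add: \<zeta>_def)
  have from_eq: "from_inv N A (dfps F H) = dfps (F oo y_N) ((fps_deriv F oo y_N) * \<zeta> + (H oo y_N))" for F H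
    by (simp add: from_inv_def orb fps_subst_dfps N.y_nth_0)
  have inj: "f = f'" if "from_inv N A f = from_inv N A f'" for f f'
  proof -
    have "from_inv N A (dfps (re f) (im f)) = from_inv N A (dfps (re f') (im f'))" using that by simp
    then have *: "re f = re f' \<and>
        (fps_deriv (re f) oo y_N) * \<zeta> + (im f oo y_N) = (fps_deriv (re f') oo y_N) * \<zeta> + (im f' oo y_N)"
      unfolding from_eq dfps_eq_iff compose_y_N_cancel .
    note r = conjunct1[OF *] and i = conjunct2[OF *]
    have "im f = im f'" using i by (simp only: r add_left_cancel compose_y_N_cancel)
    with r have "dfps (re f) (im f) = dfps (re f') (im f')" by simp
    then show ?thesis by simp
  qed
  \<comment> \<open>Injectivity for the deformed coordinate is needed to resolve
    \<open>to_inv\<close>; it follows from that for \<open>y_N\<close>, first on real parts and then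
    on \<epsilon>-parts.\<close>
  have to_from: "to_inv N A (from_inv N A f) = f" for f
    unfolding to_inv_def using inj by (intro the_equality) auto
  have key: "A g (from_inv N A (dfps F H)) = from_inv N A (dfps (\<rho>s C F) (ind_coc z C (\<rho>s C F) + \<rho>s C H))"
    if C: "C \<in> carrier Q" and g: "g \<in> C" for C g F H
  proof -
    define e where "e = ind_coc z C"
    have gG: "g \<in> carrier G" by (rule coset_in_G[OF C g])
    have e: "e \<in> carrier \<Theta>" and zg: "z g \<in> carrier \<Theta>"
      using ind_coc(1)[OF z C] der.Z_closed[OF z gG] by (simp_all add: e_def)
    define D where "D = fps_deriv (\<rho>s C F) oo y_N"
    have D: "D = \<rho> g (fps_deriv F oo y_N) * jac C" by (simp add: D_def deriv_sharp[OF C g])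
    have "evs e = ind_val z g" using ind_coc(2)[OF z C g] by (simp add: e_def)
    then have "w * (e fps_X oo y_N) = w * z g y_N + \<rho> g w * \<rho> g \<zeta> - w * \<zeta>"
      using gG by (simp add: evs_eq_w[OF e] ind_val_def ev_eq_w[OF zg] delta_def \<zeta>_def rho_times)
    then have h: "w * z g y_N + \<rho> g w * \<rho> g \<zeta> = w * (e fps_X oo y_N) + w * \<zeta>"
      by (simp add: algebra_simps)
    have wD: "w * \<rho> g (fps_deriv F oo y_N) = D * \<rho> g w"
      by (subst rho_w[OF C g]) (simp add: D mult_ac)
    \<comment> \<open>The \<epsilon>-parts are compared after multiplication by w: semi-invariance
      (\<open>wD\<close>) brings out the common factor D, and \<open>h\<close> finishes the
      comparison. Then w is cancelled.\<close>
    have "w * (D * z g y_N + \<rho> g (fps_deriv F oo y_N) * \<rho> g \<zeta>)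
        = D * (w * z g y_N) + (w * \<rho> g (fps_deriv F oo y_N)) * \<rho> g \<zeta>" by (simp add: algebra_simps)
    also have "\<dots> = D * (w * z g y_N + \<rho> g w * \<rho> g \<zeta>)" by (simp add: wD algebra_simps)
    also have "\<dots> = w * (D * \<zeta> + D * (e fps_X oo y_N))" unfolding h by (simp add: algebra_simps)
    finally have "D * z g y_N + \<rho> g (fps_deriv F oo y_N) * \<rho> g \<zeta> = D * \<zeta> + D * (e fps_X oo y_N)"
      using w_nonzero by simp
    moreover have "e (\<rho>s C F) oo y_N = D * (e fps_X oo y_N)"
      using Der_eq_deriv[OF e, of "\<rho>s C F"] by (simp add: fps_compose_mult_distrib N.y_nth_0 D_def)
    moreover have "z g (\<rho>s C F oo y_N) = D * z g y_N"
      using Der_compose_y_N[OF zg] by (simp add: D_def)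
    moreover have "A g = aut_lift (\<rho> g) (z g)" using gG by (simp add: A_def cocycle_lift_eq)
    ultimately show ?thesis
      using gG by (simp add: from_eq sharp_compose[OF C g] fps_compose_add_distrib
          e_def[symmetric] D_def[symmetric] rho_add rho_times algebra_simps)
  qed
  show ?thesis
  proof (rule extensionalityI)
    fix C assume C: "C \<in> carrier Q"
    show "sharp G N (clift z) C = cocycle_lift Q \<rho>s (ind_coc z) C"
    proof
      fix f
      have "to_inv N A (A g (from_inv N A f)) = aut_lift (\<rho>s C) (ind_coc z C) f" if "g \<in> C" for g
        using key[OF C that, of "re f" "im f"] by (simp add: to_from aut_lift_def)
      then have "(THE f'. \<forall>g\<in>C. f' = to_inv N A (A g (from_inv N A f))) = aut_lift (\<rho>s C) (ind_coc z C) f"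
        using coset_nonempty[OF C] by (intro the_equality) auto
      then show "sharp G N (clift z) C f = cocycle_lift Q \<rho>s (ind_coc z) C f"
        using C by (simp add: sharp_def cocycle_lift_eq A_def)
    qed
  qed (auto simp: sharp_def cocycle_lift_def)
qed

abbreviation "clsG \<equiv> H1_class G \<Theta> (der_act \<rho>)"
abbreviation "clsN \<equiv> H1_class (G\<lparr>carrier := N\<rparr>) \<Theta> (der_act \<rho>)"
abbreviation "clsQ \<equiv> H1_class Q \<Theta> (der_act \<rho>s)"

lemma H1N_carrier:
  "carrier (HN) = {X \<in> carrier (H1 (G\<lparr>carrier := N\<rparr>) \<Theta> (der_act \<rho>)). \<forall>g\<in>carrier G. act_H1 G N (der_act \<rho>) g X = X}"
  unfolding H1N_def by (rule der.invariants_H1[OF normal_N])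

lemma restrict_cls_in_H1N: "z \<in> der.Z \<Longrightarrow> clsN (restrict z N) \<in> carrier (HN)"
  using der.act_H1_restrict[OF normal_N] N.der.cls_in_H1 restrict_in_Z by (auto simp: H1N_carrier)

lemma res_map_tangent:
  assumes z: "z \<in> der.Z"
  shows "res_map G N \<rho> dn_re (tangent_id G \<rho> (clsG z)) = tangent_id (G\<lparr>carrier := N\<rparr>) \<rho> (clsN (restrict z N))"
  unfolding res_map_def tangent_id_cls[OF z]
proof (rule N.lift_class_eq_tangent_id(1)[OF restrict_in_Z[OF z]])
  show "(\<lambda>\<rho>\<^sub>A. restrict \<rho>\<^sub>A N) ` clift ` clsG z \<noteq> {}"
    using der.self_mem_cls[OF z] by blast
  show "(\<lambda>\<rho>\<^sub>A. restrict \<rho>\<^sub>A N) ` clift ` clsG z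
      \<subseteq> cocycle_lift (G\<lparr>carrier := N\<rparr>) \<rho> ` clsN (restrict z N)"
  proof (clarify, rule image_eqI)
    fix y assume "y \<in> clsG z"
    then obtain m where m: "m \<in> carrier \<Theta>" "y = (\<lambda>g\<in>carrier G. der_act \<rho> g m \<otimes>\<^bsub>\<Theta>\<^esub> inv\<^bsub>\<Theta>\<^esub> m \<otimes>\<^bsub>\<Theta>\<^esub> z g)"
      by (auto simp: der.mem_cls)
    show "restrict y N \<in> clsN (restrict z N)"
      unfolding N.der.mem_cls by (rule bexI[OF _ m(1)]) (auto simp: m(2) N_in_G)
    show "restrict (clift y) N = cocycle_lift (G\<lparr>carrier := N\<rparr>) \<rho> (restrict y N)"
      by (rule extensionalityI[of _ N]) (auto simp: cocycle_lift_eq N_in_G, simp add: cocycle_lift_def)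
  qed
qed

lemma ind_map_tangent:
  assumes z: "z \<in> der.Z"
  shows "ind_map G N \<rho> dn_re (tangent_id G \<rho> (clsG z)) = tangent_id Q \<rho>s (clsQ (ind_coc z))"
  unfolding ind_map_def tangent_id_cls[OF z]
proof (rule Q.lift_class_eq_tangent_id(1)[OF ind_coc_Z[OF z]])
  show "sharp G N ` clift ` clsG z \<noteq> {}"
    using der.self_mem_cls[OF z] by blast
  show "sharp G N ` clift ` clsG z \<subseteq> cocycle_lift Q \<rho>s ` clsQ (ind_coc z)"
  proof clarify
    fix y assume y: "y \<in> clsG z"
    then obtain m where m: "m \<in> carrier \<Theta>" "y = (\<lambda>g\<in>carrier G. der_act \<rho> g m \<otimes>\<^bsub>\<Theta>\<^esub> inv\<^bsub>\<Theta>\<^esub> m \<otimes>\<^bsub>\<Theta>\<^esub> z g)"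
      by (auto simp: der.mem_cls)
    have yZ: "y \<in> der.Z" by (rule der.mem_cls_in_Z[OF z y])
    have ev_y: "evG (y g) = \<rho> g (evG m) - evG m + evG (z g)" if "g \<in> carrier G" for g
      using that m by (simp add: ev_add ev_rho ev_inv)
    \<comment> \<open>The difference of the two induced values at g is g s - s. Both values vanish
      on N, so s is N-invariant, although \<open>delta y\<close> and \<open>delta z\<close> come
      from unrelated norms.\<close>
    define s where "s = evG m + delta y - delta z"
    have "\<rho> n s = s" if n: "n \<in> N" for n
    proof -
      have "\<rho> n s = \<rho> n (evG m) + \<rho> n (delta y) - \<rho> n (delta z)"
        using N_in_G[OF n] by (simp add: s_def rho_add rho_diff)
      also have "\<dots> = s"
        using ind_val_N[OF yZ n] ind_val_N[OF z n] ev_y[OF N_in_G[OF n]]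
        unfolding ind_val_def s_def by algebra
      finally show ?thesis .
    qed
    moreover have "w dvd s"
      unfolding s_def delta_def using w_dvd_v[OF v_dvd_ev[OF m(1)]] by (intro dvd_add dvd_diff) auto
    ultimately obtain d where d: "d \<in> carrier \<Theta>" "evs d = s"
      using obtain_evs[of s] by (auto simp: fps_inv_def)
    have "\<forall>C\<in>carrier Q. ind_coc y C = der_act \<rho>s C d \<otimes>\<^bsub>\<Theta>\<^esub> inv\<^bsub>\<Theta>\<^esub> d \<otimes>\<^bsub>\<Theta>\<^esub> ind_coc z C"
    proof
      fix C assume C: "C \<in> carrier Q"
      obtain g where g: "g \<in> carrier G" "g \<in> C" using coset_nonempty[OF C] by auto
      show "ind_coc y C = der_act \<rho>s C d \<otimes>\<^bsub>\<Theta>\<^esub> inv\<^bsub>\<Theta>\<^esub> d \<otimes>\<^bsub>\<Theta>\<^esub> ind_coc z C"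
      proof (rule inj_onD[OF evs_inj])
        show "evs (ind_coc y C) = evs (der_act \<rho>s C d \<otimes>\<^bsub>\<Theta>\<^esub> inv\<^bsub>\<Theta>\<^esub> d \<otimes>\<^bsub>\<Theta>\<^esub> ind_coc z C)"
          using g d(1) ev_y[OF g(1)]
          by (simp add: evs_add evs_inv evs_rho[OF C g(2)] ind_coc(2)[OF z C g(2)] ind_coc(2)[OF yZ C g(2)]
              d(2) ind_val_def s_def rho_add rho_diff algebra_simps)
      qed (use ind_coc(1)[OF z C] ind_coc(1)[OF yZ C] d(1) C Q.der.act_closed in auto)
    qed
    then have "clsQ (ind_coc y) = clsQ (ind_coc z)"
      using d(1) by (subst Q.der.cls_eq_iff[OF ind_coc_Z[OF yZ] ind_coc_Z[OF z]]) auto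
    then have "ind_coc y \<in> clsQ (ind_coc z)" using Q.der.self_mem_cls[OF ind_coc_Z[OF yZ]] by simp
    then show "sharp G N (clift y) \<in> cocycle_lift Q \<rho>s ` clsQ (ind_coc z)"
      by (simp add: sharp_cocycle_lift[OF yZ])
  qed
qed

text \<open>Eliminates lifts: injectivity of \<open>tangent_id\<close> resolves
  \<open>inv_into\<close>, and afterwards the tangent map is handled on cocycles only.\<close>

lemma Phi_tangent_cls:
  assumes z: "z \<in> der.Z"
  shows "\<Phi> (clsG z) = (clsN (restrict z N), clsQ (ind_coc z))"
proof -
  have "inj_on (map_prod (tangent_id (subgrp G N) \<rho>) (tangent_id Q \<rho>s)) (carrier (HN) \<times> carrier (HQ))"
    by (intro map_prod_inj_on inj_on_subset[OF N.tangent_id_inj])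
      (auto simp: H1N_carrier H1sharp_def intro: Q.tangent_id_inj)
  moreover have "(clsN (restrict z N), clsQ (ind_coc z)) \<in> carrier (HN) \<times> carrier (HQ)"
    using restrict_cls_in_H1N[OF z] Q.der.cls_in_H1[OF ind_coc_Z[OF z]] by (simp add: H1sharp_def)
  moreover have "Phi G N \<rho> dn_re (tangent_id G \<rho> (clsG z))
      = map_prod (tangent_id (subgrp G N) \<rho>) (tangent_id Q \<rho>s) (clsN (restrict z N), clsQ (ind_coc z))"
    by (simp add: Phi_def res_map_tangent[OF z] ind_map_tangent[OF z])
  ultimately show ?thesis unfolding Phi_tangent_def by (simp only: inv_into_f_f)
qed

subsection \<open>The maps \<open>\<sigma>\<close> and \<open>\<gamma>\<close>\<close>

abbreviation "clsQs \<equiv> H1_class Q (Ms) (acts)"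

lemma sigma_map_cls:
  assumes b: "b \<in> Q.der.Z"
  shows "(\<lambda>C\<in>carrier Q. prs (b C)) \<in> qs.Z"
    and "\<sigma> (clsQ b) = clsQs (\<lambda>C\<in>carrier Q. prs (b C))"
  unfolding sigma_map_def
  using H1_map_cls[OF Q.gmodule_Der qs.gmodule_axioms _ _ Qs_proj_hom _ b, of "\<lambda>C. C"]
  by (simp_all add: Qs_act_proj)

lemma Q2_to_H1_proj:
  assumes x: "w dvd x" "\<And>n. n \<in> N \<Longrightarrow> v dvd \<rho> n x - x"
    and y: "y \<in> N \<rightarrow>\<^sub>E carrier \<Theta>" "\<And>n. n \<in> N \<Longrightarrow> evG (y n) = \<rho> n x - x"
  shows "y \<in> N.der.Z" "p2H (pr2 x) = clsN y"
proof -
  have hom: "evG \<in> hom \<Theta> Th1"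
    by (auto simp: hom_def Th1_carrier ev_add w_dvd_v v_dvd_ev)
  have p: "pr2 m' = pr2 x \<longleftrightarrow> (\<exists>d\<in>carrier \<Theta>. m' = evG d \<otimes>\<^bsub>Th1\<^esub> x)"
    if "m' \<in> carrier Th1" for m'
  proof -
    have "v dvd m' - x \<longleftrightarrow> m' - x \<in> evG ` carrier \<Theta>" by (simp add: ev_image)
    also have "\<dots> \<longleftrightarrow> (\<exists>d\<in>carrier \<Theta>. m' = evG d \<otimes>\<^bsub>Th1\<^esub> x)" by (auto simp: image_iff algebra_simps)
    finally show ?thesis using that x by (simp add: Q2_proj_eq_iff Th1_carrier)
  qed
  note c = connecting_eq[OF N.gmodule_Der th1N.gmodule_axioms hom ev_inj _ _ p, of y]
  show "y \<in> N.der.Z" "p2H (pr2 x) = clsN y"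
    unfolding Q2_to_H1_def using c x y N_in_G by (simp_all add: ev_rho Th1_carrier Th1_inv)
qed

lemma Q1_carrier': "carrier (M1) = (\<lambda>d. pr1 (evs d)) ` carrier \<Theta>"
  by (simp add: Q1_carrier evs_image[symmetric] image_image)

lemma Q1_to_Q2_hom: "j12 \<in> hom (M1) (M2)"
proof (rule homI)
  fix X Y assume "X \<in> carrier (M1)" "Y \<in> carrier (M1)"
  then obtain x y where x: "x \<in> S" "w dvd x" "X = pr1 x" and y: "y \<in> S" "w dvd y" "Y = pr1 y"
    by (auto simp: Q1_carrier)
  have "x \<in> {x. w dvd x \<and> (\<forall>n\<in>N. v dvd \<rho> n x - x)}" using x by (auto simp: fps_inv_def)
  then show "j12 X \<in> carrier (M2)"
    using x by (auto simp: Q1_to_Q2_proj Q2_carrier)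
  show "j12 (X \<otimes>\<^bsub>M1\<^esub> Y) = j12 X \<otimes>\<^bsub>M2\<^esub> j12 Y"
    using x y by (simp add: Q1_proj_add Q1_to_Q2_proj Q2_proj_add fps_inv_add[OF N.subset])
qed

lemma Q1_to_Q2_inj: "inj_on (j12) (carrier (M1))"
proof (rule inj_onI)
  fix X Y assume "X \<in> carrier (M1)" "Y \<in> carrier (M1)"
    and eq: "j12 X = j12 Y"
  then obtain x y where x: "x \<in> S" "w dvd x" "X = pr1 x" and y: "y \<in> S" "w dvd y" "Y = pr1 y"
    by (auto simp: Q1_carrier)
  then show "X = Y" using eq by (simp add: Q1_to_Q2_proj Q1_proj_eq_iff Q2_proj_eq_iff)
qed

lemma Q1_to_Qs_hom: "j1s \<in> hom (M1) (Ms)"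
proof (rule homI)
  fix X Y assume "X \<in> carrier (M1)" "Y \<in> carrier (M1)"
  then obtain d e where d: "d \<in> carrier \<Theta>" "X = pr1 (evs d)" and e: "e \<in> carrier \<Theta>" "Y = pr1 (evs e)"
    by (auto simp: Q1_carrier')
  show "j1s X \<in> carrier (Ms)"
    using d by (simp add: Q1_to_Qs_proj Qs_carrier)
  have "X \<otimes>\<^bsub>M1\<^esub> Y = pr1 (evs (d \<otimes>\<^bsub>\<Theta>\<^esub> e))"
    using d e by (simp add: Q1_proj_add evs_in evs_add)
  then show "j1s (X \<otimes>\<^bsub>M1\<^esub> Y) = j1s X \<otimes>\<^bsub>Ms\<^esub> j1s Y"
    using d e hom_mult[OF Qs_proj_hom d(1) e(1)] by (simp add: Q1_to_Qs_proj)
qed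

text \<open>Here x is any primitive of the cocycle in \<Theta>_1, and \<open>e C\<close> any
  derivation whose value is congruent to x - g x modulo v. The connecting map yields the class of -
  e, and the sign in \<gamma> turns it into e.\<close>

lemma gamma_map_cls:
  assumes y: "y \<in> N.der.Z"
    and x: "w dvd x" "\<And>n. n \<in> N \<Longrightarrow> evG (y n) = \<rho> n x - x"
    and e: "\<And>C. C \<in> carrier Q \<Longrightarrow> e C \<in> carrier \<Theta>"
      "\<And>C. C \<in> carrier Q \<Longrightarrow> v dvd evs (e C) + (\<rho> (rep C) x - x)"
  shows "(\<lambda>C\<in>carrier Q. prs (e C)) \<in> qs.Z"
    and "\<gamma> (clsN y) = clsQs (\<lambda>C\<in>carrier Q. prs (e C))"
proof -
  have xv: "v dvd \<rho> n x - x" if "n \<in> N" for n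
    using x(2)[OF that] v_dvd_ev N.der.Z_closed[OF y that] by metis
  have yE: "y \<in> N \<rightarrow>\<^sub>E carrier \<Theta>" using N.der.Z_iff y by blast
  have m: "p2H (pr2 x) = clsN y" by (rule Q2_to_H1_proj(2)[OF x(1) xv yE x(2)])
  have mQ2: "pr2 x \<in> carrier (M2)" using x(1) xv by (auto simp: Q2_carrier)
  \<comment> \<open>Exactness in the middle: two primitives define the same class iff their
    difference becomes N-invariant after subtracting an element of \<Theta>.\<close>
  have p: "p2H m' = p2H (pr2 x)
      \<longleftrightarrow> (\<exists>u\<in>carrier (M1). m' = j12 u \<otimes>\<^bsub>M2\<^esub> pr2 x)"
    if m': "m' \<in> carrier (M2)" for m'
  proof -
    obtain x' where x': "w dvd x'" "\<And>n. n \<in> N \<Longrightarrow> v dvd \<rho> n x' - x'" "m' = pr2 x'"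
      using m' by (auto simp: Q2_carrier)
    define y' where "y' = (\<lambda>n\<in>N. inv_into (carrier \<Theta>) evG (\<rho> n x' - x'))"
    have y': "y' \<in> N \<rightarrow>\<^sub>E carrier \<Theta>" "\<And>n. n \<in> N \<Longrightarrow> evG (y' n) = \<rho> n x' - x'"
      using inv_into_ev[OF x'(2)] by (auto simp: y'_def)
    have c': "y' \<in> N.der.Z" "p2H (pr2 x') = clsN y'"
      by (rule Q2_to_H1_proj[OF x'(1,2) y'], assumption+)+
    have "clsN y' = clsN y \<longleftrightarrow> (\<exists>d\<in>carrier \<Theta>. \<forall>n\<in>N. evG (y' n) = evG (der_act \<rho> n d \<otimes>\<^bsub>\<Theta>\<^esub> inv\<^bsub>\<Theta>\<^esub> d \<otimes>\<^bsub>\<Theta>\<^esub> y n))"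
      unfolding N.der.cls_eq_iff[OF c'(1) y]
      using N.der.Z_closed[OF c'(1)] N.der.Z_closed[OF y] N.der.act_closed
      by (intro bex_cong ball_cong refl) (simp add: inj_on_eq_iff[OF ev_inj])
    also have "\<dots> \<longleftrightarrow> (\<exists>d\<in>carrier \<Theta>. x' - x - evG d \<in> S)"
      using N_in_G
      by (intro bex_cong refl) (auto simp: fps_inv_def y'(2) x(2) ev_add ev_inv ev_rho rho_diff rho_add algebra_simps)
    also have "\<dots> \<longleftrightarrow> (\<exists>q\<in>S. w dvd q \<and> v dvd x' - (q + x))"
    proof
      assume "\<exists>d\<in>carrier \<Theta>. x' - x - evG d \<in> S"
      then obtain d where d: "d \<in> carrier \<Theta>" "x' - x - evG d \<in> S" by blast
      then have "w dvd x' - x - evG d" using x(1) x'(1) w_dvd_v[OF v_dvd_ev[OF d(1)]] by (simp add: dvd_diff)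
      then show "\<exists>q\<in>S. w dvd q \<and> v dvd x' - (q + x)" using d v_dvd_ev by (intro bexI[OF _ d(2)]) simp
    next
      assume "\<exists>q\<in>S. w dvd q \<and> v dvd x' - (q + x)"
      then obtain q where q: "q \<in> S" "v dvd x' - (q + x)" by blast
      obtain d where d: "d \<in> carrier \<Theta>" "evG d = x' - (q + x)" using obtain_ev[OF q(2)] .
      have e: "x' - x - evG d = q" using d(2) by simp
      show "\<exists>d\<in>carrier \<Theta>. x' - x - evG d \<in> S" by (rule bexI[OF _ d(1)]) (simp only: e q(1))
    qed
    also have "\<dots> \<longleftrightarrow> (\<exists>u\<in>carrier (M1). m' = j12 u \<otimes>\<^bsub>M2\<^esub> pr2 x)"
      using x(1) x' by (auto simp: Q1_carrier Q1_to_Q2_proj Q2_proj_add Q2_proj_eq_iff)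
    finally show ?thesis by (simp add: c'(2) m x'(3))
  qed
  have eq: "j12 (act1 C X) = act2 C (j12 X)"
    if C: "C \<in> carrier Q" and X: "X \<in> carrier (M1)" for C X
  proof -
    obtain g where g: "g \<in> carrier G" "g \<in> C" using coset_nonempty[OF C] by auto
    obtain q where q: "q \<in> S" "w dvd q" "X = pr1 q" using X by (auto simp: Q1_carrier)
    have "v dvd \<rho> n q - q" if "n \<in> N" for n using q that by (simp add: fps_inv_def)
    then show ?thesis
      using q g by (simp add: Q1_act_proj[OF C g(2)] Q1_to_Q2_proj Q2_act_proj[OF C g(2)] rho_fps_inv w_dvd_rho)
  qed
  \<comment> \<open>Negated because the values of \<open>e\<close> represent minus the coboundary of
    x.\<close>
  define z where "z = (\<lambda>C\<in>carrier Q. pr1 (evs (inv\<^bsub>\<Theta>\<^esub> (e C))))"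
  have zE: "z \<in> carrier Q \<rightarrow>\<^sub>E carrier (M1)" using e(1) by (auto simp: z_def Q1_carrier')
  have iz: "j12 (z C) = act2 C (pr2 x) \<otimes>\<^bsub>M2\<^esub> inv\<^bsub>M2\<^esub> (pr2 x)"
    if C: "C \<in> carrier Q" for C
  proof -
    have eqd: "- evs (e C) - (\<rho> (rep C) x + - x) = - (evs (e C) + (\<rho> (rep C) x - x))" by simp
    have "v dvd - evs (e C) - (\<rho> (rep C) x + - x)"
      unfolding eqd dvd_minus_iff by (rule e(2)[OF C])
    then have "pr2 (- evs (e C)) = pr2 (\<rho> (rep C) x + - x)"
      using evs_in(2)[OF e(1)[OF C]] x(1) w_dvd_rho[OF rep_in_G[OF C] x(1)]
      by (subst Q2_proj_eq_iff) simp_all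
    then show ?thesis
      using C x(1) xv w_dvd_rho[OF rep_in_G[OF C] x(1)] evs_in[OF e(1)[OF C]]
      by (simp add: z_def Q1_to_Q2_proj evs_inv e(1) fps_inv_minus Q2_act_proj[OF C rep_mem[OF C]] Q2_inv Q2_proj_add)
  qed
  have zZ: "z \<in> q1.Z"
    and con: "connecting Q (M1) (act1) (M2) (act2) (j12) (p2H)
      (p2H (pr2 x)) = H1_class Q (M1) (act1) z"
    by (rule connecting_eq[OF q1.gmodule_axioms q2.gmodule_axioms Q1_to_Q2_hom Q1_to_Q2_inj,
          where p = "p2H" and m = "pr2 x"];
        fact eq mQ2 p zE iz)+
  have eqs: "j1s (act1 C X) = acts C (j1s X)"
    if C: "C \<in> carrier Q" and X: "X \<in> carrier (M1)" for C X
  proof -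
    obtain g where g: "g \<in> carrier G" "g \<in> C" using coset_nonempty[OF C] by auto
    obtain d where d: "d \<in> carrier \<Theta>" "X = pr1 (evs d)" using X by (auto simp: Q1_carrier')
    have "act1 C X = pr1 (evs (der_act \<rho>s C d))"
      using d by (simp add: Q1_act_proj[OF C g(2)] evs_in evs_rho[OF C g(2)])
    then show ?thesis using d C by (simp add: Q1_to_Qs_proj Q.der.act_closed Qs_act_proj)
  qed
  define z' where "z' = (\<lambda>C\<in>carrier Q. prs (inv\<^bsub>\<Theta>\<^esub> (e C)))"
  have z'_eq: "(\<lambda>C\<in>carrier Q. j1s (z C)) = z'"
    unfolding z'_def by (rule restrict_ext) (simp add: z_def Q1_to_Qs_proj e(1))
  have z'Z: "z' \<in> qs.Z"
    and H: "H1_map Q (Ms) (acts) (\<lambda>C. C) (j1s) (H1_class Q (M1) (act1) z) = clsQs z'"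
    using H1_map_cls[OF q1.gmodule_axioms qs.gmodule_axioms _ _ Q1_to_Qs_hom _ zZ, of "\<lambda>C. C"]
    by (simp_all add: eqs z'_eq)
  have inv_z': "(\<lambda>C\<in>carrier Q. inv\<^bsub>Ms\<^esub> (z' C)) = (\<lambda>C\<in>carrier Q. prs (e C))"
  proof (rule restrict_ext)
    fix C assume C: "C \<in> carrier Q"
    have "group_hom \<Theta> (Ms) (prs)"
      by (simp add: group_hom_def group_hom_axioms_def Qs_proj_hom der.M.group_axioms qs.M.group_axioms)
    then show "inv\<^bsub>Ms\<^esub> (z' C) = prs (e C)"
      using C e(1)[OF C] group_hom.hom_inv[of \<Theta> "Ms" "prs" "inv\<^bsub>\<Theta>\<^esub> (e C)"] by (simp add: z'_def)
  qed
  show "(\<lambda>C\<in>carrier Q. prs (e C)) \<in> qs.Z"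
    using qs.Z_inv[OF z'Z] by (simp only: inv_z')
  show "\<gamma> (clsN y) = clsQs (\<lambda>C\<in>carrier Q. prs (e C))"
    unfolding gamma_map_def con[unfolded m] H using qs.H1_inv[OF z'Z] by (simp only: inv_z')
qed

end

context normal_fps_action
begin

subsection \<open>The image\<close>

text \<open>Invariance of the class under r says that r x - x has the same coboundary on N as some m
  in \<Theta>. Their difference is N-invariant and divisible by w, hence the value of a derivation
  of k[[t]]^N.\<close>

lemma gamma_lift_exists:
  assumes y: "y \<in> N.der.Z" and inv: "clsN y \<in> carrier (HN)"
    and x: "w dvd x" "\<And>n. n \<in> N \<Longrightarrow> evG (y n) = \<rho> n x - x"
    and C: "C \<in> carrier Q"
  shows "\<exists>e\<in>carrier \<Theta>. v dvd evs e + (\<rho> (rep C) x - x)"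
proof -
  define r where "r = rep C"
  have r: "r \<in> carrier G" using rep_in_G[OF C] by (simp add: r_def)
  have conj: "inv r \<otimes> n \<otimes> r \<in> N" if "n \<in> N" for n using N.inv_op_closed1[OF r that] .
  have "clsN (\<lambda>n\<in>N. der_act \<rho> r (y (inv r \<otimes> n \<otimes> r))) = clsN y"
    using der.act_H1_cls(2)[OF normal_N y r] inv r by (simp add: H1N_carrier)
  then obtain m where m: "m \<in> carrier \<Theta>"
    "\<And>n. n \<in> N \<Longrightarrow> der_act \<rho> r (y (inv r \<otimes> n \<otimes> r)) = der_act \<rho> n m \<otimes>\<^bsub>\<Theta>\<^esub> inv\<^bsub>\<Theta>\<^esub> m \<otimes>\<^bsub>\<Theta>\<^esub> y n"
    using N.der.cls_eq_iff[OF der.act_H1_cls(1)[OF normal_N y r] y] by auto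
  have "\<rho> n (\<rho> r x - x - evG m) = \<rho> r x - x - evG m" if n: "n \<in> N" for n
  proof -
    have nG: "n \<in> carrier G" by (rule N_in_G[OF n])
    have "\<rho> r (evG (y (inv r \<otimes> n \<otimes> r))) = \<rho> n (evG m) - evG m + (\<rho> n x - x)"
      using arg_cong[OF m(2)[OF n], of evG] r nG m(1) x(2)[OF n] by (simp add: ev_rho ev_add ev_inv)
    moreover have "\<rho> r (evG (y (inv r \<otimes> n \<otimes> r))) = \<rho> n (\<rho> r x) - \<rho> r x"
      using x(2)[OF conj[OF n]] r nG by (simp add: rho_diff rho_mult[symmetric] m_assoc[symmetric])
    ultimately have "\<rho> n (\<rho> r x) - \<rho> r x = \<rho> n (evG m) - evG m + (\<rho> n x - x)" by simp
    moreover have "\<rho> n (\<rho> r x - x - evG m) = \<rho> n (\<rho> r x) - \<rho> n x - \<rho> n (evG m)"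
      using nG by (simp add: rho_diff)
    ultimately show ?thesis by algebra
  qed
  moreover have "w dvd \<rho> r x - x - evG m"
    using x(1) w_dvd_rho[OF r x(1)] w_dvd_v[OF v_dvd_ev[OF m(1)]] by (simp add: dvd_diff)
  ultimately obtain d where d: "d \<in> carrier \<Theta>" "evs d = \<rho> r x - x - evG m"
    using obtain_evs[of "\<rho> r x - x - evG m"] by (auto simp: fps_inv_def)
  show ?thesis
  proof (rule bexI)
    show "inv\<^bsub>\<Theta>\<^esub> d \<in> carrier \<Theta>" using d(1) by simp
    have "evs (inv\<^bsub>\<Theta>\<^esub> d) + (\<rho> (rep C) x - x) = evG m"
      using d by (simp add: evs_inv r_def[symmetric])
    then show "v dvd evs (inv\<^bsub>\<Theta>\<^esub> d) + (\<rho> (rep C) x - x)" using v_dvd_ev[OF m(1)] by simp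
  qed
qed

text \<open>With the primitive - \<delta>, the family required by \<open>gamma_map_cls\<close> is
  \<open>ind_coc z\<close> itself: the expression to be divided by v is the value of z at the
  representative, an element of \<Theta>.\<close>

lemma Phi_tangent_in_fiber_product:
  assumes z: "z \<in> der.Z"
  shows "\<gamma> (clsN (restrict z N)) = \<sigma> (clsQ (ind_coc z))"
  unfolding sigma_map_cls(2)[OF ind_coc_Z[OF z]]
proof (rule gamma_map_cls(2)[OF restrict_in_Z[OF z], of "- delta z"])
  show "w dvd - delta z" by (simp add: delta_def)
  show "evG (restrict z N n) = \<rho> n (- delta z) - - delta z" if n: "n \<in> N" for n
  proof -
    have "evG (z n) = delta z - \<rho> n (delta z)"
      using ind_val_N[OF z n] by (simp add: ind_val_def eq_diff_eq)
    then show ?thesis using n N_in_G[OF n] by (simp add: rho_uminus)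
  qed
next
  fix C assume C: "C \<in> carrier Q"
  show "ind_coc z C \<in> carrier \<Theta>" by (rule ind_coc(1)[OF z C])
  have "evs (ind_coc z C) + (\<rho> (rep C) (- delta z) - - delta z) = evG (z (rep C))"
    using ind_coc(2)[OF z C rep_mem[OF C]] rep_in_G[OF C] by (simp add: ind_val_def rho_uminus)
  then show "v dvd evs (ind_coc z C) + (\<rho> (rep C) (- delta z) - - delta z)"
    using v_dvd_ev[OF der.Z_closed[OF z rep_in_G[OF C]]] by simp
qed

text \<open>Given compatible cocycles \<open>y\<close> and \<open>b\<close>, one can choose \<open>\<delta>\<close> with \<open>y = - d\<delta>\<close> on \<open>N\<close> such that
  \<open>g \<mapsto> b(g) - (g \<delta> - \<delta>)\<close> takes values in \<open>\<Theta>\<close>. This is a cocycle of \<open>G\<close> inducing both.\<close>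

lemma fiber_product_lifts:
  assumes y: "y \<in> N.der.Z" and inv: "clsN y \<in> carrier (HN)" and b: "b \<in> Q.der.Z"
    and eq: "\<gamma> (clsN y) = \<sigma> (clsQ b)"
  obtains z where "z \<in> der.Z" "clsN (restrict z N) = clsN y" "clsQ (ind_coc z) = clsQ b"
proof -
  define x where "x = - (w * N.zeta y)"
  have xw: "w dvd x" by (simp add: x_def)
  have xy: "evG (y n) = \<rho> n x - x" if n: "n \<in> N" for n
    using ev_cocycle_N[OF y n] N_in_G[OF n] by (simp add: x_def rho_uminus)
  define e where "e = (\<lambda>C. SOME e. e \<in> carrier \<Theta> \<and> v dvd evs e + (\<rho> (rep C) x - x))"
  have e: "e C \<in> carrier \<Theta>" "v dvd evs (e C) + (\<rho> (rep C) x - x)" if C: "C \<in> carrier Q" for C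
    using someI_ex[OF gamma_lift_exists[OF y inv xw xy C, unfolded Bex_def]] by (simp_all add: e_def)
  note gam = gamma_map_cls[OF y xw xy e]
  have "clsQs (\<lambda>C\<in>carrier Q. prs (e C)) = clsQs (\<lambda>C\<in>carrier Q. prs (b C))"
    using eq gam(2) sigma_map_cls(2)[OF b] by simp
  moreover have "(\<lambda>C\<in>carrier Q. prs (e C)) \<in> qs.Z" using gam(1) by simp
  ultimately obtain s where s: "s \<in> carrier \<Theta>"
    and se: "\<And>C. C \<in> carrier Q \<Longrightarrow> prs (e C) = acts C (prs s)
      \<otimes>\<^bsub>Ms\<^esub> inv\<^bsub>Ms\<^esub> (prs s) \<otimes>\<^bsub>Ms\<^esub> prs (b C)"
    using qs.cls_eq_iff[OF _ sigma_map_cls(1)[OF b]] by (auto simp: Qs_carrier)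
  interpret qp: group_hom \<Theta> "Ms" "prs"
    by (simp add: group_hom_def group_hom_axioms_def Qs_proj_hom der.M.group_axioms qs.M.group_axioms)
  have bC: "b C \<in> carrier \<Theta>" if "C \<in> carrier Q" for C by (rule Q.der.Z_closed[OF b that])
  have sb: "v dvd evs (e C) - (\<rho> (rep C) (evs s) - evs s + evs (b C))" if C: "C \<in> carrier Q" for C
  proof -
    have cl: "der_act \<rho>s C s \<otimes>\<^bsub>\<Theta>\<^esub> inv\<^bsub>\<Theta>\<^esub> s \<otimes>\<^bsub>\<Theta>\<^esub> b C \<in> carrier \<Theta>"
      using C s bC[OF C] by (simp add: Q.der.act_closed)
    have "prs (e C) = prs (der_act \<rho>s C s \<otimes>\<^bsub>\<Theta>\<^esub> inv\<^bsub>\<Theta>\<^esub> s \<otimes>\<^bsub>\<Theta>\<^esub> b C)"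
      using se[OF C] C s bC[OF C] by (simp add: Qs_act_proj Q.der.act_closed)
    then have "v dvd evs (e C) - evs (der_act \<rho>s C s \<otimes>\<^bsub>\<Theta>\<^esub> inv\<^bsub>\<Theta>\<^esub> s \<otimes>\<^bsub>\<Theta>\<^esub> b C)"
      using Qs_proj_eq_iff[OF e(1)[OF C] cl] by blast
    then show ?thesis using s by (simp add: evs_add evs_inv evs_rho[OF C rep_mem[OF C]])
  qed
  \<comment> \<open>- x already has the right coboundary on N, and subtracting the N-invariant
    \<open>evs s\<close> preserves it. The derivation s comes from the equality of classes modulo
    \<open>\<Theta>\<^sup>N\<close> and absorbs the coboundary between e and b.\<close>
  define \<delta> where "\<delta> = - (x + evs s)"
  define D where "D = (\<lambda>g. evs (b (N #> g)) - (\<rho> g \<delta> - \<delta>))"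
  have D_mult: "D (g \<otimes> h) = D g + \<rho> g (D h)" if g: "g \<in> carrier G" and h: "h \<in> carrier G" for g h
  proof -
    have "evs (b (N #> (g \<otimes> h))) = evs (b (N #> g)) + \<rho> g (evs (b (N #> h)))"
      using Q.der.Z_mult[OF b coset_in_Q[OF g] coset_in_Q[OF h]]
      by (simp add: coset_mult g h evs_add evs_rho[OF coset_in_Q[OF g] coset_mem[OF g]])
    then show ?thesis using g h by (simp add: D_def rho_mult rho_diff)
  qed
  have D_N: "D n = evG (y n)" if n: "n \<in> N" for n
  proof -
    have "N #> n = N" using coset_join2[OF N_in_G[OF n] N.subgroup_axioms n] .
    then have "evs (b (N #> n)) = 0" using Q.der.Z_one[OF b] by (simp add: evs_one)
    moreover have "\<rho> n (evs s) = evs s" using evs_in(1)[OF s] n by (simp add: fps_inv_def)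
    ultimately show ?thesis using xy[OF n] N_in_G[OF n] by (simp add: D_def \<delta>_def rho_uminus rho_add rho_diff)
  qed
  have D_rep: "v dvd D (rep C)" if C: "C \<in> carrier Q" for C
  proof -
    have "D (rep C) = (evs (e C) + (\<rho> (rep C) x - x)) - (evs (e C) - (\<rho> (rep C) (evs s) - evs s + evs (b C)))"
      using rep_in_G[OF C] coset_eq'[OF C rep_mem[OF C]] by (simp add: D_def \<delta>_def rho_uminus rho_add rho_diff)
    then show ?thesis using dvd_diff[OF e(2)[OF C] sb[OF C]] by simp
  qed
  \<comment> \<open>Divisibility is known at representatives and on N; the cocycle rule spreads it
    to g = n r.\<close>
  have D_v: "v dvd D g" if g: "g \<in> carrier G" for g
  proof -
    define r where "r = rep (N #> g)"
    have r: "r \<in> carrier G" "r \<in> N #> g"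
      using rep_in_G[OF coset_in_Q[OF g]] rep_mem[OF coset_in_Q[OF g]] by (simp_all add: r_def)
    have "N #> g = N #> r" using coset_eq'[OF coset_in_Q[OF g] r(2)] .
    then have "g \<in> N #> r" using coset_mem[OF g] by simp
    then obtain n where n: "n \<in> N" "g = n \<otimes> r" by (auto simp: r_coset_def)
    have "D g = evG (y n) + \<rho> n (D r)" using D_mult[OF N_in_G[OF n(1)] r(1)] D_N[OF n(1)] n(2) by simp
    moreover have "v dvd D r" using D_rep[OF coset_in_Q[OF g]] by (simp only: r_def)
    ultimately show ?thesis
      using v_dvd_ev[OF N.der.Z_closed[OF y n(1)]] v_dvd_rho[OF N_in_G[OF n(1)]] by (simp add: dvd_add)
  qed
  define z where "z = (\<lambda>g\<in>carrier G. inv_into (carrier \<Theta>) evG (D g))"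
  have zc: "z g \<in> carrier \<Theta>" "evG (z g) = D g" if "g \<in> carrier G" for g
    using inv_into_ev[OF D_v[OF that]] that by (simp_all add: z_def)
  have zZ: "z \<in> der.Z"
    unfolding der.Z_iff
  proof (intro conjI ballI)
    fix g h assume gh: "g \<in> carrier G" "h \<in> carrier G"
    show "z (g \<otimes> h) = z g \<otimes>\<^bsub>\<Theta>\<^esub> der_act \<rho> g (z h)"
      by (rule inj_onD[OF ev_inj])
        (use gh zc in \<open>simp_all add: D_mult ev_add ev_rho der.act_closed\<close>)
  qed (use zc in \<open>auto simp: z_def\<close>)
  have zy: "restrict z N = y"
  proof (rule N.der.Z_eqI[OF restrict_in_Z[OF zZ] y])
    fix n assume n: "n \<in> N"
    have "z n = y n"
      by (rule inj_onD[OF ev_inj]) (use n N_in_G zc D_N N.der.Z_closed[OF y] in simp_all)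
    then show "restrict z N n = y n" using n by simp
  qed
  \<comment> \<open>The cocycle z has its own \<open>delta z\<close>, which need not be the chosen
    \<delta>. Both have the same coboundary on N, so t is N-invariant and gives a coboundary for
    G/N.\<close>
  define t where "t = delta z - \<delta>"
  have "\<rho> n t = t" if n: "n \<in> N" for n
  proof -
    have nG: "n \<in> carrier G" by (rule N_in_G[OF n])
    have "evG (z n) + \<rho> n (delta z) - delta z = 0" using ind_val_N[OF zZ n] by (simp add: ind_val_def)
    moreover have "N #> n = N" using coset_join2[OF nG N.subgroup_axioms n] .
    then have "evs (b (N #> n)) = 0" using Q.der.Z_one[OF b] by (simp add: evs_one)
    then have "evG (z n) = - (\<rho> n \<delta> - \<delta>)" using zc(2)[OF nG] by (simp add: D_def)
    moreover have "\<rho> n t = \<rho> n (delta z) - \<rho> n \<delta>" using nG by (simp add: t_def rho_diff)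
    ultimately show ?thesis unfolding t_def by algebra
  qed
  moreover have "w dvd t"
    unfolding t_def \<delta>_def delta_def using xw evs_in(2)[OF s] by (intro dvd_diff) (auto simp: dvd_diff)
  ultimately obtain d where d: "d \<in> carrier \<Theta>" "evs d = t"
    using obtain_evs[of t] by (auto simp: fps_inv_def)
  have "ind_coc z C = der_act \<rho>s C d \<otimes>\<^bsub>\<Theta>\<^esub> inv\<^bsub>\<Theta>\<^esub> d \<otimes>\<^bsub>\<Theta>\<^esub> b C" if C: "C \<in> carrier Q" for C
  proof (rule inj_onD[OF evs_inj])
    have r: "rep C \<in> carrier G" "C = N #> rep C" using rep_in_G[OF C] coset_eq'[OF C rep_mem[OF C]] by auto
    have "evs (ind_coc z C) = D (rep C) + \<rho> (rep C) (delta z) - delta z"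
      using ind_coc(2)[OF zZ C rep_mem[OF C]] zc(2)[OF r(1)] by (simp add: ind_val_def)
    also have "\<dots> = \<rho> (rep C) t - t + evs (b C)"
      using r by (simp add: D_def t_def rho_diff)
    also have "\<dots> = evs (der_act \<rho>s C d \<otimes>\<^bsub>\<Theta>\<^esub> inv\<^bsub>\<Theta>\<^esub> d \<otimes>\<^bsub>\<Theta>\<^esub> b C)"
      using d by (simp add: evs_add evs_inv evs_rho[OF C rep_mem[OF C]])
    finally show "evs (ind_coc z C) = evs (der_act \<rho>s C d \<otimes>\<^bsub>\<Theta>\<^esub> inv\<^bsub>\<Theta>\<^esub> d \<otimes>\<^bsub>\<Theta>\<^esub> b C)" .
  qed (use ind_coc(1)[OF zZ C] d(1) C bC[OF C] Q.der.act_closed in auto)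
  then have "clsQ (ind_coc z) = clsQ b"
    using d(1) by (subst Q.der.cls_eq_iff[OF ind_coc_Z[OF zZ] b]) auto
  then show ?thesis using that[OF zZ] zy by simp
qed

lemma Phi_tangent_image:
  "\<Phi> ` carrier (HG) =
     {(a, b) \<in> carrier (HN) \<times> carrier (HQ). \<gamma> a = \<sigma> b}"
proof (intro equalityI subsetI)
  fix X assume "X \<in> \<Phi> ` carrier (HG)"
  then obtain z where z: "z \<in> der.Z" "X = (clsN (restrict z N), clsQ (ind_coc z))"
    by (auto simp: H1G_def der.carrier_H1 Phi_tangent_cls)
  then show "X \<in> {(a, b) \<in> carrier (HN) \<times> carrier (HQ). \<gamma> a = \<sigma> b}"
    using restrict_cls_in_H1N[OF z(1)] Q.der.cls_in_H1[OF ind_coc_Z[OF z(1)]] Phi_tangent_in_fiber_product[OF z(1)]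
    by (simp add: H1sharp_def)
next
  fix X assume "X \<in> {(a, b) \<in> carrier (HN) \<times> carrier (HQ). \<gamma> a = \<sigma> b}"
  then obtain y b where X: "X = (clsN y, clsQ b)" and y: "y \<in> N.der.Z" "clsN y \<in> carrier (HN)"
    and b: "b \<in> Q.der.Z" and eq: "\<gamma> (clsN y) = \<sigma> (clsQ b)"
    by (auto simp: H1N_carrier H1sharp_def N.der.carrier_H1 Q.der.carrier_H1)
  obtain z where z: "z \<in> der.Z" "clsN (restrict z N) = clsN y" "clsQ (ind_coc z) = clsQ b"
    using fiber_product_lifts[OF y b eq] .
  then have "X = \<Phi> (clsG z)" by (simp add: X Phi_tangent_cls)
  then show "X \<in> \<Phi> ` carrier (HG)"
    using z(1) by (auto simp: H1G_def der.carrier_H1)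
qed

subsection \<open>The kernel\<close>

text \<open>Representatives in \<open>\<Theta>\<^sub>1\<^sup>N\<close> of the G/N-invariant classes
  modulo \<open>\<Theta>\<^sup>N\<close>.\<close>

abbreviation "A1 \<equiv> {x \<in> S. w dvd x \<and> (\<forall>g\<in>carrier G. v dvd \<rho> g x - x)}"

definition conn_coc where "conn_coc x = (\<lambda>g\<in>carrier G. inv_into (carrier \<Theta>) evG (\<rho> g x - x))"

lemma conn_coc:
  assumes x: "x \<in> A1" and g: "g \<in> carrier G"
  shows "conn_coc x g \<in> carrier \<Theta>" "evG (conn_coc x g) = \<rho> g x - x"
  using inv_into_ev[of "\<rho> g x - x"] x g by (simp_all add: conn_coc_def)

lemma infl_connecting_proj:
  assumes x: "x \<in> A1"
  shows "conn_coc x \<in> der.Z" "infl (pr1 x) = clsG (conn_coc x)"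
proof -
  define z where "z = (\<lambda>C\<in>carrier Q. conn_coc x (rep C))"
  have xT: "x \<in> carrier (ThN)" using x by (simp add: Th1i_carrier)
  have hom: "evG \<in> hom (DerN) (ThN)"
    by (auto simp: hom_def Th1i_carrier Der_inv_iff w_dvd_v v_dvd_ev)
      (simp add: Der_inv_def invariants_def ev_add)
  have inj: "inj_on evG (carrier (DerN))"
    by (rule inj_on_subset[OF ev_inj]) (auto simp: Der_inv_iff)
  have eq: "evG (act_Mod (der_act \<rho>) C d) = act_Mod \<rho> C (evG d)"
    if C: "C \<in> carrier Q" and d: "d \<in> carrier (DerN)" for C d
  proof -
    obtain g where g: "g \<in> carrier G" "g \<in> C" using coset_nonempty[OF C] by auto
    have "evG d \<in> carrier (ThN)" using hom d by (auto simp: hom_def)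
    then show ?thesis using g by (simp add: act_Mod_Der_inv[OF C g(2) d] act_Mod_Th1i[OF C g(2)] ev_rho)
  qed
  have p: "pr1 m' = pr1 x
      \<longleftrightarrow> (\<exists>d\<in>carrier (DerN). m' = evG d \<otimes>\<^bsub>ThN\<^esub> x)"
    if m': "m' \<in> carrier (ThN)" for m'
  proof -
    have "m' - x \<in> S" using m' x by (simp add: Th1i_carrier fps_inv_diff)
    then have "v dvd m' - x \<longleftrightarrow> m' - x \<in> evG ` carrier (DerN)" by (simp add: ev_Der_inv)
    also have "\<dots> \<longleftrightarrow> (\<exists>d\<in>carrier (DerN). m' = evG d \<otimes>\<^bsub>ThN\<^esub> x)"
      by (auto simp: image_iff algebra_simps)
    finally show ?thesis using m' x by (simp add: Q1_proj_eq_iff Th1i_carrier)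
  qed
  have zE: "z \<in> carrier Q \<rightarrow>\<^sub>E carrier (DerN)"
    using conn_coc[OF x rep_in_G] x by (auto simp: z_def Der_inv_iff rho_fps_inv fps_inv_diff rep_in_G)
  have iz: "evG (z C) = act_Mod \<rho> C x \<otimes>\<^bsub>ThN\<^esub> inv\<^bsub>ThN\<^esub> x" if C: "C \<in> carrier Q" for C
    using conn_coc(2)[OF x rep_in_G[OF C]] C by (simp add: z_def Th1i_inv[OF xT] act_Mod_Th1i[OF C rep_mem[OF C] xT])
  have zZ: "z \<in> deri.Z"
    and con: "connecting Q (DerN) (act_Mod (der_act \<rho>)) (ThN) (act_Mod \<rho>) evG (pr1)
      (pr1 x) = H1_class Q (DerN) (act_Mod (der_act \<rho>)) z"
    by (rule connecting_eq[OF deri.gmodule_axioms th1i.gmodule_axioms hom inj, where p = "pr1" and m = x];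
        fact eq xT p zE iz)+
  \<comment> \<open>Inflation undoes the choice of representatives: x is N-invariant, so g x depends
    only on the coset of g.\<close>
  have zc: "(\<lambda>g\<in>carrier G. z (N #> g)) = conn_coc x"
  proof (rule extensionalityI[of _ "carrier G"])
    fix g assume g: "g \<in> carrier G"
    have "\<rho> (rep (N #> g)) x = \<rho> g x"
      using rho_coset[OF coset_in_Q[OF g] rep_mem[OF coset_in_Q[OF g]] coset_mem[OF g]] x by simp
    then show "(\<lambda>g\<in>carrier G. z (N #> g)) g = conn_coc x g"
      using g rep_in_G[OF coset_in_Q[OF g]] by (simp add: z_def coset_in_Q conn_coc_def)
  qed (auto simp: conn_coc_def)
  have idhom: "(\<lambda>d. d) \<in> hom (DerN) \<Theta>"
    by (auto simp: hom_def Der_inv_iff) (simp add: Der_inv_def invariants_def)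
  have act: "act_Mod (der_act \<rho>) (N #> g) d = der_act \<rho> g d" if "g \<in> carrier G" "d \<in> carrier (DerN)" for g d
    using that by (simp add: act_Mod_Der_inv coset_in_Q coset_mem)
  note H = H1_map_cls[OF deri.gmodule_axioms gmodule_Der _ _ idhom _ zZ, of "\<lambda>g. N #> g"]
  have "conn_coc x \<in> der.Z \<and> H1_map G \<Theta> (der_act \<rho>) (\<lambda>g. N #> g) (\<lambda>d. d)
      (H1_class Q (DerN) (act_Mod (der_act \<rho>)) z) = clsG (conn_coc x)"
    using H by (simp add: coset_in_Q coset_mult act zc)
  then show "conn_coc x \<in> der.Z" "infl (pr1 x) = clsG (conn_coc x)"
    by (simp_all add: infl_connecting_def con)
qed

abbreviation "Q1inv \<equiv> invariants Q (M1) (act1)"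

lemma Q1inv_carrier: "carrier Q1inv = pr1 ` A1"
proof -
  have *: "(\<forall>C\<in>carrier Q. act1 C (pr1 x) = pr1 x) \<longleftrightarrow> (\<forall>g\<in>carrier G. v dvd \<rho> g x - x)"
    if x: "x \<in> S" "w dvd x" for x
  proof -
    have "act1 (N #> g) (pr1 x) = pr1 x \<longleftrightarrow> v dvd \<rho> g x - x" if g: "g \<in> carrier G" for g
      using x g by (simp add: Q1_act_proj[OF coset_in_Q[OF g] coset_mem[OF g]] Q1_proj_eq_iff rho_fps_inv w_dvd_rho)
    then show ?thesis by (simp add: carrier_FactGroup)
  qed
  show ?thesis
  proof (intro equalityI subsetI)
    fix X assume X: "X \<in> carrier Q1inv"
    then obtain x where x: "x \<in> S" "w dvd x" "X = pr1 x" by (auto simp: invariants_def Q1_carrier)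
    then have "\<forall>g\<in>carrier G. v dvd \<rho> g x - x" using X *[OF x(1,2)] by (simp add: invariants_def)
    then show "X \<in> pr1 ` A1" using x by blast
  next
    fix X assume "X \<in> pr1 ` A1"
    then obtain x where "x \<in> A1" "X = pr1 x" by blast
    then show "X \<in> carrier Q1inv" using *[of x] by (simp add: invariants_def Q1_carrier)
  qed
qed

lemma A1_add: "x \<in> A1 \<Longrightarrow> y \<in> A1 \<Longrightarrow> x + y \<in> A1"
  by (auto simp: fps_inv_add[OF N.subset] rho_add add_diff_add)

lemma infl_connecting_hom: "group_hom Q1inv (HG) (infl)"
proof -
  have "comm_group Q1inv"
    using q1.comm_group_invariants[of "carrier Q"] by (simp add: invariants_def)
  moreover have "infl \<in> hom Q1inv (HG)"
  proof (rule homI)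
    fix X Y assume "X \<in> carrier Q1inv" "Y \<in> carrier Q1inv"
    then obtain x y where x: "x \<in> A1" "X = pr1 x" and y: "y \<in> A1" "Y = pr1 y"
      by (auto simp: Q1inv_carrier)
    note xc = infl_connecting_proj[OF x(1)] and yc = infl_connecting_proj[OF y(1)]
    note xyc = infl_connecting_proj[OF A1_add[OF x(1) y(1)]]
    show "infl X \<in> carrier (HG)"
      by (simp add: x(2) xc(2) H1G_def der.cls_in_H1 xc(1))
    have "(\<lambda>g\<in>carrier G. conn_coc x g \<otimes>\<^bsub>\<Theta>\<^esub> conn_coc y g) = conn_coc (x + y)"
    proof (rule der.Z_eqI[OF der.Z_times[OF xc(1) yc(1)] xyc(1)])
      fix g assume g: "g \<in> carrier G"
      have "conn_coc x g \<otimes>\<^bsub>\<Theta>\<^esub> conn_coc y g = conn_coc (x + y) g"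
        by (rule inj_onD[OF ev_inj])
          (use g conn_coc[OF x(1) g] conn_coc[OF y(1) g] conn_coc[OF A1_add[OF x(1) y(1)] g] in
            \<open>simp_all add: ev_add rho_add\<close>)
      then show "(\<lambda>g\<in>carrier G. conn_coc x g \<otimes>\<^bsub>\<Theta>\<^esub> conn_coc y g) g = conn_coc (x + y) g" using g by simp
    qed
    moreover have "X \<otimes>\<^bsub>Q1inv\<^esub> Y = pr1 (x + y)"
      using x y by (simp add: invariants_def Q1_proj_add)
    ultimately show "infl (X \<otimes>\<^bsub>Q1inv\<^esub> Y) = infl X \<otimes>\<^bsub>HG\<^esub> infl Y"
      by (simp add: x(2) y(2) xc(2) yc(2) xyc(2) H1G_def der.H1_mult[OF xc(1) yc(1)])
  qed
  ultimately show ?thesis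
    using der.comm_group_H1 by (simp add: group_hom_def group_hom_axioms_def comm_group.axioms(2) H1G_def)
qed

lemma clsG_conn_coc_eq_one:
  assumes x: "x \<in> A1"
  shows "clsG (conn_coc x) = \<one>\<^bsub>HG\<^esub> \<longleftrightarrow> (\<exists>d\<in>carrier \<Theta>. \<forall>g\<in>carrier G. \<rho> g (x - evG d) = x - evG d)"
proof -
  note Z = infl_connecting_proj(1)[OF x]
  have "clsG (conn_coc x) = \<one>\<^bsub>HG\<^esub>
      \<longleftrightarrow> (\<exists>d\<in>carrier \<Theta>. \<forall>g\<in>carrier G. evG (conn_coc x g) = evG (der_act \<rho> g d \<otimes>\<^bsub>\<Theta>\<^esub> inv\<^bsub>\<Theta>\<^esub> d))"
    unfolding H1G_def der.H1_one der.cls_eq_iff[OF Z der.Z_trivial]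
    using conn_coc(1)[OF x] der.act_closed
    by (intro bex_cong ball_cong refl) (simp add: inj_on_eq_iff[OF ev_inj])
  also have "\<dots> \<longleftrightarrow> (\<exists>d\<in>carrier \<Theta>. \<forall>g\<in>carrier G. \<rho> g (x - evG d) = x - evG d)"
    by (intro bex_cong ball_cong refl) (auto simp: conn_coc(2)[OF x] ev_add ev_inv ev_rho rho_diff algebra_simps)
  finally show ?thesis .
qed

text \<open>The class of g x - x vanishes iff x - d is G-invariant for some d in \<Theta>. Since x
  is N-invariant, so is d, and subtracting it does not change the class of x modulo
  \<open>\<Theta>\<^sup>N\<close>.\<close>

lemma kernel_infl_connecting:
  "kernel Q1inv (HG) (infl) = pr1 ` carrier (invariants G Th1 \<rho>)"
proof -
  have inv: "carrier (invariants G Th1 \<rho>) = {x. w dvd x \<and> (\<forall>g\<in>carrier G. \<rho> g x = x)}"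
    by (simp add: invariants_def Th1_carrier)
  show ?thesis
  proof (intro equalityI subsetI)
    fix X assume X: "X \<in> kernel Q1inv (HG) (infl)"
    then obtain x where x: "x \<in> A1" "X = pr1 x" by (auto simp: kernel_def Q1inv_carrier)
    then have "clsG (conn_coc x) = \<one>\<^bsub>HG\<^esub>" using X infl_connecting_proj(2)[OF x(1)] by (simp add: kernel_def)
    then obtain d where d: "d \<in> carrier \<Theta>" "\<And>g. g \<in> carrier G \<Longrightarrow> \<rho> g (x - evG d) = x - evG d"
      using clsG_conn_coc_eq_one[OF x(1)] by blast
    have w: "w dvd x - evG d" using x(1) w_dvd_v[OF v_dvd_ev[OF d(1)]] by (simp add: dvd_diff)
    have S: "x - evG d \<in> S" using d(2) N_in_G by (simp add: fps_inv_def)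
    have "X = pr1 (x - evG d)"
      using x w S v_dvd_ev[OF d(1)] by (simp add: Q1_proj_eq_iff)
    then show "X \<in> pr1 ` carrier (invariants G Th1 \<rho>)" using d(2) w by (auto simp: inv)
  next
    fix X assume "X \<in> pr1 ` carrier (invariants G Th1 \<rho>)"
    then obtain x where x: "w dvd x" "\<And>g. g \<in> carrier G \<Longrightarrow> \<rho> g x = x" "X = pr1 x" by (auto simp: inv)
    have A: "x \<in> A1" using x N_in_G by (auto simp: fps_inv_def)
    have "clsG (conn_coc x) = \<one>\<^bsub>HG\<^esub>"
      unfolding clsG_conn_coc_eq_one[OF A]
      by (rule bexI[OF _ der.M.one_closed]) (simp add: ev_one x(2))
    then show "X \<in> kernel Q1inv (HG) (infl)"
      using A x(3) by (auto simp: kernel_def Q1inv_carrier infl_connecting_proj(2))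
  qed
qed

lemma infl_connecting_image:
  "infl ` carrier Q1inv =
     kernel (HG) (HN \<times>\<times> HQ) (\<Phi>)"
proof -
  have one: "\<one>\<^bsub>HN\<^esub> = \<one>\<^bsub>H1 (G\<lparr>carrier := N\<rparr>) \<Theta> (der_act \<rho>)\<^esub>"
    "\<one>\<^bsub>HQ\<^esub> = \<one>\<^bsub>H1 Q \<Theta> (der_act \<rho>s)\<^esub>"
    by (simp_all add: H1N_def H1sharp_def invariants_def)
  have N1: "clsN (restrict z N) = \<one>\<^bsub>H1 (G\<lparr>carrier := N\<rparr>) \<Theta> (der_act \<rho>)\<^esub>
      \<longleftrightarrow> (\<exists>m\<in>carrier \<Theta>. \<forall>n\<in>N. evG (z n) = \<rho> n (evG m) - evG m)" if z: "z \<in> der.Z" for z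
  proof -
    have "clsN (restrict z N) = \<one>\<^bsub>H1 (G\<lparr>carrier := N\<rparr>) \<Theta> (der_act \<rho>)\<^esub>
        \<longleftrightarrow> (\<exists>m\<in>carrier \<Theta>. \<forall>n\<in>N. evG (z n) = evG (der_act \<rho> n m \<otimes>\<^bsub>\<Theta>\<^esub> inv\<^bsub>\<Theta>\<^esub> m))"
      unfolding N.der.H1_one N.der.cls_eq_iff[OF restrict_in_Z[OF z] N.der.Z_trivial]
      using der.Z_closed[OF z] N.der.act_closed N_in_G
      by (intro bex_cong ball_cong refl) (simp add: inj_on_eq_iff[OF ev_inj])
    also have "\<dots> \<longleftrightarrow> (\<exists>m\<in>carrier \<Theta>. \<forall>n\<in>N. evG (z n) = \<rho> n (evG m) - evG m)"
      using N_in_G by (intro bex_cong ball_cong refl) (simp add: ev_add ev_inv ev_rho)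
    finally show ?thesis .
  qed
  have Q1: "clsQ (ind_coc z) = \<one>\<^bsub>H1 Q \<Theta> (der_act \<rho>s)\<^esub>
      \<longleftrightarrow> (\<exists>s\<in>carrier \<Theta>. \<forall>g\<in>carrier G. ind_val z g = \<rho> g (evs s) - evs s)" if z: "z \<in> der.Z" for z
  proof -
    have "clsQ (ind_coc z) = \<one>\<^bsub>H1 Q \<Theta> (der_act \<rho>s)\<^esub>
        \<longleftrightarrow> (\<exists>s\<in>carrier \<Theta>. \<forall>C\<in>carrier Q. evs (ind_coc z C) = evs (der_act \<rho>s C s \<otimes>\<^bsub>\<Theta>\<^esub> inv\<^bsub>\<Theta>\<^esub> s))"
      unfolding Q.der.H1_one Q.der.cls_eq_iff[OF ind_coc_Z[OF z] Q.der.Z_trivial]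
      using ind_coc(1)[OF z] Q.der.act_closed
      by (intro bex_cong ball_cong refl) (simp add: inj_on_eq_iff[OF evs_inj])
    also have "\<dots> \<longleftrightarrow> (\<exists>s\<in>carrier \<Theta>. \<forall>g\<in>carrier G. ind_val z g = \<rho> g (evs s) - evs s)"
    proof (intro bex_cong refl)
      fix s :: "'c fps \<Rightarrow> 'c fps" assume s: "s \<in> carrier \<Theta>"
      have "evs (ind_coc z (N #> g)) = evs (der_act \<rho>s (N #> g) s \<otimes>\<^bsub>\<Theta>\<^esub> inv\<^bsub>\<Theta>\<^esub> s)
          \<longleftrightarrow> ind_val z g = \<rho> g (evs s) - evs s" if g: "g \<in> carrier G" for g
        using s by (simp add: ind_coc(2)[OF z coset_in_Q[OF g] coset_mem[OF g]] evs_add evs_inv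
            evs_rho[OF coset_in_Q[OF g] coset_mem[OF g]])
      then show "(\<forall>C\<in>carrier Q. evs (ind_coc z C) = evs (der_act \<rho>s C s \<otimes>\<^bsub>\<Theta>\<^esub> inv\<^bsub>\<Theta>\<^esub> s))
          \<longleftrightarrow> (\<forall>g\<in>carrier G. ind_val z g = \<rho> g (evs s) - evs s)"
        by (simp add: carrier_FactGroup)
    qed
    finally show ?thesis .
  qed
  show ?thesis
  proof (intro equalityI subsetI)
    fix c assume "c \<in> infl ` carrier Q1inv"
    then obtain x where x: "x \<in> A1" "c = clsG (conn_coc x)"
      by (auto simp: Q1inv_carrier infl_connecting_proj(2))
    define z where "z = conn_coc x"
    have z: "z \<in> der.Z" unfolding z_def by (rule infl_connecting_proj(1)[OF x(1)])
    have zx: "evG (z g) = \<rho> g x - x" if "g \<in> carrier G" for g using conn_coc(2)[OF x(1) that] by (simp add: z_def)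
    have z0: "evG (z n) = 0" if "n \<in> N" for n using zx[OF N_in_G[OF that]] x(1) that by (simp add: fps_inv_def)
    have "clsN (restrict z N) = \<one>\<^bsub>H1 (G\<lparr>carrier := N\<rparr>) \<Theta> (der_act \<rho>)\<^esub>"
      unfolding N1[OF z] using z0 N_in_G by (intro bexI[OF _ der.M.one_closed]) (simp add: ev_one rho_zero)
    moreover have "clsQ (ind_coc z) = \<one>\<^bsub>H1 Q \<Theta> (der_act \<rho>s)\<^esub>"
    proof -
      \<comment> \<open>As z vanishes on N, \<delta> is N-invariant, and so is x + \<delta>; the
        induced cocycle is its coboundary.\<close>
      have "\<rho> n (x + delta z) = x + delta z" if n: "n \<in> N" for n
      proof -
        have "\<rho> n (delta z) = delta z" using ind_val_N[OF z n] z0[OF n] by (simp add: ind_val_def)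
        moreover have "\<rho> n x = x" using x(1) n by (simp add: fps_inv_def)
        ultimately show ?thesis using N_in_G[OF n] by (simp add: rho_add)
      qed
      moreover have "w dvd x + delta z" using x(1) by (simp add: delta_def)
      ultimately obtain s where s: "s \<in> carrier \<Theta>" "evs s = x + delta z"
        using obtain_evs[of "x + delta z"] by (auto simp: fps_inv_def)
      show ?thesis unfolding Q1[OF z]
        by (rule bexI[OF _ s(1)]) (simp add: s(2) ind_val_def zx rho_add)
    qed
    ultimately show "c \<in> kernel (HG) (HN \<times>\<times> HQ) (\<Phi>)"
      using z by (simp add: kernel_def one x(2) z_def[symmetric] Phi_tangent_cls H1G_def der.cls_in_H1)
  next
    fix c assume c: "c \<in> kernel (HG) (HN \<times>\<times> HQ) (\<Phi>)"
    then obtain z where z: "z \<in> der.Z" "c = clsG z" by (auto simp: kernel_def H1G_def der.carrier_H1)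
    have "clsN (restrict z N) = \<one>\<^bsub>H1 (G\<lparr>carrier := N\<rparr>) \<Theta> (der_act \<rho>)\<^esub>" "clsQ (ind_coc z) = \<one>\<^bsub>H1 Q \<Theta> (der_act \<rho>s)\<^esub>"
      using c by (auto simp: kernel_def one z Phi_tangent_cls)
    then obtain m s where m: "m \<in> carrier \<Theta>" "\<And>n. n \<in> N \<Longrightarrow> evG (z n) = \<rho> n (evG m) - evG m"
      and s: "s \<in> carrier \<Theta>" "\<And>g. g \<in> carrier G \<Longrightarrow> ind_val z g = \<rho> g (evs s) - evs s"
      unfolding N1[OF z(1)] Q1[OF z(1)] by blast
    \<comment> \<open>Vanishing of the induced class makes \<open>evs s\<close> - \<delta> a
      primitive of z on all of G; subtracting the value of m, which is a primitive on N, leaves an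
      N-invariant element and changes z only by a coboundary of \<Theta>.\<close>
    define x where "x = evs s - delta z - evG m"
    have zx: "evG (z g) = \<rho> g (x + evG m) - (x + evG m)" if g: "g \<in> carrier G" for g
    proof -
      have "\<rho> g (x + evG m) = \<rho> g (evs s) - \<rho> g (delta z)" using g by (simp add: x_def rho_diff)
      then show ?thesis using s(2)[OF g] unfolding x_def ind_val_def by algebra
    qed
    have "\<rho> n x = x" if n: "n \<in> N" for n
      using zx[OF N_in_G[OF n]] m(2)[OF n] N_in_G[OF n] by (simp add: rho_add)
    then have xS: "x \<in> S" by (simp add: fps_inv_def)
    have xw: "w dvd x"
      unfolding x_def delta_def using evs_in(2)[OF s(1)] w_dvd_v[OF v_dvd_ev[OF m(1)]] by (intro dvd_diff) auto
    have xv: "\<rho> g x - x = evG (z g \<otimes>\<^bsub>\<Theta>\<^esub> inv\<^bsub>\<Theta>\<^esub> (der_act \<rho> g m) \<otimes>\<^bsub>\<Theta>\<^esub> m)" if g: "g \<in> carrier G" for g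
      using zx[OF g] g m(1) der.act_closed[OF g m(1)] by (simp add: ev_add ev_inv ev_rho rho_add)
    have "v dvd \<rho> g x - x" if g: "g \<in> carrier G" for g
      unfolding xv[OF g] using der.Z_closed[OF z(1) g] der.act_closed[OF g m(1)] m(1) by (intro v_dvd_ev) simp
    then have A: "x \<in> A1" using xS xw by simp
    have "z g = der_act \<rho> g m \<otimes>\<^bsub>\<Theta>\<^esub> inv\<^bsub>\<Theta>\<^esub> m \<otimes>\<^bsub>\<Theta>\<^esub> conn_coc x g" if g: "g \<in> carrier G" for g
    proof (rule inj_onD[OF ev_inj])
      show "evG (z g) = evG (der_act \<rho> g m \<otimes>\<^bsub>\<Theta>\<^esub> inv\<^bsub>\<Theta>\<^esub> m \<otimes>\<^bsub>\<Theta>\<^esub> conn_coc x g)"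
        using zx[OF g] g m(1) conn_coc(2)[OF A g] by (simp add: ev_add ev_inv ev_rho rho_add)
    qed (use der.Z_closed[OF z(1) g] der.act_closed[OF g m(1)] m(1) conn_coc(1)[OF A g] in simp_all)
    then have "clsG z = clsG (conn_coc x)"
      using m(1) by (subst der.cls_eq_iff[OF z(1) infl_connecting_proj(1)[OF A]]) auto
    then have "c = infl (pr1 x)"
      by (simp add: z(2) infl_connecting_proj(2)[OF A])
    then show "c \<in> infl ` carrier Q1inv"
      unfolding Q1inv_carrier using A by blast
  qed
qed

end

section \<open>The kernel as a cokernel, and the image as a fibered product\<close>

theorem corollary4p3:
  fixes G :: "('g, 'b) monoid_scheme" and N :: "'g set"
    and \<rho> :: "'g \<Rightarrow> 'k::field fps \<Rightarrow> 'k fps"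
  assumes "CHAR('k) > 0" and "surj (\<lambda>x::'k. x ^ CHAR('k))"
    and "group G" and "finite (carrier G)"
    and "local_action G \<rho>"
    and "N \<lhd> G"
  defines "K \<equiv> kernel (H1G G \<rho>) (H1N G N \<rho> \<times>\<times> H1sharp G N \<rho>) (Phi_tangent G N \<rho>)"
  shows "(\<lambda>X. the_elem (infl_connecting G N \<rho> ` X)) \<in>
           iso (invariants (G Mod N) (Q1 G N \<rho>) (Q1_act \<rho>)
                  Mod (Q1_proj G N \<rho> ` carrier (invariants G (Theta1 G N \<rho>) \<rho>)))
               ((H1G G \<rho>)\<lparr>carrier := K\<rparr>)
       \<and> Phi_tangent G N \<rho> ` carrier (H1G G \<rho>) =
           {(a, b) \<in> carrier (H1N G N \<rho>) \<times> carrier (H1sharp G N \<rho>).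
              gamma_map G N \<rho> a = sigma_map G N \<rho> b}"
proof -
  interpret normal_fps_action G \<rho> N
    using assms(3-6)
    by (simp add: normal_fps_action_def faithful_fps_action_def fps_action_def fps_action_axioms_def
        faithful_fps_action_axioms_def local_action_def)
  interpret h: group_hom Q1inv "H1G G \<rho>" "infl_connecting G N \<rho>"
    by (rule infl_connecting_hom)
  \<comment> \<open>With the kernel of \<Phi> recognized as the image of the inflated connecting
    map, the first isomorphism theorem identifies it with the cokernel.\<close>
  have K: "K = infl_connecting G N \<rho> ` carrier Q1inv"
    by (simp add: K_def infl_connecting_image)
  have sub: "subgroup K (H1G G \<rho>)"
    unfolding K by (rule h.img_is_subgroup)
  interpret hK: group_hom Q1inv "(H1G G \<rho>)\<lparr>carrier := K\<rparr>" "infl_connecting G N \<rho>"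
    using subgroup.subgroup_is_group[OF sub h.H.is_group] h.homh
    by (simp add: group_hom_def group_hom_axioms_def h.G.group_axioms) (auto simp: hom_def K)
  have "kernel Q1inv ((H1G G \<rho>)\<lparr>carrier := K\<rparr>) (infl_connecting G N \<rho>)
      = Q1_proj G N \<rho> ` carrier (invariants G Th1 \<rho>)"
    using kernel_infl_connecting by (simp add: kernel_def)
  then have "(\<lambda>X. the_elem (infl_connecting G N \<rho> ` X)) \<in>
      iso (Q1inv Mod (Q1_proj G N \<rho> ` carrier (invariants G Th1 \<rho>))) ((H1G G \<rho>)\<lparr>carrier := K\<rparr>)"
    using hK.FactGroup_iso_set by (simp add: K)
  then show ?thesis using Phi_tangent_image by blast
qed

end
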